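(* Let $\mathfrak g=(\mathbb R Z\oplus\mathfrak u)\ltimes\mathfrak n$ be a real Lie algebra, where $\mathfrak u$ is a compact semisimple Lie algebra, $\mathfrak n$ is a nilpotent Lie algebra, and $Z$ is a non-zero element commuting with $\mathfrak u$. Assume that $\operatorname{ad}Z|_{\mathfrak n}$ is diagonalizable with positive eigenvalues and let $\mathfrak n=\mathfrak n^{(1)}\oplus\dots\oplus\mathfrak n^{(k)}$ be the corresponding decomposition into eigenspaces. If, for some $i$, some irreducible component of $\mathfrak n^{(i)}$ as a $\mathfrak u$-module admits a decomposition $V_1\oplus V_2$ and an inner product satisfying properties (1)–(6) listed in the context (for the representation of $\mathfrak u$ on that component), then $\mathfrak g$ admits an inner product with negative Ricci curvature.
   Context: All Lie algebras are finite-dimensional. A real Lie algebra is compact semisimple if its Killing form is negative definite. In $\mathfrak g=(\mathbb R Z\oplus\mathfrak u)\ltimes\mathfrak n$, $\mathfrak n$ is an ideal on which $\mathbb R Z\oplus\mathfrak u$ acts by derivations; each eigenspace $\mathfrak n^{(i)}$ is a $\mathfrak u$-submodule because $[Z,\mathfrak u]=0$. $\mathfrak u_{\mathbb C}=\mathfrak u\otimes_{\mathbb R}\mathbb C$, with Killing form $B$, Cartan subalgebra $\mathfrak h$, root system $\Delta$, a fixed positive system $\Delta^+$, and one-dimensional root spaces $(\mathfrak u_{\mathbb C})_\alpha$. For $\alpha\in\Delta$, $H_\alpha\in\mathfrak h$ is defined by $B(H,H_\alpha)=\alpha(H)$ for all $H\in\mathfrak h$; $\mathfrak h_{\mathbb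 R}$ is the real span of all $H_\alpha$. Root vectors $X_\alpha\in(\mathfrak u_{\mathbb C})_\alpha$ are chosen with $[X_\alpha,X_{-\alpha}]=H_\alpha$; $[X_\alpha,X_\beta]=N_{\alpha,\beta}X_{\alpha+\beta}$ if $\alpha+\beta\in\Delta$, with $N_{\alpha,\beta}=-N_{-\alpha,-\beta}\in\mathbb R$; $[X_\alpha,X_\beta]=0$ if $\alpha+\beta\neq0$ and $\alpha+\beta\notin\Delta$; and such that $\mathfrak u=\sum_{\alpha\in\Delta}\mathbb R\,iH_\alpha+\sum_{\alpha\in\Delta}\mathbb R X^\alpha+\sum_{\alpha\in\Delta}\mathbb R Y^\alpha$, where $X^\alpha=X_\alpha-X_{-\alpha}$ and $Y^\alpha=i(X_\alpha+X_{-\alpha})$ (this is always possible up to isomorphism, by uniqueness of compact real forms). Properties, for a real representation $(\pi,V)$ of $\mathfrak u$ with a decomposition $V=V_1\oplus V_2$ and an inner product $\langle\cdot,\cdot\rangle$ on $V$: (1) $V_1$ and $V_2$ are $i\mathfrak h_{\mathbb R}$-invariant. (2) $\pi(X^\alpha)(V_1)\subset V_2$ and $\pi(Y^\alpha)(V_1)\subset V_2$ for every $\alpha\in\Delta^+$. (3) $V_1$ is orthogonal to $V_2$. (4) $\pi(H)$ is a skew-symmetric operator of $V$ for every $H\in i\mathfrak h_{\mathbb R}$. (5) $\pi(X^\alpha)|_{V_1}$ and $\pi(Y^\alpha)|_{V_1}$ are non-zero for every $\alpha\in\Delta^+$. (6) $\operatorname{tr}\big((\pi(Y)|_{V_1})^t\,\pi(X)|_{V_1}\big)=0$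 whenever $X\neq Y$ are elements of $\{X^\alpha,Y^\alpha:\alpha\in\Delta^+\}$. An inner product on a real Lie algebra $\mathfrak g$ has negative Ricci curvature if the corresponding left-invariant Riemannian metric on the simply connected Lie group with Lie algebra $\mathfrak g$ has negative definite Ricci operator. *)

theory Defs
  imports "HOL-Analysis.Analysis" "HOL-Library.Function_Algebras"
begin

section \<open>Linear algebra on subspaces\<close>

text \<open>
  Everything that is needed both over the reals and over the complex numbers takes the scalar
  multiplication as a parameter, in the style of the locale \<^locale>\<open>vector_space\<close>.
\<close>

text \<open>The trace of an endomorphism of a finite-dimensional subspace \<open>V\<close>, read off from an
  arbitrary basis of \<open>V\<close>.\<close>

definition trace_on ::
  "('k::field \<Rightarrow> 'v::ab_group_add \<Rightarrow> 'v) \<Rightarrow> 'v set \<Rightarrow> ('v \<Rightarrow> 'v) \<Rightarrow> 'k" where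
  "trace_on smul V f =
     (let B = (SOME B. \<not> module.dependent smul B \<and> module.span smul B = V)
      in \<Sum>b\<in>B. module.representation smul B (f b) b)"

definition internal_direct_sum :: "'v::real_vector set \<Rightarrow> 'v set \<Rightarrow> 'v set \<Rightarrow> bool" where
  "internal_direct_sum V A B \<longleftrightarrow>
     subspace A \<and> subspace B \<and> A \<inter> B = {0} \<and> V = {a + b | a b. a \<in> A \<and> b \<in> B}"

definition diagonalizable_on :: "'v::real_vector set \<Rightarrow> ('v \<Rightarrow> 'v) \<Rightarrow> bool" where
  "diagonalizable_on V f \<longleftrightarrow>
     (\<exists>B. independent B \<and> span B = V \<and> (\<forall>b\<in>B. \<exists>c. f b = c *\<^sub>R b))"

definition eigenspace_on :: "'v::real_vector set \<Rightarrow> ('v \<Rightarrow> 'v) \<Rightarrow> real \<Rightarrow> 'v set" where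
  "eigenspace_on V f c = {v \<in> V. f v = c *\<^sub>R v}"

definition inner_product_on :: "'v::real_vector set \<Rightarrow> ('v \<Rightarrow> 'v \<Rightarrow> real) \<Rightarrow> bool" where
  "inner_product_on V ip \<longleftrightarrow>
     (\<forall>x\<in>V. \<forall>y\<in>V. \<forall>z\<in>V. ip (x + y) z = ip x z + ip y z) \<and>
     (\<forall>a. \<forall>x\<in>V. \<forall>y\<in>V. ip (a *\<^sub>R x) y = a * ip x y) \<and>
     (\<forall>x\<in>V. \<forall>y\<in>V. ip x y = ip y x) \<and>
     (\<forall>x\<in>V. x \<noteq> 0 \<longrightarrow> 0 < ip x x)"

text \<open>The transpose \<open>V \<rightarrow> W\<close> of a linear map \<open>A : W \<rightarrow> V\<close>, where both spaces carry \<open>ip\<close>.\<close>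

definition transpose_on ::
  "('v::real_vector \<Rightarrow> 'v \<Rightarrow> real) \<Rightarrow> 'v set \<Rightarrow> ('v \<Rightarrow> 'v) \<Rightarrow> 'v \<Rightarrow> 'v" where
  "transpose_on ip W A y = (THE z. z \<in> W \<and> (\<forall>w\<in>W. ip (A w) y = ip w z))"

section \<open>Lie algebras\<close>

definition real_lie_algebra :: "('g::real_vector \<Rightarrow> 'g \<Rightarrow> 'g) \<Rightarrow> bool" where
  "real_lie_algebra br \<longleftrightarrow>
     (\<exists>B::'g set. finite B \<and> span B = UNIV) \<and>
     bilinear br \<and>
     (\<forall>x. br x x = 0) \<and>
     (\<forall>x y z. br x (br y z) + br y (br z x) + br z (br x y) = 0)"

definition lie_subalgebra ::
  "('k::field \<Rightarrow> 'v::ab_group_add \<Rightarrow> 'v) \<Rightarrow> ('v \<Rightarrow> 'v \<Rightarrow> 'v) \<Rightarrow> 'v set \<Rightarrow> bool" where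
  "lie_subalgebra smul br L \<longleftrightarrow>
     module.subspace smul L \<and> (\<forall>x\<in>L. \<forall>y\<in>L. br x y \<in> L)"

definition lie_ideal :: "('g::real_vector \<Rightarrow> 'g \<Rightarrow> 'g) \<Rightarrow> 'g set \<Rightarrow> bool" where
  "lie_ideal br I \<longleftrightarrow> subspace I \<and> (\<forall>x. \<forall>y\<in>I. br x y \<in> I)"

primrec lower_central_series ::
  "('k::field \<Rightarrow> 'v::ab_group_add \<Rightarrow> 'v) \<Rightarrow> ('v \<Rightarrow> 'v \<Rightarrow> 'v) \<Rightarrow> 'v set \<Rightarrow> nat \<Rightarrow> 'v set" where
  "lower_central_series smul br L 0 = L"
| "lower_central_series smul br L (Suc i) =
     module.span smul {br x y | x y. x \<in> L \<and> y \<in> lower_central_series smul br L i}"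

definition lie_nilpotent ::
  "('k::field \<Rightarrow> 'v::ab_group_add \<Rightarrow> 'v) \<Rightarrow> ('v \<Rightarrow> 'v \<Rightarrow> 'v) \<Rightarrow> 'v set \<Rightarrow> bool" where
  "lie_nilpotent smul br L \<longleftrightarrow> (\<exists>i. lower_central_series smul br L i = {0})"

definition killing_form ::
  "('k::field \<Rightarrow> 'v::ab_group_add \<Rightarrow> 'v) \<Rightarrow> ('v \<Rightarrow> 'v \<Rightarrow> 'v) \<Rightarrow> 'v set \<Rightarrow> 'v \<Rightarrow> 'v \<Rightarrow> 'k" where
  "killing_form smul br L x y = trace_on smul L (\<lambda>z. br x (br y z))"

definition compact_semisimple :: "('g::real_vector \<Rightarrow> 'g \<Rightarrow> 'g) \<Rightarrow> 'g set \<Rightarrow> bool" where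
  "compact_semisimple br u \<longleftrightarrow>
     lie_subalgebra scaleR br u \<and> (\<forall>x\<in>u. x \<noteq> 0 \<longrightarrow> killing_form scaleR br u x x < 0)"

section \<open>Ricci curvature of a left-invariant metric\<close>

text \<open>
  Left-invariant Riemannian metrics on the simply connected Lie group of \<open>\<gg>\<close> correspond to inner
  products on \<open>\<gg>\<close>, and all curvature tensors are determined by their values on left-invariant
  fields, i.e. on \<open>\<gg>\<close>.  On left-invariant fields the derivative terms of Koszul's formula vanish,
  which leaves the defining equation of \<open>levi_civita\<close>:
  \<open>2 \<langle>\<nabla>\<^sub>x y, z\<rangle> = \<langle>[x,y],z\<rangle> - \<langle>[y,z],x\<rangle> + \<langle>[z,x],y\<rangle>\<close>.
  The conventions are \<open>R(x,y) = \<nabla>\<^sub>x\<nabla>\<^sub>y - \<nabla>\<^sub>y\<nabla>\<^sub>x - \<nabla>\<^bsub>[x,y]\<^esub>\<close> and \<open>ric(x,y) = tr (w \<mapsto> R(w,x)y)\<close>, so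
  that round spheres have positive Ricci curvature.
\<close>

definition levi_civita ::
  "('g::real_vector \<Rightarrow> 'g \<Rightarrow> 'g) \<Rightarrow> ('g \<Rightarrow> 'g \<Rightarrow> real) \<Rightarrow> 'g \<Rightarrow> 'g \<Rightarrow> 'g" where
  "levi_civita br ip x y =
     (THE w. \<forall>z. 2 * ip w z = ip (br x y) z - ip (br y z) x + ip (br z x) y)"

definition riemann_curvature ::
  "('g::real_vector \<Rightarrow> 'g \<Rightarrow> 'g) \<Rightarrow> ('g \<Rightarrow> 'g \<Rightarrow> real) \<Rightarrow> 'g \<Rightarrow> 'g \<Rightarrow> 'g \<Rightarrow> 'g" where
  "riemann_curvature br ip x y z =
     levi_civita br ip x (levi_civita br ip y z)
     - levi_civita br ip y (levi_civita br ip x z)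
     - levi_civita br ip (br x y) z"

definition ricci_tensor ::
  "('g::real_vector \<Rightarrow> 'g \<Rightarrow> 'g) \<Rightarrow> ('g \<Rightarrow> 'g \<Rightarrow> real) \<Rightarrow> 'g \<Rightarrow> 'g \<Rightarrow> real" where
  "ricci_tensor br ip x y = trace_on scaleR UNIV (\<lambda>w. riemann_curvature br ip w x y)"

definition ricci_operator ::
  "('g::real_vector \<Rightarrow> 'g \<Rightarrow> 'g) \<Rightarrow> ('g \<Rightarrow> 'g \<Rightarrow> real) \<Rightarrow> 'g \<Rightarrow> 'g" where
  "ricci_operator br ip x = (THE w. \<forall>y. ip w y = ricci_tensor br ip x y)"

definition negative_ricci ::
  "('g::real_vector \<Rightarrow> 'g \<Rightarrow> 'g) \<Rightarrow> ('g \<Rightarrow> 'g \<Rightarrow> real) \<Rightarrow> bool" where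
  "negative_ricci br ip \<longleftrightarrow> (\<forall>x. x \<noteq> 0 \<longrightarrow> ip (ricci_operator br ip x) x < 0)"

section \<open>Complexification\<close>

text \<open>
  The pair \<open>(x, y)\<close> stands for \<open>x + \<i> y\<close>.  The complexification of a subspace \<open>u\<close> is \<open>u \<times> u\<close>, and
  \<open>u\<close> sits in it as \<open>u \<times> {0}\<close>.
\<close>

definition complex_scale :: "complex \<Rightarrow> 'g::real_vector \<times> 'g \<Rightarrow> 'g \<times> 'g" where
  "complex_scale c p = (Re c *\<^sub>R fst p - Im c *\<^sub>R snd p, Re c *\<^sub>R snd p + Im c *\<^sub>R fst p)"

definition complex_bracket ::
  "('g::real_vector \<Rightarrow> 'g \<Rightarrow> 'g) \<Rightarrow> 'g \<times> 'g \<Rightarrow> 'g \<times> 'g \<Rightarrow> 'g \<times> 'g" where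
  "complex_bracket br p q =
     (br (fst p) (fst q) - br (snd p) (snd q), br (fst p) (snd q) + br (snd p) (fst q))"

lemma vector_space_complex_scale: "vector_space complex_scale"
  by unfold_locales (auto simp: complex_scale_def algebra_simps)

lemma complex_scale_of_real: "complex_scale (of_real r) p = r *\<^sub>R p"
  by (simp add: complex_scale_def prod_eq_iff)

section \<open>Roots\<close>

definition cartan_subalgebra ::
  "('k::field \<Rightarrow> 'v::ab_group_add \<Rightarrow> 'v) \<Rightarrow> ('v \<Rightarrow> 'v \<Rightarrow> 'v) \<Rightarrow> 'v set \<Rightarrow> 'v set \<Rightarrow> bool" where
  "cartan_subalgebra smul br L h \<longleftrightarrow>
     h \<subseteq> L \<and> lie_subalgebra smul br h \<and> lie_nilpotent smul br h \<and>
     (\<forall>x\<in>L. (\<forall>y\<in>h. br x y \<in> h) \<longrightarrow> x \<in> h)"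

text \<open>Linear functionals on \<open>h\<close> are represented by functions on the ambient type that vanish
  outside \<open>h\<close>, so that equal functionals are equal functions and sums and negatives of functionals
  are the pointwise ones.\<close>

definition dual_on ::
  "('k::field \<Rightarrow> 'v::ab_group_add \<Rightarrow> 'v) \<Rightarrow> 'v set \<Rightarrow> ('v \<Rightarrow> 'k) set" where
  "dual_on smul h =
     {\<alpha>. (\<forall>x\<in>h. \<forall>y\<in>h. \<alpha> (x + y) = \<alpha> x + \<alpha> y) \<and> (\<forall>c. \<forall>x\<in>h. \<alpha> (smul c x) = c * \<alpha> x) \<and>
         (\<forall>x. x \<notin> h \<longrightarrow> \<alpha> x = 0)}"

definition root_space ::
  "('k::field \<Rightarrow> 'v::ab_group_add \<Rightarrow> 'v) \<Rightarrow> ('v \<Rightarrow> 'v \<Rightarrow> 'v) \<Rightarrow> 'v set \<Rightarrow> 'v set \<Rightarrow>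
     ('v \<Rightarrow> 'k) \<Rightarrow> 'v set" where
  "root_space smul br L h \<alpha> = {x \<in> L. \<forall>H\<in>h. br H x = smul (\<alpha> H) x}"

definition root_system ::
  "('k::field \<Rightarrow> 'v::ab_group_add \<Rightarrow> 'v) \<Rightarrow> ('v \<Rightarrow> 'v \<Rightarrow> 'v) \<Rightarrow> 'v set \<Rightarrow> 'v set \<Rightarrow>
     ('v \<Rightarrow> 'k) set" where
  "root_system smul br L h =
     {\<alpha> \<in> dual_on smul h. \<alpha> \<noteq> 0 \<and> root_space smul br L h \<alpha> \<noteq> {0}}"

definition positive_system :: "('v \<Rightarrow> 'k::ab_group_add) set \<Rightarrow> ('v \<Rightarrow> 'k) set \<Rightarrow> bool" where
  "positive_system \<Delta> P \<longleftrightarrow>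
     P \<subseteq> \<Delta> \<and> (\<forall>\<alpha>\<in>\<Delta>. \<alpha> \<in> P \<longleftrightarrow> - \<alpha> \<notin> P) \<and>
     (\<forall>\<alpha>\<in>P. \<forall>\<beta>\<in>P. \<alpha> + \<beta> \<in> \<Delta> \<longrightarrow> \<alpha> + \<beta> \<in> P)"

text \<open>For root vectors \<open>X\<close>: the vectors \<open>X\<^sup>\<alpha> = X\<^sub>\<alpha> - X\<^bsub>-\<alpha>\<^esub>\<close> and \<open>Y\<^sup>\<alpha> = \<i> (X\<^sub>\<alpha> + X\<^bsub>-\<alpha>\<^esub>)\<close>
  of the complexification.\<close>

definition X_up :: "(('v \<Rightarrow> complex) \<Rightarrow> 'g::real_vector \<times> 'g) \<Rightarrow> ('v \<Rightarrow> complex) \<Rightarrow> 'g \<times> 'g" where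
  "X_up X \<alpha> = X \<alpha> - X (- \<alpha>)"

definition Y_up :: "(('v \<Rightarrow> complex) \<Rightarrow> 'g::real_vector \<times> 'g) \<Rightarrow> ('v \<Rightarrow> complex) \<Rightarrow> 'g \<times> 'g" where
  "Y_up X \<alpha> = complex_scale \<i> (X \<alpha> + X (- \<alpha>))"

text \<open>\<open>h\<close> is a Cartan subalgebra of the complexification of \<open>u\<close>, \<open>\<Delta>\<close> its root system, \<open>P\<close> the
  positive system, \<open>Hr \<alpha>\<close> and \<open>X \<alpha>\<close> are the vectors \<open>H\<^sub>\<alpha>\<close> and \<open>X\<^sub>\<alpha>\<close>; their values at arguments that
  are not roots are irrelevant.\<close>

locale compact_root_data =
  fixes br :: "'g::real_vector \<Rightarrow> 'g \<Rightarrow> 'g"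
    and u :: "'g set"
    and h :: "('g \<times> 'g) set"
    and \<Delta> :: "('g \<times> 'g \<Rightarrow> complex) set"
    and P :: "('g \<times> 'g \<Rightarrow> complex) set"
    and Hr :: "('g \<times> 'g \<Rightarrow> complex) \<Rightarrow> 'g \<times> 'g"
    and X :: "('g \<times> 'g \<Rightarrow> complex) \<Rightarrow> 'g \<times> 'g"
  assumes cartan: "cartan_subalgebra complex_scale (complex_bracket br) (u \<times> u) h"
    and roots: "\<Delta> = root_system complex_scale (complex_bracket br) (u \<times> u) h"
    and positive: "positive_system \<Delta> P"
    and Hr_mem: "\<alpha> \<in> \<Delta> \<Longrightarrow> Hr \<alpha> \<in> h"
    and Hr_dual: "\<alpha> \<in> \<Delta> \<Longrightarrow> H \<in> h \<Longrightarrow>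
      killing_form complex_scale (complex_bracket br) (u \<times> u) H (Hr \<alpha>) = \<alpha> H"
    and X_root_space: "\<alpha> \<in> \<Delta> \<Longrightarrow>
      X \<alpha> \<in> root_space complex_scale (complex_bracket br) (u \<times> u) h \<alpha>"
    and X_opposite: "\<alpha> \<in> \<Delta> \<Longrightarrow> complex_bracket br (X \<alpha>) (X (- \<alpha>)) = Hr \<alpha>"
    and X_sum: "\<exists>N :: ('g \<times> 'g \<Rightarrow> complex) \<Rightarrow> ('g \<times> 'g \<Rightarrow> complex) \<Rightarrow> real.
      \<forall>\<alpha>\<in>\<Delta>. \<forall>\<beta>\<in>\<Delta>. \<alpha> + \<beta> \<in> \<Delta> \<longrightarrow>
        complex_bracket br (X \<alpha>) (X \<beta>) = complex_scale (of_real (N \<alpha> \<beta>)) (X (\<alpha> + \<beta>)) \<and>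
        N \<alpha> \<beta> = - N (- \<alpha>) (- \<beta>)"
    and X_zero: "\<alpha> \<in> \<Delta> \<Longrightarrow> \<beta> \<in> \<Delta> \<Longrightarrow> \<alpha> + \<beta> \<noteq> 0 \<Longrightarrow> \<alpha> + \<beta> \<notin> \<Delta> \<Longrightarrow>
      complex_bracket br (X \<alpha>) (X \<beta>) = 0"
    and real_form: "u \<times> {0} =
      span ((\<lambda>\<alpha>. complex_scale \<i> (Hr \<alpha>)) ` \<Delta> \<union> X_up X ` \<Delta> \<union> Y_up X ` \<Delta>)"

section \<open>Modules and the conditions on an irreducible component\<close>

definition submodule ::
  "('u \<Rightarrow> 'v \<Rightarrow> 'v) \<Rightarrow> 'u set \<Rightarrow> 'v::real_vector set \<Rightarrow> bool" where
  "submodule \<pi> u W \<longleftrightarrow> subspace W \<and> (\<forall>x\<in>u. \<forall>w\<in>W. \<pi> x w \<in> W)"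

definition irreducible_module ::
  "('u \<Rightarrow> 'v \<Rightarrow> 'v) \<Rightarrow> 'u set \<Rightarrow> 'v::real_vector set \<Rightarrow> bool" where
  "irreducible_module \<pi> u V \<longleftrightarrow>
     submodule \<pi> u V \<and> V \<noteq> {0} \<and> (\<forall>W. submodule \<pi> u W \<and> W \<subseteq> V \<longrightarrow> W = {0} \<or> W = V)"

text \<open>\<open>V\<close> is one of the summands in a direct sum decomposition of \<open>M\<close> into irreducible
  submodules.\<close>

definition irreducible_component ::
  "('u \<Rightarrow> 'v \<Rightarrow> 'v) \<Rightarrow> 'u set \<Rightarrow> 'v::real_vector set \<Rightarrow> 'v set \<Rightarrow> bool" where
  "irreducible_component \<pi> u M V \<longleftrightarrow>
     (\<exists>\<W>. finite \<W> \<and> V \<in> \<W> \<and> (\<forall>W\<in>\<W>. irreducible_module \<pi> u W) \<and>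
       M = span (\<Union>\<W>) \<and>
       (\<forall>f. (\<forall>W\<in>\<W>. f W \<in> W) \<and> (\<Sum>W\<in>\<W>. f W) = 0 \<longrightarrow> (\<forall>W\<in>\<W>. f W = 0)))"

text \<open>
  \<open>T\<close> is the real abelian subalgebra \<open>\<i> h\<^sub>\<real>\<close> of \<open>u\<close>, and \<open>XU \<alpha>\<close>, \<open>YU \<alpha>\<close> are the elements \<open>X\<^sup>\<alpha>\<close>, \<open>Y\<^sup>\<alpha>\<close>
  of \<open>u\<close>.
\<close>

definition adapted_decomposition ::
  "('u \<Rightarrow> 'v \<Rightarrow> 'v) \<Rightarrow> 'u set \<Rightarrow> 'r set \<Rightarrow> ('r \<Rightarrow> 'u) \<Rightarrow> ('r \<Rightarrow> 'u) \<Rightarrow>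
     'v::real_vector set \<Rightarrow> 'v set \<Rightarrow> 'v set \<Rightarrow> ('v \<Rightarrow> 'v \<Rightarrow> real) \<Rightarrow> bool" where
  "adapted_decomposition \<pi> T P XU YU V V1 V2 ip \<longleftrightarrow>
     internal_direct_sum V V1 V2 \<and> inner_product_on V ip \<and>
     (\<forall>H\<in>T. \<pi> H ` V1 \<subseteq> V1 \<and> \<pi> H ` V2 \<subseteq> V2) \<and>
     (\<forall>\<alpha>\<in>P. \<pi> (XU \<alpha>) ` V1 \<subseteq> V2 \<and> \<pi> (YU \<alpha>) ` V1 \<subseteq> V2) \<and>
     (\<forall>v\<in>V1. \<forall>w\<in>V2. ip v w = 0) \<and>
     (\<forall>H\<in>T. \<forall>v\<in>V. \<forall>w\<in>V. ip (\<pi> H v) w = - ip v (\<pi> H w)) \<and>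
     (\<forall>\<alpha>\<in>P. (\<exists>v\<in>V1. \<pi> (XU \<alpha>) v \<noteq> 0) \<and> (\<exists>v\<in>V1. \<pi> (YU \<alpha>) v \<noteq> 0)) \<and>
     (\<forall>A \<in> XU ` P \<union> YU ` P. \<forall>B \<in> XU ` P \<union> YU ` P. A \<noteq> B \<longrightarrow>
        trace_on scaleR V1 (\<lambda>v. transpose_on ip V1 (\<pi> B) (\<pi> A v)) = 0)"

end

theory Submission
  imports Defs
begin

text \<open>
  Fix an inner product with orthonormal basis \<open>e\<close>, let \<open>S\<close> be the symmetric part of \<open>ad x\<close> and let
  \<open>\<langle>H, y\<rangle> = tr (ad y)\<close>.  Then
  \<open>ric(x,x) = - |S|\<^sup>2 + 1/4 \<Sum> \<langle>[e\<^sub>i, e\<^sub>j], x\<rangle>\<^sup>2 - \<langle>[H, x], x\<rangle>\<close> (lemma \<open>ricci_tensor_diagonal\<close>).  This is a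
  quadratic form in \<open>x\<close> whose coefficients are polynomials in the structure constants, so negative
  definiteness is an open condition on the structure constants (\<open>ricci_form_negative_open\<close>).  It
  suffices to rescale a basis so that the structure constants converge to an array for which the
  form is negative definite (\<open>negative_ricci_by_degeneration\<close>).

  Let \<open>T = \<i> h\<^sub>\<real>\<close>, let \<open>M\<close> be the set of all \<open>X\<^sup>\<alpha>\<close> and \<open>Y\<^sup>\<alpha>\<close> with \<open>\<alpha>\<close> positive, and let \<open>W\<close> be a complement of
  the given component \<open>V = V\<^sub>1 + V\<^sub>2\<close> in \<open>\<nn>\<close>, invariant under \<open>\<uu>\<close> and \<open>Z\<close>.  The Killing form of \<open>\<uu>\<close> shows that
  \<open>M\<close> and a basis of \<open>T\<close> form a basis of \<open>\<uu>\<close>, and that \<open>T\<close> is abelian and rotates the planes spanned by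
  \<open>X\<^sup>\<alpha>\<close> and \<open>Y\<^sup>\<alpha>\<close>.  Give \<open>Z\<close> and \<open>T\<close> the weight 0, \<open>M\<close> the weight 1, \<open>V\<^sub>1\<close> and \<open>W\<close> the weight 2 and \<open>V\<^sub>2\<close> the
  weight 3, and multiply a basis vector of weight \<open>w\<close> by \<open>t\<^bsup>-w\<^esup>\<close>.  Since \<open>T\<close> preserves \<open>V\<^sub>1\<close> and \<open>V\<^sub>2\<close>,
  no structure constant grows with \<open>t\<close>.  In the limit the actions of \<open>Z\<close> and \<open>T\<close> are unchanged, an element of \<open>M\<close> acts
  on \<open>\<nn>\<close> only by the given map from \<open>V\<^sub>1\<close> to \<open>V\<^sub>2\<close>, and all brackets within \<open>M\<close> and within \<open>\<nn>\<close> vanish.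

  For this limit the Ricci form is bounded by a sum of four forms (\<open>ricci_form_bound\<close>).

  \<^item> On \<open>\<nn>\<close> the mean curvature term dominates: \<open>H\<close> is a positive multiple of \<open>Z\<close>, because \<open>T\<close> acts with
    trace zero and \<open>M\<close> nilpotently, and \<open>ad Z\<close> has positive eigenvalues on \<open>\<nn>\<close>.

  \<^item> On \<open>M\<close> the leading part is minus the squared norm of the symmetric part of the action on \<open>\<nn>\<close>.  It is
    diagonal because the maps from \<open>V\<^sub>1\<close> to \<open>V\<^sub>2\<close> are orthogonal, and its diagonal entries are negative because
    the symmetric part of a nonzero map from \<open>V\<^sub>1\<close> to \<open>V\<^sub>2\<close> does not vanish.

  \<^item> On \<open>T\<close> there is the obstacle that with respect to an invariant inner product \<open>T\<close> acts on \<open>M\<close> by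
    skew maps, whose symmetric part is zero.  The remedy is to give \<open>X\<^sup>\<alpha>\<close> and \<open>Y\<^sup>\<alpha>\<close> different lengths.  The
    symmetric part is then nonzero for every nonzero element of \<open>T\<close>, because the roots separate
    the points of \<open>T\<close>.

  \<^item> On \<open>Z\<close> it is minus the squared norm of \<open>ad Z\<close>.

  The remaining terms are quadratic in scaling factors \<open>\<delta>\<close> of \<open>M\<close> and \<open>\<epsilon>\<close> of \<open>T\<close>, and are absorbed by first
  taking \<open>\<delta>\<close> and then \<open>\<epsilon>\<close> small (\<open>negative_ricci_exists\<close>).
\<close>

section \<open>Traces of endomorphisms of a subspace\<close>

text \<open>Expand each element of \<open>B\<close> in the basis chosen by the definition of the trace, and each image in
  \<open>B\<close>: both diagonal sums become the same double sum.  The map only has to be linear on \<open>V\<close>, so that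
  the lemma applies to transposes, which are meaningless outside \<open>V\<close>.\<close>

lemma (in vector_space) trace_on_basis:
  assumes fin: "finite B" and ind: "independent B" and spn: "span B = V"
    and add: "\<And>x y. x \<in> V \<Longrightarrow> y \<in> V \<Longrightarrow> f (x + y) = f x + f y"
    and hom: "\<And>c x. x \<in> V \<Longrightarrow> f (scale c x) = scale c (f x)"
    and into: "\<And>x. x \<in> V \<Longrightarrow> f x \<in> V"
  shows "trace_on scale V f = (\<Sum>b\<in>B. representation B (f b) b)"
proof -
  define A where "A = (SOME B. independent B \<and> span B = V)"
  have "independent A \<and> span A = V"
    unfolding A_def by (rule someI[of "\<lambda>B. independent B \<and> span B = V" B]) (simp add: ind spn)
  then have A: "independent A" "span A = V" by auto
  have finA: "finite A"
    using independent_span_bound[OF fin A(1)] span_superset[of A] A(2) spn by auto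
  have tr: "trace_on scale V f = (\<Sum>b\<in>A. representation A (f b) b)"
    by (simp add: trace_on_def A_def Let_def)
  have zero: "f 0 = 0"
    using hom[of 0 0] spn span_zero by fastforce
  have f_sum: "f (\<Sum>b\<in>D. scale (r b) b) = (\<Sum>b\<in>D. scale (r b) (f b))" if "finite D" "D \<subseteq> V" for D r
    using that
  proof (induction D)
    case empty then show ?case by (simp add: zero)
  next
    case (insert x D)
    have "(\<Sum>b\<in>D. scale (r b) b) \<in> V"
      using insert.prems spn by (auto intro!: span_sum span_scale)
    moreover have "scale (r x) x \<in> V" using insert.prems spn by (auto intro: span_scale)
    ultimately show ?case using insert by (simp add: add hom)
  qed
  have AV: "A \<subseteq> V" using A span_superset by blast
  have BV: "B \<subseteq> V" using spn span_superset by blast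
  have expand: "representation B (f b) b = (\<Sum>a\<in>A. representation A b a * representation B (f a) b)"
    if "b \<in> B" for b
  proof -
    have "b = (\<Sum>a\<in>A. scale (representation A b a) a)"
      using sum_representation_eq[OF A(1) _ finA subset_refl] A that BV by auto
    then have "f b = (\<Sum>a\<in>A. scale (representation A b a) (f a))"
      using f_sum[OF finA AV] by metis
    moreover have "f a \<in> span B" if "a \<in> A" for a using into AV spn that by auto
    ultimately show ?thesis
      by (simp add: representation_sum[OF ind] representation_scale[OF ind] span_scale)
  qed
  have expand': "representation A (f a) a = (\<Sum>b\<in>B. representation B (f a) b * representation A b a)"
    if "a \<in> A" for a
  proof -
    have fa: "f a \<in> span B" using into AV spn that by auto
    have "f a = (\<Sum>b\<in>B. scale (representation B (f a) b) b)"
      using sum_representation_eq[OF ind fa fin subset_refl] by simp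
    then have "representation A (f a) a = representation A (\<Sum>b\<in>B. scale (representation B (f a) b) b) a"
      by simp
    also have "\<dots> = (\<Sum>b\<in>B. representation A (scale (representation B (f a) b) b) a)"
      using BV A by (subst representation_sum[OF A(1)]) (auto intro: span_scale)
    also have "\<dots> = (\<Sum>b\<in>B. representation B (f a) b * representation A b a)"
      using BV A by (intro sum.cong refl) (auto simp: representation_scale[OF A(1)])
    finally show ?thesis .
  qed
  have "(\<Sum>b\<in>B. representation B (f b) b)
      = (\<Sum>b\<in>B. \<Sum>a\<in>A. representation A b a * representation B (f a) b)"
    using expand by simp
  also have "\<dots> = (\<Sum>a\<in>A. \<Sum>b\<in>B. representation B (f a) b * representation A b a)"
    by (subst sum.swap) (simp add: mult.commute)
  also have "\<dots> = (\<Sum>a\<in>A. representation A (f a) a)"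
    using expand' by simp
  finally show ?thesis using tr by simp
qed

lemma (in vector_space) representation_sum_scale:
  assumes "finite B" "independent B" "b \<in> B"
  shows "representation B (\<Sum>a\<in>B. scale (r a) a) b = r b"
proof -
  have "representation B (\<Sum>a\<in>B. scale (r a) a) b = (\<Sum>a\<in>B. representation B (scale (r a) a) b)"
    by (subst representation_sum[OF assms(2)]) (auto intro: span_scale span_base)
  also have "\<dots> = (\<Sum>a\<in>B. if a = b then r b else 0)"
    using assms
    by (intro sum.cong refl) (auto simp: representation_scale span_base representation_basis)
  finally show ?thesis using assms by simp
qed

lemma finite_basis_subspace:
  fixes V :: "'v::real_vector set"
  assumes "finite F" "V \<subseteq> span F" "subspace V"
  obtains B where "finite B" "independent B" "span B = V"
proof -
  obtain B where B: "B \<subseteq> V" "independent B" "V \<subseteq> span B"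
    using real_vector.maximal_independent_subset[of V] by auto
  have "span B = V" using B assms(3) by (simp add: span_minimal subset_antisym)
  moreover have "finite B"
    using real_vector.independent_span_bound[OF assms(1) B(2)] B(1) assms(2) by auto
  ultimately show ?thesis using that B by blast
qed

text \<open>Finite dimension is assumed for the subspace alone, since the ambient type carries no dimension.\<close>

locale finite_subspace =
  fixes V :: "'v::real_vector set"
  assumes basis: "\<exists>B. finite B \<and> independent B \<and> span B = V"
begin

lemma trace_on_linear_basis:
  assumes "finite B" "independent B" "span B = V" "linear f" "f ` V \<subseteq> V"
  shows "trace_on scaleR V f = (\<Sum>b\<in>B. representation B (f b) b)"
  using assms
  by (intro real_vector.trace_on_basis) (auto simp: linear_add linear_scale)

lemma trace_on_diff:
  assumes "linear f" "f ` V \<subseteq> V" "linear g" "g ` V \<subseteq> V"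
  shows "trace_on scaleR V (\<lambda>x. f x - g x) = trace_on scaleR V f - trace_on scaleR V g"
proof -
  obtain B where B: "finite B" "independent B" "span B = V" using basis by blast
  have fg: "linear (\<lambda>x. f x - g x)" using assms by (simp add: linear_compose_sub)
  have sub: "(\<lambda>x. f x - g x) ` V \<subseteq> V" using assms B(3) by (auto intro!: span_diff)
  have "representation B (f b - g b) b = representation B (f b) b - representation B (g b) b"
    if "b \<in> B" for b
  proof -
    have "f b \<in> span B" "g b \<in> span B" using span_base[OF that] assms(2,4) B(3) by blast+
    then show ?thesis by (simp add: real_vector.representation_diff[OF B(2)])
  qed
  then show ?thesis
    by (simp add: trace_on_linear_basis[OF B fg sub] trace_on_linear_basis[OF B assms(1,2)]
        trace_on_linear_basis[OF B assms(3,4)] sum_subtractf)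
qed

lemma trace_on_add:
  assumes "linear f" "f ` V \<subseteq> V" "linear g" "g ` V \<subseteq> V"
  shows "trace_on scaleR V (\<lambda>x. f x + g x) = trace_on scaleR V f + trace_on scaleR V g"
proof -
  have B: "subspace V" using basis by auto
  have "linear (\<lambda>x. f x + g x)" using assms by (simp add: linear_compose_add)
  moreover have "(\<lambda>x. f x + g x) ` V \<subseteq> V" using assms B by (auto intro!: subspace_add)
  ultimately have "trace_on scaleR V (\<lambda>x. (f x + g x) - g x)
      = trace_on scaleR V (\<lambda>x. f x + g x) - trace_on scaleR V g"
    by (rule trace_on_diff[OF _ _ assms(3,4)])
  then show ?thesis by simp
qed

lemma trace_on_scale:
  assumes "linear f" "f ` V \<subseteq> V"
  shows "trace_on scaleR V (\<lambda>x. c *\<^sub>R f x) = c * trace_on scaleR V f"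
proof -
  obtain B where B: "finite B" "independent B" "span B = V" using basis by blast
  have fg: "linear (\<lambda>x. c *\<^sub>R f x)" using assms by (simp add: linear_compose_scale_right)
  have sub: "(\<lambda>x. c *\<^sub>R f x) ` V \<subseteq> V" using assms B(3) by (auto intro!: span_scale)
  have "representation B (c *\<^sub>R f b) b = c * representation B (f b) b" if "b \<in> B" for b
  proof -
    have "f b \<in> span B" using span_base[OF that] assms(2) B(3) by blast
    then show ?thesis by (simp add: real_vector.representation_scale[OF B(2)])
  qed
  then show ?thesis
    by (simp add: trace_on_linear_basis[OF B fg sub] trace_on_linear_basis[OF B assms(1,2)]
        sum_distrib_left)
qed

lemma trace_on_commute:
  assumes "linear f" "f ` V \<subseteq> V" "linear g" "g ` V \<subseteq> V"
  shows "trace_on scaleR V (\<lambda>x. f (g x)) = trace_on scaleR V (\<lambda>x. g (f x))"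
proof -
  obtain B where B: "finite B" "independent B" "span B = V" using basis by blast
  have key: "trace_on scaleR V (\<lambda>x. f (g x))
      = (\<Sum>b\<in>B. \<Sum>a\<in>B. representation B (g b) a * representation B (f a) b)"
    if fg: "linear f" "f ` V \<subseteq> V" "linear g" "g ` V \<subseteq> V" for f g
  proof -
    have "representation B (f (g b)) b = (\<Sum>a\<in>B. representation B (g b) a * representation B (f a) b)"
      if "b \<in> B" for b
    proof -
      have in_span: "f a \<in> span B" "g a \<in> span B" if "a \<in> B" for a
        using span_base[OF that] fg(2,4) B(3) by blast+
      then have "g b = (\<Sum>a\<in>B. representation B (g b) a *\<^sub>R a)"
        using real_vector.sum_representation_eq[OF B(2) _ B(1) subset_refl, of "g b"] that by simp
      then have "f (g b) = f (\<Sum>a\<in>B. representation B (g b) a *\<^sub>R a)" by simp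
      also have "\<dots> = (\<Sum>a\<in>B. representation B (g b) a *\<^sub>R f a)"
        by (simp add: linear_sum[OF fg(1)] linear_scale[OF fg(1)])
      finally show ?thesis
        using in_span
        by (simp add: real_vector.representation_sum[OF B(2)] real_vector.representation_scale[OF B(2)]
            span_scale)
    qed
    moreover have "linear (\<lambda>x. f (g x))" using linear_compose[OF fg(3,1)] by (simp add: o_def)
    moreover have "(\<lambda>x. f (g x)) ` V \<subseteq> V" using fg by auto
    ultimately show ?thesis by (simp add: trace_on_linear_basis[OF B])
  qed
  show ?thesis
    unfolding key[OF assms] key[OF assms(3,4,1,2)]
    by (subst sum.swap) (simp add: mult.commute)
qed

end

section \<open>The Ricci form in an orthonormal frame\<close>

locale orthonormal_frame =
  fixes ip :: "'g::real_vector \<Rightarrow> 'g \<Rightarrow> real" and E :: "'g set"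
  assumes inner: "inner_product_on UNIV ip" and finite_E: "finite E" and span_E: "span E = UNIV"
    and orthonormal: "\<And>a b. a \<in> E \<Longrightarrow> b \<in> E \<Longrightarrow> ip a b = (if a = b then 1 else 0)"
begin

lemma ip_commute: "ip x y = ip y x"
  using inner by (simp add: inner_product_on_def)

lemma ip_linear: "linear (ip x)" "linear (\<lambda>x. ip x y)"
proof -
  show "linear (\<lambda>x. ip x y)" for y
    using inner by (intro linearI) (auto simp: inner_product_on_def)
  moreover have "ip x = (\<lambda>y. ip y x)" using ip_commute by auto
  ultimately show "linear (ip x)" by simp
qed

lemmas ip_simps = linear_add[OF ip_linear(1)] linear_add[OF ip_linear(2)]
  linear_diff[OF ip_linear(1)] linear_diff[OF ip_linear(2)]
  linear_scale[OF ip_linear(1)] linear_scale[OF ip_linear(2)]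
  linear_sum[OF ip_linear(1)] linear_sum[OF ip_linear(2)]
  linear_0[OF ip_linear(1)] linear_0[OF ip_linear(2)]
  linear_neg[OF ip_linear(1)] linear_neg[OF ip_linear(2)]

lemma ip_pos: "x \<noteq> 0 \<Longrightarrow> 0 < ip x x"
  using inner by (simp add: inner_product_on_def)

lemma ip_eqI: "(\<And>z. ip x z = ip y z) \<Longrightarrow> x = y"
  using ip_pos[of "x - y"] by (auto simp: ip_simps)

lemma ip_frame: "b \<in> E \<Longrightarrow> ip (\<Sum>a\<in>E. r a *\<^sub>R a) b = r b"
  using finite_E by (simp add: ip_simps orthonormal if_distrib cong: if_cong)

lemma frame_expansion: "(\<Sum>a\<in>E. ip x a *\<^sub>R a) = x"
proof -
  have "x \<in> span E" by (simp add: span_E)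
  then obtain r where x: "x = (\<Sum>a\<in>E. r a *\<^sub>R a)"
    using span_finite[OF finite_E] by auto
  then have "ip x b = r b" if "b \<in> E" for b using ip_frame[OF that] by simp
  then have "(\<Sum>a\<in>E. ip x a *\<^sub>R a) = (\<Sum>a\<in>E. r a *\<^sub>R a)" by (intro sum.cong) auto
  with x show ?thesis by simp
qed

lemma ip_parseval: "ip x y = (\<Sum>a\<in>E. ip x a * ip y a)"
proof -
  have "ip x y = ip (\<Sum>a\<in>E. ip x a *\<^sub>R a) y" by (simp add: frame_expansion)
  also have "\<dots> = (\<Sum>a\<in>E. ip x a * ip y a)" unfolding ip_simps by (simp add: ip_commute)
  finally show ?thesis .
qed

lemma functional_expansion:
  assumes "linear \<phi>" shows "\<phi> x = (\<Sum>a\<in>E. ip x a *\<^sub>R \<phi> a)"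
  by (subst frame_expansion[of x, symmetric]) (simp add: linear_sum[OF assms] linear_scale[OF assms])

lemma riesz:
  assumes "linear (\<phi> :: 'g \<Rightarrow> real)" shows "ip (\<Sum>a\<in>E. \<phi> a *\<^sub>R a) z = \<phi> z"
proof -
  have "\<phi> z = (\<Sum>a\<in>E. ip z a * \<phi> a)" using functional_expansion[OF assms, of z] by simp
  also have "\<dots> = ip (\<Sum>a\<in>E. \<phi> a *\<^sub>R a) z"
    unfolding ip_simps by (simp add: ip_commute[of z] mult.commute)
  finally show ?thesis by simp
qed

text \<open>The Levi-Civita connection and the Ricci operator are specified by a definite description of this
  shape.\<close>

lemma the_riesz:
  assumes "linear (\<phi> :: 'g \<Rightarrow> real)" shows "ip (THE w. \<forall>z. ip w z = \<phi> z) z = \<phi> z"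
proof -
  have "(THE w. \<forall>z. ip w z = \<phi> z) = (\<Sum>a\<in>E. \<phi> a *\<^sub>R a)"
    using riesz[OF assms] by (intro the_equality ip_eqI) simp_all
  then show ?thesis using riesz[OF assms] by simp
qed

lemma independent_E: "independent E"
proof -
  have "r b = 0" if "(\<Sum>a\<in>E. r a *\<^sub>R a) = 0" "b \<in> E" for r b
    using ip_frame[of b r] that by (simp add: ip_simps)
  then show ?thesis by (metis independent_if_scalars_zero finite_E)
qed

lemma trace_on_frame:
  assumes "linear f" shows "trace_on scaleR UNIV f = (\<Sum>a\<in>E. ip (f a) a)"
proof -
  have "representation E x b = ip x b" if "b \<in> E" for x b
    using real_vector.representation_sum_scale[OF finite_E independent_E that, of "ip x"]
    by (simp add: frame_expansion)
  moreover have "trace_on scaleR UNIV f = (\<Sum>b\<in>E. representation E (f b) b)"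
    using assms
    by (intro real_vector.trace_on_basis)
      (auto simp: finite_E independent_E span_E linear_add linear_scale)
  ultimately show ?thesis by simp
qed

lemma frame_trace_commute:
  assumes "linear f" "linear g"
  shows "(\<Sum>a\<in>E. ip (f (g a)) a) = (\<Sum>a\<in>E. ip (g (f a)) a)"
proof -
  have fin: "finite_subspace (UNIV :: 'g set)"
    using finite_E independent_E span_E by unfold_locales blast
  have "linear (\<lambda>x. f (g x))" "linear (\<lambda>x. g (f x))"
    using linear_compose[OF assms] linear_compose[OF assms(2,1)] by (auto simp: o_def)
  then show ?thesis
    using finite_subspace.trace_on_commute[OF fin assms(1) _ assms(2)] by (simp add: trace_on_frame)
qed

end

text \<open>The formula for the Ricci curvature below uses only that the bracket is bilinear and
  alternating.\<close>

locale alternating_algebra =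
  fixes br :: "'g::real_vector \<Rightarrow> 'g \<Rightarrow> 'g"
  assumes bilinear: "bilinear br" and br_self: "br x x = 0"
begin

lemma br_linear: "linear (br x)" "linear (\<lambda>x. br x y)"
  using bilinear by (auto simp: bilinear_def)

lemmas br_simps = linear_add[OF br_linear(1)] linear_add[OF br_linear(2)]
  linear_diff[OF br_linear(1)] linear_diff[OF br_linear(2)]
  linear_scale[OF br_linear(1)] linear_scale[OF br_linear(2)]
  linear_0[OF br_linear(1)] linear_0[OF br_linear(2)]
  linear_neg[OF br_linear(1)] linear_neg[OF br_linear(2)]

lemma br_skew: "br x y = - br y x"
proof -
  have "br (x + y) (x + y) = 0" by (rule br_self)
  then have "br x y + br y x = 0" unfolding br_simps by (simp add: br_self add.commute)
  then show ?thesis by (simp add: eq_neg_iff_add_eq_0)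
qed

end

locale metric_algebra = orthonormal_frame ip E + alternating_algebra br
  for ip :: "'g::real_vector \<Rightarrow> 'g \<Rightarrow> real" and E :: "'g set"
    and br :: "'g \<Rightarrow> 'g \<Rightarrow> 'g"
begin

abbreviation nabla where "nabla \<equiv> levi_civita br ip"

text \<open>Everything about the connection is derived from its pairing with vectors.\<close>

lemma koszul: "2 * ip (nabla x y) z = ip (br x y) z - ip (br y z) x + ip (br z x) y"
proof -
  define \<phi> where "\<phi> z = (ip (br x y) z - ip (br y z) x + ip (br z x) y) / 2" for z
  have "linear \<phi>"
    unfolding \<phi>_def by (rule linearI) (auto simp: ip_simps br_simps field_simps)
  moreover have "nabla x y = (THE w. \<forall>z. ip w z = \<phi> z)"
    unfolding levi_civita_def \<phi>_def by (rule arg_cong[where f = The]) (simp add: fun_eq_iff field_simps)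
  ultimately have "ip (nabla x y) z = \<phi> z" using the_riesz[of \<phi> z] by simp
  then show ?thesis by (simp add: \<phi>_def)
qed

lemma nabla_linear: "linear (nabla x)" "linear (\<lambda>x. nabla x y)"
proof -
  have eqI: "a = b" if "\<And>z. 2 * ip a z = 2 * ip b z" for a b
    using that by (intro ip_eqI) simp
  show "linear (nabla x)"
    by (rule linearI; rule eqI)
      (simp_all add: koszul ip_simps br_simps distrib_left right_diff_distrib mult.left_commute[of 2])
  show "linear (\<lambda>x. nabla x y)"
    by (rule linearI; rule eqI)
      (simp_all add: koszul ip_simps br_simps distrib_left right_diff_distrib mult.left_commute[of 2])
qed

lemma nabla_torsion_free: "nabla x y = nabla y x + br x y"
proof (rule ip_eqI)
  fix z
  have "2 * ip (nabla x y) z = 2 * ip (nabla y x + br x y) z"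
    unfolding ip_simps distrib_left koszul
    by (subst br_skew[of y x], subst br_skew[of x z], subst br_skew[of z y]) (simp add: ip_simps)
  then show "ip (nabla x y) z = ip (nabla y x + br x y) z" by simp
qed

lemma ricci_tensor_linear: "linear (ricci_tensor br ip x)"
proof -
  have lin: "linear (\<lambda>w. riemann_curvature br ip w x y)" for y
    unfolding riemann_curvature_def
    by (rule linearI)
      (simp_all add: linear_add[OF nabla_linear(1)] linear_add[OF nabla_linear(2)]
        linear_scale[OF nabla_linear(1)] linear_scale[OF nabla_linear(2)] br_simps
        scaleR_diff_right)
  have "ricci_tensor br ip x y = (\<Sum>a\<in>E. ip (riemann_curvature br ip a x y) a)" for y
    unfolding ricci_tensor_def by (rule trace_on_frame[OF lin])
  then have "ricci_tensor br ip x = (\<lambda>y. \<Sum>a\<in>E. ip (riemann_curvature br ip a x y) a)" by auto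
  moreover have "linear (\<lambda>y. ip (riemann_curvature br ip a x y) a)" for a
    unfolding riemann_curvature_def
    by (rule linearI)
      (simp_all add: linear_add[OF nabla_linear(1)] linear_scale[OF nabla_linear(1)] ip_simps
        algebra_simps)
  ultimately show ?thesis by (simp add: linear_compose_sum)
qed

definition mean_curvature :: "'g \<Rightarrow> real" where
  "mean_curvature a = (\<Sum>b\<in>E. ip (br a b) b)"

text \<open>The first sum is the squared norm of the symmetric part of \<open>ad x\<close>.

  Put \<open>N y = \<nabla>\<^sub>y x\<close>.  Torsion-freeness gives \<open>\<nabla>\<^sub>x = N + ad x\<close>, hence
  \<open>R(y,x)x = \<nabla>\<^sub>y \<nabla>\<^sub>x x - N (N y) - [x, N y] + N [x, y]\<close>.  The last two maps have opposite traces.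
  The trace of \<open>y \<mapsto> \<nabla>\<^sub>y w\<close> is minus the trace of \<open>ad w\<close>, which yields the mean curvature term.
  Finally \<open>N = - S + J\<close> with \<open>S\<close> the symmetric part of \<open>ad x\<close> and a skew \<open>J\<close> given by
  \<open>2 \<langle>J a, b\<rangle> = \<langle>[b, a], x\<rangle>\<close>, so that \<open>tr N\<^sup>2 = |S|\<^sup>2 - |J|\<^sup>2\<close>.\<close>

lemma ricci_tensor_diagonal:
  "ricci_tensor br ip x x =
     - (\<Sum>a\<in>E. \<Sum>b\<in>E. ((ip (br x a) b + ip (br x b) a) / 2)\<^sup>2)
     + (\<Sum>a\<in>E. \<Sum>b\<in>E. (ip (br a b) x)\<^sup>2) / 4
     - (\<Sum>a\<in>E. mean_curvature a * ip (br a x) x)"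
proof -
  define N where "N y = nabla y x" for y
  have lin_N: "linear N" unfolding N_def by (rule nabla_linear)
  have lin: "linear (\<lambda>w. riemann_curvature br ip w x x)"
    unfolding riemann_curvature_def
    by (rule linearI)
      (simp_all add: linear_add[OF nabla_linear(1)] linear_add[OF nabla_linear(2)]
        linear_scale[OF nabla_linear(1)] linear_scale[OF nabla_linear(2)] br_simps
        scaleR_diff_right)
  have ric: "ricci_tensor br ip x x = (\<Sum>a\<in>E. ip (riemann_curvature br ip a x x) a)"
    unfolding ricci_tensor_def by (rule trace_on_frame[OF lin])
  have curv: "ip (riemann_curvature br ip a x x) a
      = ip (nabla a (nabla x x)) a - ip (N (N a)) a - ip (br x (N a)) a + ip (N (br x a)) a" for a
  proof -
    have "nabla x (N a) = N (N a) + br x (N a)"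
      unfolding N_def by (rule nabla_torsion_free)
    moreover have "nabla (br a x) x = - N (br x a)"
      unfolding N_def by (subst br_skew) (simp add: linear_neg[OF nabla_linear(2)])
    ultimately show ?thesis
      unfolding riemann_curvature_def by (simp add: ip_simps N_def)
  qed
  have comm: "(\<Sum>a\<in>E. ip (br x (N a)) a) = (\<Sum>a\<in>E. ip (N (br x a)) a)"
    by (rule frame_trace_commute[OF br_linear(1) lin_N])
  have first: "(\<Sum>a\<in>E. ip (nabla a (nabla x x)) a) = - (\<Sum>a\<in>E. mean_curvature a * ip (br a x) x)"
  proof -
    have sq: "ip (nabla x x) z = ip (br z x) x" for z
    proof -
      have "2 * ip (nabla x x) z = 2 * ip (br z x) x"
        unfolding koszul by (subst br_skew[of x z]) (simp add: ip_simps br_self)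
      then show ?thesis by simp
    qed
    have "ip (nabla a w) a = - ip (br w a) a" for a w
    proof -
      have "2 * ip (nabla a w) a = - (2 * ip (br w a) a)"
        unfolding koszul by (subst br_skew[of a w]) (simp add: ip_simps br_self)
      then show ?thesis by simp
    qed
    then have "(\<Sum>a\<in>E. ip (nabla a w) a) = - mean_curvature w" for w
      by (simp add: mean_curvature_def sum_negf)
    moreover have "linear mean_curvature"
      unfolding mean_curvature_def[abs_def]
      by (intro linear_compose_sum ballI linearI) (auto simp: ip_simps br_simps)
    then have "mean_curvature (nabla x x) = (\<Sum>a\<in>E. ip (nabla x x) a * mean_curvature a)"
      using functional_expansion[of mean_curvature "nabla x x"] by simp
    ultimately show ?thesis by (simp add: sq mult.commute)
  qed
  define S where "S a b = (ip (br x a) b + ip (br x b) a) / 2" for a b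
  define J where "J a b = ip (br b a) x / 2" for a b
  have N_ab: "ip (N a) b = - S a b + J a b" for a b
  proof -
    have "2 * ip (N a) b = 2 * (- S a b + J a b)"
      unfolding N_def koszul S_def J_def
      by (subst br_skew[of a x]) (simp add: ip_simps field_simps)
    then show ?thesis by simp
  qed
  have S_sym: "S a b = S b a" for a b by (simp add: S_def)
  have J_skew: "J a b = - J b a" for a b unfolding J_def by (subst br_skew) (simp add: ip_simps)
  have "(\<Sum>a\<in>E. ip (N (N a)) a) = (\<Sum>a\<in>E. \<Sum>b\<in>E. ip (N a) b * ip (N b) a)"
  proof (rule sum.cong[OF refl])
    fix a
    have "linear (\<lambda>y. ip (N y) a)"
      by (rule linearI) (simp_all add: linear_add[OF lin_N] linear_scale[OF lin_N] ip_simps)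
    from functional_expansion[OF this, of "N a"]
    show "ip (N (N a)) a = (\<Sum>b\<in>E. ip (N a) b * ip (N b) a)" by simp
  qed
  also have "\<dots> = (\<Sum>a\<in>E. \<Sum>b\<in>E. (S a b)\<^sup>2 - (J a b)\<^sup>2)"
  proof -
    have "ip (N a) b * ip (N b) a = (S a b)\<^sup>2 - (J a b)\<^sup>2" for a b
      unfolding N_ab S_sym[of b a] J_skew[of b a] by (simp add: power2_eq_square algebra_simps)
    then show ?thesis by simp
  qed
  also have "\<dots> = (\<Sum>a\<in>E. \<Sum>b\<in>E. (S a b)\<^sup>2) - (\<Sum>a\<in>E. \<Sum>b\<in>E. (J a b)\<^sup>2)"
    by (simp add: sum_subtractf)
  also have "(\<Sum>a\<in>E. \<Sum>b\<in>E. (J a b)\<^sup>2) = (\<Sum>a\<in>E. \<Sum>b\<in>E. (ip (br a b) x)\<^sup>2) / 4"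
    by (subst sum.swap) (simp add: J_def power_divide sum_divide_distrib)
  finally have trace_NN: "(\<Sum>a\<in>E. ip (N (N a)) a)
      = (\<Sum>a\<in>E. \<Sum>b\<in>E. (S a b)\<^sup>2) - (\<Sum>a\<in>E. \<Sum>b\<in>E. (ip (br a b) x)\<^sup>2) / 4" .
  show ?thesis
    unfolding ric curv sum.distrib sum_subtractf first comm trace_NN S_def by simp
qed

lemma negative_ricci_iff: "negative_ricci br ip \<longleftrightarrow> (\<forall>x. x \<noteq> 0 \<longrightarrow> ricci_tensor br ip x x < 0)"
proof -
  have "ip (ricci_operator br ip x) y = ricci_tensor br ip x y" for x y
    unfolding ricci_operator_def using the_riesz[OF ricci_tensor_linear] by simp
  then show ?thesis by (simp add: negative_ricci_def)
qed

end

section \<open>The Ricci form as a function of the structure constants\<close>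

text \<open>\<open>C i j k\<close> stands for \<open>\<langle>[e\<^sub>i, e\<^sub>j], e\<^sub>k\<rangle>\<close> in an orthonormal basis \<open>e\<close>, and \<open>x\<close> for the coordinates of a
  vector.  The array \<open>C\<close> is arbitrary: limits of structure constants can then be studied without
  giving them a Lie algebra to live on.\<close>

definition ricci_form :: "'i set \<Rightarrow> ('i \<Rightarrow> 'i \<Rightarrow> 'i \<Rightarrow> real) \<Rightarrow> ('i \<Rightarrow> real) \<Rightarrow> real" where
  "ricci_form I C x =
     - (\<Sum>i\<in>I. \<Sum>j\<in>I. ((\<Sum>k\<in>I. x k * (C k i j + C k j i)) / 2)\<^sup>2)
     + (\<Sum>i\<in>I. \<Sum>j\<in>I. (\<Sum>k\<in>I. C i j k * x k)\<^sup>2) / 4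
     - (\<Sum>i\<in>I. (\<Sum>l\<in>I. C i l l) * (\<Sum>j\<in>I. \<Sum>k\<in>I. C i j k * x j * x k))"

text \<open>The matrix of the quadratic form \<open>ricci_form I C\<close>; it is a polynomial in the entries of \<open>C\<close>.\<close>

definition ricci_coeff :: "'i set \<Rightarrow> ('i \<Rightarrow> 'i \<Rightarrow> 'i \<Rightarrow> real) \<Rightarrow> 'i \<Rightarrow> 'i \<Rightarrow> real" where
  "ricci_coeff I C k l =
     - (\<Sum>i\<in>I. \<Sum>j\<in>I. (C k i j + C k j i) * (C l i j + C l j i) / 4)
     + (\<Sum>i\<in>I. \<Sum>j\<in>I. C i j k * C i j l / 4)
     - (\<Sum>i\<in>I. (\<Sum>j\<in>I. C i j j) * C i k l)"

lemma sum_square_swap: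
  fixes a :: "'i \<Rightarrow> 'j \<Rightarrow> 'k \<Rightarrow> real"
  shows "(\<Sum>i\<in>I. \<Sum>j\<in>J. (\<Sum>k\<in>K. x k * a i j k)\<^sup>2)
       = (\<Sum>k\<in>K. \<Sum>l\<in>K. x k * x l * (\<Sum>i\<in>I. \<Sum>j\<in>J. a i j k * a i j l))"
proof -
  have "(\<Sum>i\<in>I. \<Sum>j\<in>J. (\<Sum>k\<in>K. x k * a i j k)\<^sup>2)
      = (\<Sum>i\<in>I. \<Sum>j\<in>J. \<Sum>k\<in>K. \<Sum>l\<in>K. x k * x l * (a i j k * a i j l))"
    by (simp add: power2_eq_square sum_product mult_ac)
  also have "\<dots> = (\<Sum>i\<in>I. \<Sum>k\<in>K. \<Sum>j\<in>J. \<Sum>l\<in>K. x k * x l * (a i j k * a i j l))"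
    by (intro sum.cong refl sum.swap)
  also have "\<dots> = (\<Sum>k\<in>K. \<Sum>i\<in>I. \<Sum>l\<in>K. \<Sum>j\<in>J. x k * x l * (a i j k * a i j l))"
    by (subst sum.swap) (intro sum.cong refl sum.swap)
  also have "\<dots> = (\<Sum>k\<in>K. \<Sum>l\<in>K. \<Sum>i\<in>I. \<Sum>j\<in>J. x k * x l * (a i j k * a i j l))"
    by (intro sum.cong refl sum.swap)
  finally show ?thesis by (simp add: sum_distrib_left)
qed

lemma ricci_form_coeff:
  "ricci_form I C x = (\<Sum>k\<in>I. \<Sum>l\<in>I. x k * x l * ricci_coeff I C k l)"
proof -
  have 1: "(\<Sum>i\<in>I. \<Sum>j\<in>I. ((\<Sum>k\<in>I. x k * (C k i j + C k j i)) / 2)\<^sup>2)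
      = (\<Sum>k\<in>I. \<Sum>l\<in>I. x k * x l * (\<Sum>i\<in>I. \<Sum>j\<in>I. (C k i j + C k j i) * (C l i j + C l j i) / 4))"
    using sum_square_swap[of x "\<lambda>i j k. (C k i j + C k j i) / 2" I I I]
    by (simp add: sum_divide_distrib[symmetric])
  have 2: "(\<Sum>i\<in>I. \<Sum>j\<in>I. (\<Sum>k\<in>I. C i j k * x k)\<^sup>2) / 4
      = (\<Sum>k\<in>I. \<Sum>l\<in>I. x k * x l * (\<Sum>i\<in>I. \<Sum>j\<in>I. C i j k * C i j l / 4))"
    using sum_square_swap[of x "\<lambda>i j k. C i j k / 2" I I I]
    by (simp add: sum_divide_distrib[symmetric] power_divide mult.commute)
  have 3: "(\<Sum>i\<in>I. (\<Sum>l\<in>I. C i l l) * (\<Sum>j\<in>I. \<Sum>k\<in>I. C i j k * x j * x k))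
      = (\<Sum>k\<in>I. \<Sum>l\<in>I. x k * x l * (\<Sum>i\<in>I. (\<Sum>j\<in>I. C i j j) * C i k l))"
  proof -
    have "(\<Sum>i\<in>I. (\<Sum>l\<in>I. C i l l) * (\<Sum>j\<in>I. \<Sum>k\<in>I. C i j k * x j * x k))
        = (\<Sum>i\<in>I. \<Sum>j\<in>I. \<Sum>k\<in>I. x j * x k * ((\<Sum>l\<in>I. C i l l) * C i j k))"
      by (simp add: sum_distrib_left mult_ac)
    also have "\<dots> = (\<Sum>j\<in>I. \<Sum>k\<in>I. \<Sum>i\<in>I. x j * x k * ((\<Sum>l\<in>I. C i l l) * C i j k))"
      by (subst sum.swap) (intro sum.cong refl sum.swap)
    finally show ?thesis by (simp add: sum_distrib_left)
  qed
  show ?thesis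
    unfolding ricci_form_def 1 2 3 ricci_coeff_def
    by (simp add: distrib_left right_diff_distrib sum.distrib sum_subtractf sum_negf)
qed

lemma ricci_form_scale: "ricci_form I C (\<lambda>i. c * x i) = c\<^sup>2 * ricci_form I C x"
  unfolding ricci_form_coeff sum_distrib_left
  by (intro sum.cong refl) (simp add: power2_eq_square mult_ac)

lemma ricci_form_cong:
  assumes "\<And>i j k. i \<in> I \<Longrightarrow> j \<in> I \<Longrightarrow> k \<in> I \<Longrightarrow> C i j k = D i j k"
    and "\<And>i. i \<in> I \<Longrightarrow> x i = y i"
  shows "ricci_form I C x = ricci_form I D y"
  unfolding ricci_form_def using assms by (simp cong: sum.cong)

text \<open>The coefficients of the quadratic form depend continuously on \<open>C\<close>, and on the compact sphere of
  the maximum norm the limit form stays below a negative constant; homogeneity does the rest.\<close>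

lemma ricci_form_negative_open:
  assumes fin: "finite I"
    and lim: "\<And>i j k. i \<in> I \<Longrightarrow> j \<in> I \<Longrightarrow> k \<in> I \<Longrightarrow> ((\<lambda>t. C t i j k) \<longlongrightarrow> D i j k) F"
    and neg: "\<And>x. \<exists>i\<in>I. x i \<noteq> 0 \<Longrightarrow> ricci_form I D x < 0"
  shows "\<forall>\<^sub>F t in F. \<forall>x. (\<exists>i\<in>I. x i \<noteq> 0) \<longrightarrow> ricci_form I (C t) x < 0"
proof (cases "I = {}")
  case True then show ?thesis by simp
next
  case False
  define K where "K = PiE UNIV (\<lambda>i. if i \<in> I then {-1..1::real} else {0})"
  define S where "S = K \<inter> (\<Union>i\<in>I. {x. \<bar>x i\<bar> = 1})"
  \<comment> \<open>coordinates outside the finite index set are frozen at 0, which makes the cube compact\<close>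
  have "compactin (product_topology (\<lambda>i. euclidean) UNIV) K"
    unfolding K_def by (auto simp: compactin_PiE)
  then have "compact K" by (metis compactin_euclidean_iff euclidean_product_topology)
  moreover have "closed (\<Union>i\<in>I. {x :: 'a \<Rightarrow> real. \<bar>x i\<bar> = 1})"
    using fin by (intro closed_UN ballI closed_Collect_eq continuous_intros) auto
  ultimately have "compact S" unfolding S_def by (rule compact_Int_closed)
  moreover have "S \<noteq> {}"
  proof -
    have "(\<lambda>i. if i \<in> I then 1 else 0) \<in> S" using False by (auto simp: S_def K_def)
    then show ?thesis by blast
  qed
  moreover have "continuous_on S (ricci_form I D)"
    unfolding ricci_form_coeff[abs_def]
    by (intro continuous_intros continuous_on_subset[OF continuous_on_product_coordinates]) auto
  ultimately obtain y where y: "y \<in> S" "\<And>x. x \<in> S \<Longrightarrow> ricci_form I D x \<le> ricci_form I D y"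
    using continuous_attains_sup by metis
  define \<eta> where "\<eta> = - ricci_form I D y"
  have "\<eta> > 0" using y(1) neg[of y] by (force simp: \<eta>_def S_def)
  define G where "G t = (\<Sum>k\<in>I. \<Sum>l\<in>I. \<bar>ricci_coeff I (C t) k l - ricci_coeff I D k l\<bar>)" for t
  have "((\<lambda>t. ricci_coeff I (C t) k l) \<longlongrightarrow> ricci_coeff I D k l) F" if "k \<in> I" "l \<in> I" for k l
    unfolding ricci_coeff_def using that by (intro tendsto_intros lim) auto
  then have "(G \<longlongrightarrow> (\<Sum>k\<in>I. \<Sum>l\<in>I. \<bar>ricci_coeff I D k l - ricci_coeff I D k l\<bar>)) F"
    unfolding G_def by (intro tendsto_intros) auto
  then have "\<forall>\<^sub>F t in F. G t < \<eta>"
    using \<open>\<eta> > 0\<close> by (auto dest: order_tendstoD(2))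
  then show ?thesis
  proof eventually_elim
    case (elim t)
    show ?case
    proof (intro allI impI)
      fix x :: "'a \<Rightarrow> real" assume x: "\<exists>i\<in>I. x i \<noteq> 0"
      define m where "m = Max ((\<lambda>i. \<bar>x i\<bar>) ` I)"
      have m_ge: "\<bar>x i\<bar> \<le> m" if "i \<in> I" for i using that fin by (simp add: m_def)
      have "m \<in> (\<lambda>i. \<bar>x i\<bar>) ` I" unfolding m_def using fin False by (intro Max_in) auto
      then obtain j where j: "j \<in> I" "\<bar>x j\<bar> = m" by auto
      have m_pos: "m > 0" using x m_ge by (metis abs_ge_zero order_less_le zero_less_abs_iff order_less_le_trans)
      define z where "z i = (if i \<in> I then x i / m else 0)" for i
      have z1: "\<bar>z i\<bar> \<le> 1" if "i \<in> I" for i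
        using m_ge[OF that] m_pos that by (simp add: z_def)
      have "z i \<in> (if i \<in> I then {-1..1} else {0})" for i
      proof (cases "i \<in> I")
        case True
        then have "-1 \<le> z i" "z i \<le> 1" using z1[OF True] by linarith+
        with True show ?thesis by simp
      qed (simp add: z_def)
      moreover have "\<bar>z j\<bar> = 1" using j m_pos by (simp add: z_def)
      ultimately have zS: "z \<in> S" unfolding S_def K_def using j(1) by auto
      have "ricci_form I (C t) z - ricci_form I D z
          = (\<Sum>k\<in>I. \<Sum>l\<in>I. z k * z l * (ricci_coeff I (C t) k l - ricci_coeff I D k l))"
        unfolding ricci_form_coeff by (simp add: right_diff_distrib sum_subtractf)
      also have "\<dots> \<le> G t"
        unfolding G_def
      proof (intro sum_mono)
        fix k l assume "k \<in> I" "l \<in> I"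
        then have "\<bar>z k * z l\<bar> \<le> 1" using z1 by (simp add: abs_mult mult_le_one)
        then show "z k * z l * (ricci_coeff I (C t) k l - ricci_coeff I D k l)
            \<le> \<bar>ricci_coeff I (C t) k l - ricci_coeff I D k l\<bar>"
          using mult_right_mono[of "\<bar>z k * z l\<bar>" 1 "\<bar>ricci_coeff I (C t) k l - ricci_coeff I D k l\<bar>"]
            abs_ge_self[of "z k * z l * (ricci_coeff I (C t) k l - ricci_coeff I D k l)"]
          by (simp only: abs_mult) simp
      qed
      finally have "ricci_form I (C t) z < 0"
        using y(2)[OF zS] elim by (simp add: \<eta>_def)
      moreover have "ricci_form I (C t) x = m\<^sup>2 * ricci_form I (C t) z"
        unfolding ricci_form_scale[symmetric]
        using m_pos by (intro ricci_form_cong) (simp_all add: z_def)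
      ultimately show "ricci_form I (C t) x < 0"
        using m_pos by (simp add: mult_pos_neg)
    qed
  qed
qed

context metric_algebra
begin

lemma ricci_tensor_form:
  "ricci_tensor br ip x x = ricci_form E (\<lambda>a b c. ip (br a b) c) (ip x)"
proof -
  have lin: "linear (\<lambda>x. ip (br x a) b)" "linear (\<lambda>x. ip (br a x) b)" for a b
    by (rule linearI; simp add: br_simps ip_simps)+
  have left: "ip (br x a) b = (\<Sum>k\<in>E. ip x k * ip (br k a) b)" for a b
    using functional_expansion[OF lin(1)[of a b], of x] by simp
  have right: "ip (br a x) b = (\<Sum>k\<in>E. ip x k * ip (br a k) b)" for a b
    using functional_expansion[OF lin(2)[of a b], of x] by simp
  have "ip (br a x) x = (\<Sum>j\<in>E. \<Sum>k\<in>E. ip (br a j) k * ip x j * ip x k)" for a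
    by (subst right, subst ip_parseval)
      (simp add: sum_distrib_left mult_ac)
  moreover have "ip (br a b) x = (\<Sum>k\<in>E. ip (br a b) k * ip x k)" for a b
    by (rule ip_parseval)
  moreover have "ip (br x a) b + ip (br x b) a = (\<Sum>k\<in>E. ip x k * (ip (br k a) b + ip (br k b) a))" for a b
    by (subst left, subst left) (simp add: distrib_left sum.distrib)
  ultimately show ?thesis
    unfolding ricci_tensor_diagonal ricci_form_def mean_curvature_def by simp
qed

end

section \<open>The limit bracket\<close>

text \<open>The structure constants that survive the degeneration.  Here \<open>z\<close> stands for \<open>Z\<close>,
  \<open>T\<close> for a basis of the torus, \<open>M\<close> for the root vectors of the compact algebra and \<open>N\<close> for a basis of the
  nilpotent ideal: \<open>z\<close> acts on \<open>N\<close> diagonally with positive eigenvalues \<open>d\<close>, the torus acts on \<open>M\<close> and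
  on \<open>N\<close>, the elements of \<open>M\<close> act on \<open>N\<close> and commute with each other, and \<open>N\<close> is abelian.

  The conditions \<open>small_N\<close> and \<open>small_M\<close> say that \<open>T\<close> acts weakly compared to \<open>M\<close>, and \<open>T\<close> and \<open>M\<close>
  weakly compared to \<open>z\<close>.  The condition \<open>faithful\<close> says that no nonzero element of the torus acts
  skew-symmetrically on the span of \<open>M\<close>; it is what makes the curvature negative on the torus.\<close>

locale graded_limit =
  fixes z :: 'i and T M N :: "'i set" and C :: "'i \<Rightarrow> 'i \<Rightarrow> 'i \<Rightarrow> real" and d :: "'i \<Rightarrow> real"
  assumes fin: "finite T" "finite M" "finite N"
    and disj: "z \<notin> T" "z \<notin> M" "z \<notin> N" "T \<inter> M = {}" "T \<inter> N = {}" "M \<inter> N = {}"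
    and N_nonempty: "N \<noteq> {}" and d_pos: "n \<in> N \<Longrightarrow> 0 < d n"
    and skew: "C i j k = - C j i k"
    and Z: "C z j k = (if j \<in> N \<and> k = j then d j else 0)"
    and TT: "k \<in> T \<Longrightarrow> l \<in> T \<Longrightarrow> C k l j = 0"
    and TM: "k \<in> T \<Longrightarrow> e \<in> M \<Longrightarrow> j \<notin> M \<Longrightarrow> C k e j = 0"
    and TN: "k \<in> T \<Longrightarrow> n \<in> N \<Longrightarrow> j \<notin> N \<Longrightarrow> C k n j = 0"
    and MM: "e \<in> M \<Longrightarrow> f \<in> M \<Longrightarrow> C e f j = 0"
    and MN: "e \<in> M \<Longrightarrow> n \<in> N \<Longrightarrow> j \<notin> N \<Longrightarrow> C e n j = 0"
    and NN: "n \<in> N \<Longrightarrow> n' \<in> N \<Longrightarrow> C n n' j = 0"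
    and trace_TM: "k \<in> T \<Longrightarrow> (\<Sum>e\<in>M. C k e e) = 0"
    and trace_TN: "k \<in> T \<Longrightarrow> (\<Sum>n\<in>N. C k n n) = 0"
    and trace_dTN: "k \<in> T \<Longrightarrow> (\<Sum>n\<in>N. d n * C k n n) = 0"
    and diag_MN: "e \<in> M \<Longrightarrow> n \<in> N \<Longrightarrow> C e n n = 0"
    and orth_TM: "k \<in> T \<Longrightarrow> e \<in> M \<Longrightarrow>
      (\<Sum>n\<in>N. \<Sum>n'\<in>N. (C k n n' + C k n' n) * (C e n n' + C e n' n)) = 0"
    and orth_MM: "e \<in> M \<Longrightarrow> f \<in> M \<Longrightarrow> e \<noteq> f \<Longrightarrow>
      (\<Sum>n\<in>N. \<Sum>n'\<in>N. (C e n n' + C e n' n) * (C f n n' + C f n' n)) = 0"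
    and small_N: "n \<in> N \<Longrightarrow>
      (\<Sum>k\<in>T \<union> M. \<Sum>v\<in>N. \<Sum>w\<in>N. (C k v w)\<^sup>2) / 2 < (\<Sum>v\<in>N. d v) * d n"
    and small_M: "e \<in> M \<Longrightarrow>
      (\<Sum>k\<in>T. \<Sum>f\<in>M. \<Sum>f'\<in>M. (C k f f')\<^sup>2) / 2
        < (\<Sum>n\<in>N. \<Sum>n'\<in>N. (C e n n' + C e n' n)\<^sup>2) / 4"
    and faithful: "(\<And>e f. e \<in> M \<Longrightarrow> f \<in> M \<Longrightarrow> (\<Sum>k\<in>T. x k * (C k e f + C k f e)) = 0)
      \<Longrightarrow> k \<in> T \<Longrightarrow> x k = 0"
begin

abbreviation "I \<equiv> insert z (T \<union> M \<union> N)"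

lemma sum_I: "(\<Sum>i\<in>I. g i) = g z + (\<Sum>i\<in>T. g i) + (\<Sum>i\<in>M. g i) + (\<Sum>i\<in>N. g i)"
  for g :: "'i \<Rightarrow> real"
proof -
  have "(\<Sum>i\<in>I. g i) = g z + (\<Sum>i\<in>T \<union> M \<union> N. g i)"
    using fin disj by (intro sum.insert) auto
  also have "(\<Sum>i\<in>T \<union> M \<union> N. g i) = (\<Sum>i\<in>T. g i) + (\<Sum>i\<in>M. g i) + (\<Sum>i\<in>N. g i)"
    using fin disj by (subst sum.union_disjoint; (subst sum.union_disjoint)?) auto
  finally show ?thesis by simp
qed

lemma TM': "k \<in> T \<Longrightarrow> e \<in> M \<Longrightarrow> j \<notin> M \<Longrightarrow> C e k j = 0"
  and TN': "k \<in> T \<Longrightarrow> n \<in> N \<Longrightarrow> j \<notin> N \<Longrightarrow> C n k j = 0"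
  and MN': "e \<in> M \<Longrightarrow> n \<in> N \<Longrightarrow> j \<notin> N \<Longrightarrow> C n e j = 0"
  and Z': "C j z k = (if j \<in> N \<and> k = j then - d j else 0)"
  using skew[of e k j] skew[of n k j] skew[of n e j] skew[of j z k]
  by (auto simp: TM TN MN Z)

lemma into_z: "i \<in> I \<Longrightarrow> j \<in> I \<Longrightarrow> C i j z = 0"
  using disj
  by (auto simp: TM' TN' MN' Z' TM TN MN Z TT MM NN)

lemma into_T: "i \<in> I \<Longrightarrow> j \<in> I \<Longrightarrow> k \<in> T \<Longrightarrow> C i j k = 0"
proof -
  assume "i \<in> I" "j \<in> I" "k \<in> T"
  moreover have "k \<notin> M" "k \<notin> N" "k \<noteq> z" using \<open>k \<in> T\<close> disj by auto
  ultimately show ?thesis by (auto simp: TM' TN' MN' Z' TM TN MN Z TT MM NN)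
qed

lemma NI: "n \<in> N \<Longrightarrow> i \<in> I \<Longrightarrow> j \<notin> N \<Longrightarrow> C n i j = 0"
  by (auto simp: TN' MN' Z' NN)

context
  fixes x :: "'i \<Rightarrow> real"
begin

text \<open>\<open>S\<close> is the symmetric part of \<open>ad x\<close>.  The constants \<open>A\<close> and \<open>B\<close> bound the positive contributions to
  the curvature on the spans of \<open>M\<close> and \<open>N\<close>, and \<open>q e\<close> is the squared norm of the symmetric part of the
  action of \<open>e\<close> on \<open>N\<close>.\<close>

definition "S i j = (\<Sum>k\<in>I. x k * (C k i j + C k j i)) / 2"
definition "A = (\<Sum>k\<in>T. \<Sum>f\<in>M. \<Sum>f'\<in>M. (C k f f')\<^sup>2)"
definition "B = (\<Sum>k\<in>T \<union> M. \<Sum>v\<in>N. \<Sum>w\<in>N. (C k v w)\<^sup>2)"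
definition "q e = (\<Sum>n\<in>N. \<Sum>n'\<in>N. (C e n n' + C e n' n)\<^sup>2) / 4"

lemma S_zN: assumes "n \<in> N" shows "S z n = - (x n * d n / 2)" "S n z = - (x n * d n / 2)"
proof -
  have nI: "n \<in> I" "z \<in> I" "n \<notin> M" "n \<notin> T" "n \<noteq> z" using assms disj by auto
  have "(\<Sum>k\<in>I. x k * (C k z n + C k n z)) = (\<Sum>k\<in>I. if k = n then - x n * d n else 0)"
    using nI by (intro sum.cong refl) (auto simp: into_z Z')
  also have "\<dots> = - x n * d n" using nI fin by (subst sum.delta) auto
  finally show "S z n = - (x n * d n / 2)" by (simp add: S_def)
  then show "S n z = - (x n * d n / 2)" by (simp add: S_def add.commute)
qed

lemma S_MM: assumes "e \<in> M" "f \<in> M" shows "S e f = (\<Sum>k\<in>T. x k * (C k e f + C k f e)) / 2"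
proof -
  have "C k e f = 0" "C k f e = 0" if "k \<in> N" for k
    using that assms disj by (auto intro!: NI)
  moreover have "e \<notin> N" "f \<notin> N" using assms disj by auto
  ultimately show ?thesis
    unfolding S_def sum_I using assms disj by (simp add: Z MM)
qed

lemma S_NN:
  assumes "n \<in> N" "n' \<in> N"
  shows "S n n' = x z * (if n = n' then d n else 0)
     + (\<Sum>k\<in>T. x k * (C k n n' + C k n' n)) / 2 + (\<Sum>k\<in>M. x k * (C k n n' + C k n' n)) / 2"
  unfolding S_def sum_I using assms by (simp add: Z NN add_divide_distrib)

text \<open>On \<open>N\<close> the symmetric part of \<open>ad x\<close> is the sum of the contributions of \<open>z\<close>, \<open>T\<close> and \<open>M\<close>.  They are
  pairwise orthogonal by the trace conditions, the contributions of different elements of \<open>M\<close> are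
  orthogonal too, and the norm of the contribution of \<open>T\<close> is dropped.\<close>

lemma sum_S_NN:
  "(\<Sum>n\<in>N. \<Sum>n'\<in>N. (S n n')\<^sup>2) \<ge> (x z)\<^sup>2 * (\<Sum>n\<in>N. (d n)\<^sup>2) + (\<Sum>e\<in>M. (x e)\<^sup>2 * q e)"
proof -
  define a where "a n n' = x z * (if n = n' then d n else 0)" for n n'
  define b where "b n n' = (\<Sum>k\<in>T. x k * (C k n n' + C k n' n)) / 2" for n n'
  define c where "c n n' = (\<Sum>k\<in>M. x k * (C k n n' + C k n' n)) / 2" for n n'
  have S_abc: "S n n' = a n n' + b n n' + c n n'" if "n \<in> N" "n' \<in> N" for n n'
    unfolding a_def b_def c_def by (rule S_NN[OF that])
  have "(\<Sum>n\<in>N. \<Sum>n'\<in>N. (S n n')\<^sup>2) = (\<Sum>n\<in>N. \<Sum>n'\<in>N. (a n n')\<^sup>2 + (b n n')\<^sup>2 + (c n n')\<^sup>2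
      + 2 * (a n n' * b n n') + 2 * (a n n' * c n n') + 2 * (b n n' * c n n'))"
    by (intro sum.cong refl) (simp add: S_abc power2_eq_square algebra_simps)
  also have "\<dots> = (\<Sum>n\<in>N. \<Sum>n'\<in>N. (a n n')\<^sup>2) + (\<Sum>n\<in>N. \<Sum>n'\<in>N. (b n n')\<^sup>2)
      + (\<Sum>n\<in>N. \<Sum>n'\<in>N. (c n n')\<^sup>2) + 2 * (\<Sum>n\<in>N. \<Sum>n'\<in>N. a n n' * b n n')
      + 2 * (\<Sum>n\<in>N. \<Sum>n'\<in>N. a n n' * c n n') + 2 * (\<Sum>n\<in>N. \<Sum>n'\<in>N. b n n' * c n n')"
    by (simp add: sum.distrib sum_distrib_left)
  also have "(\<Sum>n\<in>N. \<Sum>n'\<in>N. (a n n')\<^sup>2) = (x z)\<^sup>2 * (\<Sum>n\<in>N. (d n)\<^sup>2)"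
  proof -
    have "(\<Sum>n'\<in>N. (a n n')\<^sup>2) = (x z)\<^sup>2 * (d n)\<^sup>2" if "n \<in> N" for n
    proof -
      have "(\<Sum>n'\<in>N. (a n n')\<^sup>2) = (\<Sum>n'\<in>N. if n = n' then (x z)\<^sup>2 * (d n)\<^sup>2 else 0)"
        by (intro sum.cong refl) (simp add: a_def power_mult_distrib)
      then show ?thesis using that fin by simp
    qed
    then show ?thesis by (simp add: sum_distrib_left)
  qed
  also have "(\<Sum>n\<in>N. \<Sum>n'\<in>N. a n n' * b n n') = 0"
  proof -
    have "(\<Sum>n'\<in>N. a n n' * b n n') = (\<Sum>k\<in>T. x z * x k * (d n * C k n n))" if "n \<in> N" for n
    proof -
      have "(\<Sum>n'\<in>N. a n n' * b n n') = (\<Sum>n'\<in>N. if n = n' then x z * d n * b n n else 0)"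
        by (intro sum.cong refl) (simp add: a_def)
      also have "\<dots> = x z * d n * b n n" using that fin by simp
      also have "\<dots> = (\<Sum>k\<in>T. x z * x k * (d n * C k n n))"
        by (simp add: b_def sum_distrib_left sum_divide_distrib mult_ac)
      finally show ?thesis .
    qed
    then have "(\<Sum>n\<in>N. \<Sum>n'\<in>N. a n n' * b n n')
        = (\<Sum>n\<in>N. \<Sum>k\<in>T. x z * x k * (d n * C k n n))" by simp
    also have "\<dots> = (\<Sum>k\<in>T. x z * x k * (\<Sum>n\<in>N. d n * C k n n))"
      by (subst sum.swap) (simp add: sum_distrib_left)
    finally show ?thesis by (simp add: trace_dTN)
  qed
  also have "(\<Sum>n\<in>N. \<Sum>n'\<in>N. a n n' * c n n') = 0"
    by (intro sum.neutral ballI) (auto simp: a_def c_def diag_MN)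
  also have "(\<Sum>n\<in>N. \<Sum>n'\<in>N. b n n' * c n n') = 0"
  proof -
    have "(\<Sum>n\<in>N. \<Sum>n'\<in>N. b n n' * c n n')
      = (\<Sum>n\<in>N. \<Sum>n'\<in>N. \<Sum>k\<in>T. \<Sum>e\<in>M. x k * x e / 4 * ((C k n n' + C k n' n) * (C e n n' + C e n' n)))"
      unfolding b_def c_def sum_divide_distrib sum_product
      by (intro sum.cong refl) (simp add: field_simps)
    also have "\<dots> = (\<Sum>n\<in>N. \<Sum>k\<in>T. \<Sum>n'\<in>N. \<Sum>e\<in>M. x k * x e / 4 * ((C k n n' + C k n' n) * (C e n n' + C e n' n)))"
      by (intro sum.cong refl sum.swap)
    also have "\<dots> = (\<Sum>k\<in>T. \<Sum>n\<in>N. \<Sum>e\<in>M. \<Sum>n'\<in>N. x k * x e / 4 * ((C k n n' + C k n' n) * (C e n n' + C e n' n)))"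
      by (subst sum.swap) (intro sum.cong refl sum.swap)
    also have "\<dots> = (\<Sum>k\<in>T. \<Sum>e\<in>M. \<Sum>n\<in>N. \<Sum>n'\<in>N. x k * x e / 4 * ((C k n n' + C k n' n) * (C e n n' + C e n' n)))"
      by (intro sum.cong refl sum.swap)
    also have "\<dots> = (\<Sum>k\<in>T. \<Sum>e\<in>M. x k * x e / 4 * (\<Sum>n\<in>N. \<Sum>n'\<in>N. (C k n n' + C k n' n) * (C e n n' + C e n' n)))"
      by (simp add: sum_distrib_left)
    finally show ?thesis by (simp add: orth_TM)
  qed
  also have "(\<Sum>n\<in>N. \<Sum>n'\<in>N. (c n n')\<^sup>2) = (\<Sum>e\<in>M. (x e)\<^sup>2 * q e)"
  proof -
    have "(\<Sum>n\<in>N. \<Sum>n'\<in>N. (c n n')\<^sup>2)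
      = (\<Sum>e\<in>M. \<Sum>f\<in>M. x e * x f *
          (\<Sum>n\<in>N. \<Sum>n'\<in>N. (C e n n' + C e n' n) / 2 * ((C f n n' + C f n' n) / 2)))"
      using sum_square_swap[of x "\<lambda>n n' k. (C k n n' + C k n' n) / 2" M N N]
      by (simp add: c_def sum_divide_distrib)
    also have "\<dots> = (\<Sum>e\<in>M. \<Sum>f\<in>M. if e = f then (x e)\<^sup>2 * q e else 0)"
    proof (intro sum.cong refl)
      fix e f assume ef: "e \<in> M" "f \<in> M"
      have "(\<Sum>n\<in>N. \<Sum>n'\<in>N. (C e n n' + C e n' n) / 2 * ((C f n n' + C f n' n) / 2))
          = (\<Sum>n\<in>N. \<Sum>n'\<in>N. (C e n n' + C e n' n) * (C f n n' + C f n' n)) / 4"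
        by (simp add: sum_divide_distrib)
      also have "\<dots> = (if e = f then q e else 0)"
        using ef by (simp add: orth_MM q_def power2_eq_square)
      finally show "x e * x f *
          (\<Sum>n\<in>N. \<Sum>n'\<in>N. (C e n n' + C e n' n) / 2 * ((C f n n' + C f n' n) / 2))
          = (if e = f then (x e)\<^sup>2 * q e else 0)"
        by (simp add: power2_eq_square)
    qed
    also have "\<dots> = (\<Sum>e\<in>M. (x e)\<^sup>2 * q e)" using fin by simp
    finally show ?thesis .
  qed
  finally show ?thesis by (simp add: sum_nonneg)
qed

text \<open>The entries \<open>(z, n)\<close> and \<open>(n, z)\<close> are kept although they only see the \<open>N\<close>-part of \<open>x\<close>: they cancel
  the contribution of \<open>z\<close> to the positive term of the curvature, which is not small.\<close>

lemma sum_S: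
  "(\<Sum>i\<in>I. \<Sum>j\<in>I. (S i j)\<^sup>2) \<ge> (\<Sum>n\<in>N. (d n * x n)\<^sup>2) / 2 + (\<Sum>e\<in>M. \<Sum>f\<in>M. (S e f)\<^sup>2)
     + (x z)\<^sup>2 * (\<Sum>n\<in>N. (d n)\<^sup>2) + (\<Sum>e\<in>M. (x e)\<^sup>2 * q e)"
proof -
  have nonneg: "0 \<le> (\<Sum>i\<in>J. \<Sum>j\<in>K. (S i j)\<^sup>2)" "0 \<le> (\<Sum>j\<in>K. (S i j)\<^sup>2)" for J K i
    by (simp_all add: sum_nonneg)
  have "(\<Sum>i\<in>I. \<Sum>j\<in>I. (S i j)\<^sup>2) \<ge> (\<Sum>n\<in>N. (S z n)\<^sup>2) + (\<Sum>n\<in>N. (S n z)\<^sup>2)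
      + (\<Sum>e\<in>M. \<Sum>f\<in>M. (S e f)\<^sup>2) + (\<Sum>n\<in>N. \<Sum>n'\<in>N. (S n n')\<^sup>2)"
    unfolding sum_I sum.distrib
    using nonneg(1)[of T T] nonneg(1)[of T M] nonneg(1)[of T N] nonneg(1)[of M T] nonneg(1)[of M N]
      nonneg(1)[of N T] nonneg(1)[of N M] nonneg(2)[where i = z and K = T] nonneg(2)[where i = z and K = M]
      sum_nonneg[of T "\<lambda>i. (S i z)\<^sup>2"] sum_nonneg[of M "\<lambda>i. (S i z)\<^sup>2"]
      zero_le_power2[of "S z z"]
    by simp
  moreover have "(\<Sum>n\<in>N. (S z n)\<^sup>2) + (\<Sum>n\<in>N. (S n z)\<^sup>2) = (\<Sum>n\<in>N. (d n * x n)\<^sup>2) / 2"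
    unfolding sum.distrib[symmetric] sum_divide_distrib
    by (intro sum.cong refl) (simp add: S_zN power2_eq_square)
  ultimately show ?thesis using sum_S_NN by linarith
qed

text \<open>The pairing of the bracket of two basis vectors with \<open>x\<close>.\<close>

definition "W i j = (\<Sum>k\<in>I. C i j k * x k)"

lemma sum_W:
  "(\<Sum>i\<in>I. \<Sum>j\<in>I. (W i j)\<^sup>2) \<le> 2 * (\<Sum>n\<in>N. (d n * x n)\<^sup>2) + 2 * A * (\<Sum>e\<in>M. (x e)\<^sup>2)
     + 2 * B * (\<Sum>n\<in>N. (x n)\<^sup>2)"
proof -
  have W_skew: "(W i j)\<^sup>2 = (W j i)\<^sup>2" for i j
  proof -
    have "W i j = - W j i" unfolding W_def by (subst skew) (simp add: sum_negf)
    then show ?thesis by simp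
  qed
  have zz: "W z z = 0" and zM: "k \<in> M \<Longrightarrow> W z k = 0" and zT: "k \<in> T \<Longrightarrow> W z k = 0" for k
    using disj by (auto simp: W_def Z intro!: sum.neutral)
  have TT: "k \<in> T \<Longrightarrow> l \<in> T \<Longrightarrow> W k l = 0" and MM: "e \<in> M \<Longrightarrow> f \<in> M \<Longrightarrow> W e f = 0"
    and NN: "n \<in> N \<Longrightarrow> n' \<in> N \<Longrightarrow> W n n' = 0" for k l e f n n'
    by (auto simp: W_def TT MM NN)
  have zN: "W z n = d n * x n" if "n \<in> N" for n
  proof -
    have "W z n = (\<Sum>k\<in>I. if k = n then d n * x n else 0)"
      unfolding W_def using that by (intro sum.cong refl) (simp add: Z)
    then show ?thesis using that fin by simp
  qed
  have WTM: "W k e = (\<Sum>f\<in>M. C k e f * x f)" if "k \<in> T" "e \<in> M" for k e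
    unfolding W_def using that fin disj by (intro sum.mono_neutral_right) (auto simp: TM)
  have WN: "W k n = (\<Sum>v\<in>N. C k n v * x v)" if "k \<in> T \<union> M" "n \<in> N" for k n
    unfolding W_def using that fin disj by (intro sum.mono_neutral_right) (auto simp: TN MN)
  have "(\<Sum>i\<in>I. \<Sum>j\<in>I. (W i j)\<^sup>2) = 2 * (\<Sum>n\<in>N. (W z n)\<^sup>2)
      + 2 * (\<Sum>k\<in>T. \<Sum>e\<in>M. (W k e)\<^sup>2) + 2 * (\<Sum>k\<in>T. \<Sum>n\<in>N. (W k n)\<^sup>2)
      + 2 * (\<Sum>k\<in>M. \<Sum>n\<in>N. (W k n)\<^sup>2)"
  proof -
    have "(\<Sum>i\<in>N. (W i z)\<^sup>2) = (\<Sum>n\<in>N. (W z n)\<^sup>2)"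
      by (intro sum.cong refl W_skew)
    moreover have "(\<Sum>i\<in>J. \<Sum>j\<in>K. (W i j)\<^sup>2) = (\<Sum>i\<in>K. \<Sum>j\<in>J. (W i j)\<^sup>2)" for J K
      by (subst sum.swap) (intro sum.cong refl W_skew)
    note this[of M T] this[of N T] this[of N M]
    moreover have "(W i z)\<^sup>2 = 0" if "i \<in> T \<union> M" for i
      using W_skew[of i z] zT zM that by auto
    ultimately show ?thesis
      unfolding sum_I sum.distrib
      by (simp add: zz zT zM TT MM NN)
  qed
  moreover have "(\<Sum>k\<in>T. \<Sum>e\<in>M. (W k e)\<^sup>2) \<le> A * (\<Sum>e\<in>M. (x e)\<^sup>2)"
    unfolding A_def sum_distrib_right[where 'a = real and r = "\<Sum>e\<in>M. (x e)\<^sup>2"]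
  proof (intro sum_mono)
    fix k e assume "k \<in> T" "e \<in> M"
    then show "(W k e)\<^sup>2 \<le> (\<Sum>f\<in>M. (C k e f)\<^sup>2 * (\<Sum>e\<in>M. (x e)\<^sup>2))"
      using Cauchy_Schwarz_ineq_sum[of "C k e" x M] by (simp add: WTM sum_distrib_right)
  qed
  moreover have "(\<Sum>k\<in>T. \<Sum>n\<in>N. (W k n)\<^sup>2) + (\<Sum>k\<in>M. \<Sum>n\<in>N. (W k n)\<^sup>2) \<le> B * (\<Sum>n\<in>N. (x n)\<^sup>2)"
  proof -
    have "(\<Sum>k\<in>T. \<Sum>n\<in>N. (W k n)\<^sup>2) + (\<Sum>k\<in>M. \<Sum>n\<in>N. (W k n)\<^sup>2) = (\<Sum>k\<in>T\<union>M. \<Sum>n\<in>N. (W k n)\<^sup>2)"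
      using fin disj by (subst sum.union_disjoint) auto
    also have "\<dots> \<le> B * (\<Sum>n\<in>N. (x n)\<^sup>2)"
      unfolding B_def sum_distrib_right[where 'a = real and r = "\<Sum>n\<in>N. (x n)\<^sup>2"]
    proof (intro sum_mono)
      fix k n assume "k \<in> T \<union> M" "n \<in> N"
      then show "(W k n)\<^sup>2 \<le> (\<Sum>v\<in>N. (C k n v)\<^sup>2 * (\<Sum>n\<in>N. (x n)\<^sup>2))"
        using Cauchy_Schwarz_ineq_sum[of "C k n" x N] by (simp add: WN sum_distrib_right)
    qed
    finally show ?thesis .
  qed
  moreover have "(\<Sum>n\<in>N. (W z n)\<^sup>2) = (\<Sum>n\<in>N. (d n * x n)\<^sup>2)" by (simp add: zN)
  ultimately show ?thesis by (simp add: algebra_simps)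
qed

text \<open>Only \<open>z\<close> acts with nonzero trace, so the mean curvature vector is the positive multiple
  \<open>sum d N\<close> of it.\<close>

lemma mean_curvature_term:
  "(\<Sum>i\<in>I. (\<Sum>l\<in>I. C i l l) * (\<Sum>j\<in>I. \<Sum>k\<in>I. C i j k * x j * x k))
     = (\<Sum>v\<in>N. d v) * (\<Sum>n\<in>N. d n * (x n)\<^sup>2)"
proof -
  have tz: "(\<Sum>l\<in>I. C z l l) = (\<Sum>v\<in>N. d v)"
    using disj by (simp add: sum_I Z subset_eq disjoint_iff cong: sum.cong)
  have tT: "(\<Sum>l\<in>I. C k l l) = 0" if "k \<in> T" for k
  proof -
    have "C k z z = 0" using that disj by (auto simp: Z')
    then show ?thesis unfolding sum_I using that by (simp add: TT trace_TM trace_TN)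
  qed
  have tM: "(\<Sum>l\<in>I. C k l l) = 0" if "k \<in> M" for k
  proof (intro sum.neutral ballI)
    fix l assume "l \<in> I"
    moreover have "k \<in> I" using that by simp
    ultimately show "C k l l = 0"
      using into_z[of k l] into_T[of k l l] MM[OF that, of l] diag_MN[OF that, of l] by auto
  qed
  have tN: "(\<Sum>l\<in>I. C k l l) = 0" if "k \<in> N" for k
  proof (intro sum.neutral ballI)
    fix l assume "l \<in> I"
    then show "C k l l = 0" using NI[OF that, of l l] NN[OF that, of l] by auto
  qed
  have "(\<Sum>j\<in>I. \<Sum>k\<in>I. C z j k * x j * x k) = (\<Sum>j\<in>I. if j \<in> N then d j * (x j)\<^sup>2 else 0)"
  proof (intro sum.cong refl)
    fix j assume "j \<in> I"
    have "(\<Sum>k\<in>I. C z j k * x j * x k) = (\<Sum>k\<in>I. if k = j then (if j \<in> N then d j * (x j)\<^sup>2 else 0) else 0)"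
      by (intro sum.cong refl) (simp add: Z power2_eq_square)
    then show "(\<Sum>k\<in>I. C z j k * x j * x k) = (if j \<in> N then d j * (x j)\<^sup>2 else 0)"
      using \<open>j \<in> I\<close> fin by (subst (asm) sum.delta) auto
  qed
  also have "\<dots> = (\<Sum>n\<in>N. d n * (x n)\<^sup>2)"
    using fin by (intro sum.mono_neutral_cong_right) auto
  finally show ?thesis
    unfolding sum_I[of "\<lambda>i. (\<Sum>l\<in>I. C i l l) * _ i"] by (simp add: tz tT tM tN)
qed

text \<open>Each of the four blocks gets a negative definite share: \<open>z\<close> from the norm of its action, \<open>T\<close> from the
  symmetric part of its action on \<open>M\<close>, \<open>M\<close> from the symmetric part of its action on \<open>N\<close>, and \<open>N\<close> from
  the mean curvature.\<close>

lemma ricci_form_bound: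
  "ricci_form I C x \<le> - (x z)\<^sup>2 * (\<Sum>n\<in>N. (d n)\<^sup>2) - (\<Sum>e\<in>M. \<Sum>f\<in>M. (S e f)\<^sup>2)
     - (\<Sum>e\<in>M. (x e)\<^sup>2 * (q e - A / 2)) - (\<Sum>n\<in>N. (x n)\<^sup>2 * ((\<Sum>v\<in>N. d v) * d n - B / 2))"
proof -
  have "ricci_form I C x = - (\<Sum>i\<in>I. \<Sum>j\<in>I. (S i j)\<^sup>2) + (\<Sum>i\<in>I. \<Sum>j\<in>I. (W i j)\<^sup>2) / 4
      - (\<Sum>v\<in>N. d v) * (\<Sum>n\<in>N. d n * (x n)\<^sup>2)"
    unfolding ricci_form_def S_def W_def mean_curvature_term by simp
  moreover have "(\<Sum>e\<in>M. (x e)\<^sup>2 * (q e - A / 2)) = (\<Sum>e\<in>M. (x e)\<^sup>2 * q e) - A / 2 * (\<Sum>e\<in>M. (x e)\<^sup>2)"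
    by (simp add: right_diff_distrib sum_subtractf sum_distrib_left mult.commute)
  moreover have "(\<Sum>n\<in>N. (x n)\<^sup>2 * (D * d n - B / 2))
      = D * (\<Sum>n\<in>N. d n * (x n)\<^sup>2) - B / 2 * (\<Sum>n\<in>N. (x n)\<^sup>2)" for D
    by (simp add: right_diff_distrib sum_subtractf sum_distrib_left mult_ac)
  ultimately show ?thesis using sum_S sum_W by simp
qed

lemma ricci_form_negative:
  assumes "\<exists>i\<in>I. x i \<noteq> 0"
  shows "ricci_form I C x < 0"
proof (rule ccontr)
  assume "\<not> ricci_form I C x < 0"
  moreover have "0 \<le> (x z)\<^sup>2 * (\<Sum>n\<in>N. (d n)\<^sup>2)" by (simp add: sum_nonneg)
  moreover have S0: "0 \<le> (\<Sum>e\<in>M. \<Sum>f\<in>M. (S e f)\<^sup>2)" by (simp add: sum_nonneg)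
  moreover have M_pos: "0 < q e - A / 2" if "e \<in> M" for e
    using small_M[OF that] by (simp add: A_def q_def)
  then have M0: "0 \<le> (\<Sum>e\<in>M. (x e)\<^sup>2 * (q e - A / 2))" by (intro sum_nonneg) (simp add: less_imp_le)
  moreover have N_pos: "0 < (\<Sum>v\<in>N. d v) * d n - B / 2" if "n \<in> N" for n
    using small_N[OF that] by (simp add: B_def)
  then have N0: "0 \<le> (\<Sum>n\<in>N. (x n)\<^sup>2 * ((\<Sum>v\<in>N. d v) * d n - B / 2))"
    by (intro sum_nonneg) (simp add: less_imp_le)
  ultimately have eq: "(x z)\<^sup>2 * (\<Sum>n\<in>N. (d n)\<^sup>2) = 0" "(\<Sum>e\<in>M. \<Sum>f\<in>M. (S e f)\<^sup>2) = 0"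
    "(\<Sum>e\<in>M. (x e)\<^sup>2 * (q e - A / 2)) = 0"
    "(\<Sum>n\<in>N. (x n)\<^sup>2 * ((\<Sum>v\<in>N. d v) * d n - B / 2)) = 0"
    using ricci_form_bound by linarith+
  have "0 < (\<Sum>n\<in>N. (d n)\<^sup>2)"
    using fin N_nonempty d_pos by (intro sum_pos) force+
  then have "x z = 0" using eq(1) by simp
  moreover have "x e = 0" if "e \<in> M" for e
  proof -
    have "(x e)\<^sup>2 * (q e - A / 2) = 0"
      using eq(3) fin M_pos that by (subst (asm) sum_nonneg_eq_0_iff) (auto simp: less_imp_le)
    then show ?thesis using M_pos[OF that] by simp
  qed
  moreover have "x n = 0" if "n \<in> N" for n
  proof -
    have "(x n)\<^sup>2 * ((\<Sum>v\<in>N. d v) * d n - B / 2) = 0"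
      using eq(4) fin N_pos that by (subst (asm) sum_nonneg_eq_0_iff) (auto simp: less_imp_le)
    then show ?thesis using N_pos[OF that] by simp
  qed
  moreover have "x k = 0" if "k \<in> T" for k
  proof (rule faithful[OF _ that])
    fix e f assume ef: "e \<in> M" "f \<in> M"
    have "(\<Sum>f\<in>M. (S e f)\<^sup>2) = 0"
      using eq(2) fin ef by (subst (asm) sum_nonneg_eq_0_iff) (auto simp: sum_nonneg)
    then have "S e f = 0" using fin ef by (subst (asm) sum_nonneg_eq_0_iff) auto
    then show "(\<Sum>k\<in>T. x k * (C k e f + C k f e)) = 0" using ef by (simp add: S_MM)
  qed
  ultimately show False using assms by auto
qed

end

end

section \<open>Compact semisimple Lie algebras\<close>

locale lie_algebra =
  fixes br :: "'g::real_vector \<Rightarrow> 'g \<Rightarrow> 'g"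
  assumes lie: "real_lie_algebra br"
begin

sublocale alternating_algebra br
  using lie by unfold_locales (auto simp: real_lie_algebra_def)

lemma jacobi: "br x (br y z) = br (br x y) z + br y (br x z)"
proof -
  have "br x (br y z) + br y (br z x) + br z (br x y) = 0"
    using lie by (simp add: real_lie_algebra_def)
  moreover have "br y (br z x) = - br y (br x z)" by (subst br_skew[of z x]) (simp add: br_simps)
  moreover have "br z (br x y) = - br (br x y) z" by (rule br_skew)
  ultimately show ?thesis by (simp add: algebra_simps)
qed

lemma linear_br_br: "linear (\<lambda>z. br x (br y z))"
  using linear_compose[OF br_linear(1) br_linear(1)] by (simp add: o_def)

lemma finite_basis:
  fixes V :: "'g set"
  assumes "subspace V" obtains B where "finite B" "independent B" "span B = V"
proof -
  obtain F :: "'g set" where "finite F" "span F = UNIV" using lie by (auto simp: real_lie_algebra_def)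
  then obtain B where "finite B" "independent B" "span B = V"
    using finite_basis_subspace[of F V] assms by auto
  then show ?thesis by (rule that)
qed

lemma finite_subspaceI:
  fixes V :: "'g set"
  assumes "subspace V" shows "finite_subspace V"
proof
  show "\<exists>B. finite B \<and> independent B \<and> span B = V"
    using finite_basis[OF assms] by metis
qed

lemma independent_finite: assumes "independent (B :: 'g set)" shows "finite B"
proof -
  obtain F :: "'g set" where "finite F" "span F = UNIV" using lie by (auto simp: real_lie_algebra_def)
  then show ?thesis using real_vector.independent_span_bound[OF _ assms, of F] by simp
qed

end

locale compact_lie = lie_algebra br for br :: "'g::real_vector \<Rightarrow> 'g \<Rightarrow> 'g" +
  fixes u :: "'g set"
  assumes compact: "compact_semisimple br u"
begin

lemma subspace_u: "subspace u"
  using compact by (simp add: compact_semisimple_def lie_subalgebra_def subspace_raw_def)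

lemma u_closed: "x \<in> u \<Longrightarrow> y \<in> u \<Longrightarrow> br x y \<in> u"
  using compact by (simp add: compact_semisimple_def lie_subalgebra_def)

sublocale finite_subspace u
  by (rule finite_subspaceI[OF subspace_u])

definition \<kappa> :: "'g \<Rightarrow> 'g \<Rightarrow> real" where "\<kappa> x y = trace_on scaleR u (\<lambda>z. br x (br y z))"

lemma \<kappa>_neg: "x \<in> u \<Longrightarrow> x \<noteq> 0 \<Longrightarrow> \<kappa> x x < 0"
  using compact by (simp add: compact_semisimple_def killing_form_def \<kappa>_def)

lemma \<kappa>_commute: assumes "x \<in> u" "y \<in> u" shows "\<kappa> x y = \<kappa> y x"
  unfolding \<kappa>_def using assms by (intro trace_on_commute br_linear) (auto simp: u_closed)

lemma \<kappa>_add: assumes "x \<in> u" "y \<in> u" "z \<in> u" shows "\<kappa> (x + y) z = \<kappa> x z + \<kappa> y z"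
  unfolding \<kappa>_def br_simps using assms
  by (intro trace_on_add linear_br_br) (auto simp: u_closed)

lemma \<kappa>_scale: assumes "x \<in> u" "z \<in> u" shows "\<kappa> (c *\<^sub>R x) z = c * \<kappa> x z"
  unfolding \<kappa>_def br_simps using assms
  by (intro trace_on_scale linear_br_br) (auto simp: u_closed)

lemma \<kappa>_add_right: assumes "x \<in> u" "y \<in> u" "z \<in> u" shows "\<kappa> z (x + y) = \<kappa> z x + \<kappa> z y"
  using \<kappa>_add[OF assms] assms by (simp add: \<kappa>_commute[of z] subspace_add[OF subspace_u])

lemma \<kappa>_scale_right: assumes "x \<in> u" "z \<in> u" shows "\<kappa> z (c *\<^sub>R x) = c * \<kappa> z x"
  using \<kappa>_scale[OF assms] assms by (simp add: \<kappa>_commute[of z] subspace_scale[OF subspace_u])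

lemma \<kappa>_zero: "x \<in> u \<Longrightarrow> \<kappa> x 0 = 0" "x \<in> u \<Longrightarrow> \<kappa> 0 x = 0"
  using \<kappa>_scale_right[of 0 x 0] \<kappa>_scale[of 0 x 0] subspace_0[OF subspace_u] by auto

lemma \<kappa>_minus: "x \<in> u \<Longrightarrow> y \<in> u \<Longrightarrow> \<kappa> (- x) y = - \<kappa> x y" "x \<in> u \<Longrightarrow> y \<in> u \<Longrightarrow> \<kappa> x (- y) = - \<kappa> x y"
  using \<kappa>_scale_right[of y x "-1"] \<kappa>_scale[of x y "-1"] by auto

lemma \<kappa>_invariant:
  assumes "x \<in> u" "y \<in> u" "z \<in> u" shows "\<kappa> (br x y) z = \<kappa> x (br y z)"
proof -
  have lin: "linear (\<lambda>w. br x (br y (br z w)))" for x y z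
    using linear_compose[OF linear_br_br br_linear(1)] by (simp add: o_def)
  have "\<kappa> (br x y) z = trace_on scaleR u (\<lambda>w. br x (br y (br z w)) - br y (br x (br z w)))"
    unfolding \<kappa>_def by (intro arg_cong[where f = "trace_on scaleR u"] ext) (simp add: jacobi[of x y])
  also have "\<dots> = trace_on scaleR u (\<lambda>w. br x (br y (br z w))) - trace_on scaleR u (\<lambda>w. br y (br x (br z w)))"
    using assms by (intro trace_on_diff lin) (auto simp: u_closed)
  also have "trace_on scaleR u (\<lambda>w. br y (br x (br z w))) = trace_on scaleR u (\<lambda>w. br x (br z (br y w)))"
    using assms
    by (intro trace_on_commute[where f = "br y" and g = "\<lambda>w. br x (br z w)"] br_linear linear_br_br)
      (auto simp: u_closed)
  also have "trace_on scaleR u (\<lambda>w. br x (br y (br z w))) - \<dots>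
      = trace_on scaleR u (\<lambda>w. br x (br y (br z w)) - br x (br z (br y w)))"
    using assms by (intro trace_on_diff[symmetric] lin) (auto simp: u_closed)
  also have "\<dots> = \<kappa> x (br y z)"
    unfolding \<kappa>_def
    by (intro arg_cong[where f = "trace_on scaleR u"] ext) (simp add: jacobi[of y z] br_simps)
  finally show ?thesis .
qed

lemma central_zero:
  assumes "x \<in> u" "\<And>y. y \<in> u \<Longrightarrow> br x y = 0" shows "x = 0"
proof -
  obtain B where B: "finite B" "independent B" "span B = u" using basis by blast
  have "\<kappa> x x = (\<Sum>b\<in>B. representation B (br x (br x b)) b)"
    unfolding \<kappa>_def using assms(1)
    by (intro trace_on_linear_basis[OF B] linear_br_br) (auto simp: u_closed)
  also have "\<dots> = 0"
    using assms(2) B(3) span_superset[of B]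
    by (intro sum.neutral) (auto simp: br_simps subset_iff real_vector.representation_zero)
  finally show ?thesis using \<kappa>_neg[OF assms(1)] by force
qed

text \<open>The vectors \<open>H\<^sub>\<alpha>\<close> turn out to be of the form \<open>(0, k)\<close>, i.e. \<open>\<i> k\<close> with \<open>k\<close> in \<open>u\<close>; this formula then
  expresses the roots by the real Killing form.  It holds because a real basis of \<open>u\<close> is a complex
  basis of \<open>u \<times> u\<close>.\<close>

lemma killing_form_imaginary:
  assumes "p \<in> u" "q \<in> u" "k \<in> u"
  shows "killing_form complex_scale (complex_bracket br) (u \<times> u) (p, q) (0, k)
       = Complex (- \<kappa> q k) (\<kappa> p k)"
proof -
  interpret cx: vector_space "complex_scale :: complex \<Rightarrow> 'g \<times> 'g \<Rightarrow> _"
    by (rule vector_space_complex_scale)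
  obtain B where B: "finite B" "independent B" "span B = u" using basis by blast
  have inj: "inj_on (\<lambda>b. (b, 0 :: 'g)) B" by (auto intro: inj_onI)
  define B' where "B' = (\<lambda>b. (b, 0 :: 'g)) ` B"
  have fin: "finite B'" using B by (simp add: B'_def)
  have sum_B': "(\<Sum>b\<in>B'. complex_scale (g b) b)
      = (\<Sum>b\<in>B. Re (g (b, 0)) *\<^sub>R b, \<Sum>b\<in>B. Im (g (b, 0)) *\<^sub>R b)" for g
    unfolding B'_def using inj
    by (simp add: sum.reindex complex_scale_def prod_eq_iff fst_sum snd_sum)
  have expand: "(\<Sum>b\<in>B. representation B x b *\<^sub>R b) = x" if "x \<in> u" for x
    using that B by (intro real_vector.sum_representation_eq) auto
  have pair: "(\<Sum>b\<in>B'. complex_scale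
      (Complex (representation B x (fst b)) (representation B y (fst b))) b) = (x, y)"
    if "x \<in> u" "y \<in> u" for x y
    using that by (simp add: sum_B' expand)
  have ind: "cx.independent B'"
  proof (rule cx.independent_if_scalars_zero[OF fin])
    fix g b assume g: "(\<Sum>x\<in>B'. complex_scale (g x) x) = 0" and b: "b \<in> B'"
    then obtain a where a: "b = (a, 0)" "a \<in> B" by (auto simp: B'_def)
    have "Re (g (a, 0)) = representation B (\<Sum>b\<in>B. Re (g (b, 0)) *\<^sub>R b) a"
      using real_vector.representation_sum_scale[OF B(1,2) a(2), of "\<lambda>b. Re (g (b, 0))"] by simp
    moreover have "Im (g (a, 0)) = representation B (\<Sum>b\<in>B. Im (g (b, 0)) *\<^sub>R b) a"
      using real_vector.representation_sum_scale[OF B(1,2) a(2), of "\<lambda>b. Im (g (b, 0))"] by simp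
    ultimately show "g b = 0"
      using g by (simp add: sum_B' a zero_prod_def complex_eq_iff real_vector.representation_zero)
  qed
  have subu: "cx.subspace (u \<times> u)"
    using subspace_u
    by (auto simp: cx.subspace_def complex_scale_def zero_prod_def subspace_0 subspace_add
        subspace_diff subspace_scale)
  have spn: "cx.span B' = u \<times> u"
  proof
    show "cx.span B' \<subseteq> u \<times> u"
      using B span_superset[of B] subspace_u
      by (intro cx.span_minimal subu) (auto simp: B'_def subspace_0)
    show "u \<times> u \<subseteq> cx.span B'"
    proof (clarify)
      fix x y assume xy: "x \<in> u" "y \<in> u"
      have "(\<Sum>b\<in>B'. complex_scale
          (Complex (representation B x (fst b)) (representation B y (fst b))) b) \<in> cx.span B'"
        by (intro cx.span_sum cx.span_scale cx.span_base)
      then show "(x, y) \<in> cx.span B'" unfolding pair[OF xy] .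
    qed
  qed
  let ?f = "\<lambda>z. complex_bracket br (p, q) (complex_bracket br (0, k) z)"
  have "killing_form complex_scale (complex_bracket br) (u \<times> u) (p, q) (0, k)
      = (\<Sum>b\<in>B'. cx.representation B' (?f b) b)"
    unfolding killing_form_def
  proof (rule cx.trace_on_basis[OF fin ind spn])
    show "?f (x + y) = ?f x + ?f y" for x y
      by (simp add: complex_bracket_def br_simps algebra_simps)
    show "?f (complex_scale c x) = complex_scale c (?f x)" for c x
      by (simp add: complex_bracket_def complex_scale_def br_simps algebra_simps)
    show "?f x \<in> u \<times> u" if "x \<in> u \<times> u" for x
      using that assms subspace_u
      by (auto simp: complex_bracket_def u_closed br_simps intro!: subspace_add subspace_diff subspace_neg)
  qed
  also have "\<dots> = (\<Sum>b\<in>B'. Complex (representation B (- br q (br k (fst b))) (fst b))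
      (representation B (br p (br k (fst b))) (fst b)))"
  proof (rule sum.cong[OF refl])
    fix b' assume b': "b' \<in> B'"
    then obtain b where b: "b' = (b, 0)" "b \<in> B" by (auto simp: B'_def)
    have bu: "b \<in> u" using b B span_superset[of B] by auto
    then have in_u: "- br q (br k b) \<in> u" "br p (br k b) \<in> u"
      using assms by (auto simp: u_closed intro!: subspace_neg[OF subspace_u])
    have "?f b' = (- br q (br k b), br p (br k b))"
      by (simp add: b complex_bracket_def br_simps)
    also have "\<dots> = (\<Sum>a\<in>B'. complex_scale (Complex (representation B (- br q (br k b)) (fst a))
         (representation B (br p (br k b)) (fst a))) a)"
      by (rule pair[OF in_u, symmetric])
    finally show "cx.representation B' (?f b') b' = Complex (representation B (- br q (br k (fst b'))) (fst b'))
      (representation B (br p (br k (fst b'))) (fst b'))"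
      using cx.representation_sum_scale[OF fin ind b'] b by simp
  qed
  also have "\<dots> = (\<Sum>b\<in>B. Complex (representation B (- br q (br k b)) b) (representation B (br p (br k b)) b))"
    unfolding B'_def using inj by (simp add: sum.reindex)
  also have "\<dots> = Complex (\<Sum>b\<in>B. representation B (- br q (br k b)) b) (\<Sum>b\<in>B. representation B (br p (br k b)) b)"
    by (simp add: complex_eq_iff Re_sum Im_sum)
  also have "(\<Sum>b\<in>B. representation B (br p (br k b)) b) = \<kappa> p k"
    unfolding \<kappa>_def using assms
    by (intro trace_on_linear_basis[symmetric] B linear_br_br) (auto simp: u_closed)
  also have "(\<Sum>b\<in>B. representation B (- br q (br k b)) b) = \<kappa> (- q) k"
    unfolding \<kappa>_def using assms
    by (subst trace_on_linear_basis[OF B linear_br_br])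
      (auto simp: u_closed br_simps intro!: subspace_neg[OF subspace_u])
  finally show ?thesis using assms by (simp add: \<kappa>_minus)
qed

lemma orthogonal_independent:
  assumes "M \<subseteq> u" "0 \<notin> M" "\<And>e f. e \<in> M \<Longrightarrow> f \<in> M \<Longrightarrow> e \<noteq> f \<Longrightarrow> \<kappa> e f = 0"
  shows "independent M"
  unfolding real_vector.independent_explicit_module
proof (intro allI impI)
  fix F c v assume F: "finite F" "F \<subseteq> M" and sum: "(\<Sum>w\<in>F. c w *\<^sub>R w) = 0" and v: "v \<in> F"
  have "\<kappa> v (\<Sum>w\<in>G. c w *\<^sub>R w) = (\<Sum>w\<in>G. c w * \<kappa> v w)" if "finite G" "G \<subseteq> u" for G
    using that
  proof (induction G)
    case empty then show ?case using v F assms(1) by (simp add: \<kappa>_zero subset_iff)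
  next
    case (insert w G)
    then have "(\<Sum>w\<in>G. c w *\<^sub>R w) \<in> u" "c w *\<^sub>R w \<in> u" "w \<in> u" "v \<in> u"
      using v F assms(1) subspace_u by (auto intro!: subspace_sum subspace_scale)
    then show ?case using insert by (simp add: \<kappa>_add_right \<kappa>_scale_right)
  qed
  then have "0 = (\<Sum>w\<in>F. c w * \<kappa> v w)"
    using sum F assms(1) v by (metis \<kappa>_zero(1) subset_iff subset_trans)
  also have "\<dots> = (\<Sum>w\<in>F. if w = v then c v * \<kappa> v v else 0)"
    using F v assms(3) by (intro sum.cong refl) (auto simp: subset_iff)
  also have "\<dots> = c v * \<kappa> v v" using F v by simp
  finally have "c v * \<kappa> v v = 0" by simp
  moreover have "v \<in> u" "v \<noteq> 0" using assms(1,2) v F by auto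
  ultimately show "c v = 0" using \<kappa>_neg[of v] by simp
qed

end

section \<open>The root decomposition of the compact real form\<close>

locale compact_roots = compact_lie br u + compact_root_data br u h \<Delta> P Hr X
  for br :: "'g::real_vector \<Rightarrow> 'g \<Rightarrow> 'g" and u h \<Delta> P Hr X
begin

text \<open>\<open>K \<alpha>\<close>, \<open>xx \<alpha>\<close> and \<open>yy \<alpha>\<close> are \<open>\<i> H\<^sub>\<alpha>\<close>, \<open>X\<^sup>\<alpha>\<close> and \<open>Y\<^sup>\<alpha>\<close> as elements of \<open>u\<close>, and \<open>T\<close> is the torus \<open>\<i> h\<^sub>\<real>\<close>.
  The real functional \<open>rt \<alpha>\<close> on \<open>T\<close> is \<open>\<alpha>\<close> divided by \<open>\<i>\<close>.\<close>

definition K where "K \<alpha> = fst (complex_scale \<i> (Hr \<alpha>))"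
definition xx where "xx \<alpha> = fst (X_up X \<alpha>)"
definition yy where "yy \<alpha> = fst (Y_up X \<alpha>)"
definition T where "T = fst ` complex_scale \<i> ` span (Hr ` \<Delta>)"
definition rt where "rt \<alpha> H = - \<kappa> H (K \<alpha>)"

lemma P_sub: "\<alpha> \<in> P \<Longrightarrow> \<alpha> \<in> \<Delta>"
  using positive by (auto simp: positive_system_def)

text \<open>The generators in the description of the real form have vanishing imaginary part, because they lie
  in their own span.\<close>

lemma in_real_form:
  assumes "\<alpha> \<in> \<Delta>"
  shows "complex_scale \<i> (Hr \<alpha>) = (K \<alpha>, 0)" "X_up X \<alpha> = (xx \<alpha>, 0)" "Y_up X \<alpha> = (yy \<alpha>, 0)"
    and K_u: "K \<alpha> \<in> u" and xx_u: "xx \<alpha> \<in> u" and yy_u: "yy \<alpha> \<in> u"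
proof -
  let ?G = "(\<lambda>\<alpha>. complex_scale \<i> (Hr \<alpha>)) ` \<Delta> \<union> X_up X ` \<Delta> \<union> Y_up X ` \<Delta>"
  have "complex_scale \<i> (Hr \<alpha>) \<in> ?G" "X_up X \<alpha> \<in> ?G" "Y_up X \<alpha> \<in> ?G" using assms by auto
  then have *: "complex_scale \<i> (Hr \<alpha>) \<in> u \<times> {0}" "X_up X \<alpha> \<in> u \<times> {0}" "Y_up X \<alpha> \<in> u \<times> {0}"
    unfolding real_form by (auto simp only: span_base)
  show "complex_scale \<i> (Hr \<alpha>) = (K \<alpha>, 0)" "X_up X \<alpha> = (xx \<alpha>, 0)" "Y_up X \<alpha> = (yy \<alpha>, 0)"
    "K \<alpha> \<in> u" "xx \<alpha> \<in> u" "yy \<alpha> \<in> u"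
    using * by (auto simp: K_def xx_def yy_def)
qed

lemma Hr_eq: assumes "\<alpha> \<in> \<Delta>" shows "Hr \<alpha> = (0, - K \<alpha>)"
  using in_real_form(1)[OF assms]
  by (cases "Hr \<alpha>") (auto simp: complex_scale_def minus_equation_iff[of _ "K \<alpha>"])

lemma X_eq:
  assumes "\<alpha> \<in> \<Delta>"
  shows "X \<alpha> = ((1/2) *\<^sub>R xx \<alpha>, - (1/2) *\<^sub>R yy \<alpha>)" "X (- \<alpha>) = (- (1/2) *\<^sub>R xx \<alpha>, - (1/2) *\<^sub>R yy \<alpha>)"
proof -
  obtain a b c d where ab: "X \<alpha> = (a, b)" "X (- \<alpha>) = (c, d)" by fastforce
  have "a - c = xx \<alpha>" "b - d = 0" "a + c = 0" "- (b + d) = yy \<alpha>"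
    using in_real_form(2,3)[OF assms] ab by (auto simp: X_up_def Y_up_def complex_scale_def)
  then have "c = - a" "d = b" "xx \<alpha> = 2 *\<^sub>R a" "yy \<alpha> = - 2 *\<^sub>R b"
    by (auto simp: add_eq_0_iff scaleR_2)
  then show "X \<alpha> = ((1/2) *\<^sub>R xx \<alpha>, - (1/2) *\<^sub>R yy \<alpha>)"
    "X (- \<alpha>) = (- (1/2) *\<^sub>R xx \<alpha>, - (1/2) *\<^sub>R yy \<alpha>)"
    using ab by auto
qed

lemma killing_Hr:
  assumes "\<alpha> \<in> \<Delta>" "p \<in> u" "q \<in> u"
  shows "killing_form complex_scale (complex_bracket br) (u \<times> u) (p, q) (Hr \<alpha>)
    = Complex (\<kappa> q (K \<alpha>)) (- \<kappa> p (K \<alpha>))"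
  unfolding Hr_eq[OF assms(1)]
  using assms K_u[OF assms(1)] subspace_neg[OF subspace_u, of "K \<alpha>"]
  by (subst killing_form_imaginary) (auto simp: \<kappa>_minus)

text \<open>Since \<open>H\<^sub>\<alpha>\<close> and \<open>H\<^sub>\<beta>\<close> are both purely imaginary, roots take real values on the \<open>H\<^sub>\<beta>\<close>.  This is why
  the torus rotates the planes spanned by \<open>xx \<alpha>\<close> and \<open>yy \<alpha>\<close>.\<close>

lemma root_value:
  assumes "\<alpha> \<in> \<Delta>" "\<beta> \<in> \<Delta>" shows "\<alpha> (Hr \<beta>) = of_real (rt \<alpha> (K \<beta>))"
proof -
  have "\<alpha> (Hr \<beta>) = killing_form complex_scale (complex_bracket br) (u \<times> u) (0, - K \<beta>) (Hr \<alpha>)"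
    using Hr_dual[OF assms(1) Hr_mem[OF assms(2)]] Hr_eq[OF assms(2)] by simp
  also have "\<dots> = Complex (- \<kappa> (K \<beta>) (K \<alpha>)) 0"
    using assms K_u subspace_u
    by (subst killing_Hr) (auto simp: subspace_0 subspace_neg \<kappa>_minus \<kappa>_zero)
  finally show ?thesis by (simp add: rt_def complex_eq_iff)
qed

text \<open>The real and the imaginary part of \<open>[H\<^sub>\<beta>, X\<^sub>\<alpha>] = \<alpha>(H\<^sub>\<beta>) X\<^sub>\<alpha>\<close>, where \<open>X\<^sub>\<alpha> = (xx \<alpha> - \<i> yy \<alpha>) / 2\<close>.\<close>

lemma br_K:
  assumes "\<alpha> \<in> \<Delta>" "\<beta> \<in> \<Delta>"
  shows "br (K \<beta>) (xx \<alpha>) = rt \<alpha> (K \<beta>) *\<^sub>R yy \<alpha>" "br (K \<beta>) (yy \<alpha>) = - rt \<alpha> (K \<beta>) *\<^sub>R xx \<alpha>"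
proof -
  have "complex_bracket br (Hr \<beta>) (X \<alpha>) = complex_scale (\<alpha> (Hr \<beta>)) (X \<alpha>)"
    using X_root_space[OF assms(1)] Hr_mem[OF assms(2)] by (simp add: root_space_def)
  then have "- ((1/2) *\<^sub>R br (K \<beta>) (yy \<alpha>)) = (rt \<alpha> (K \<beta>) / 2) *\<^sub>R xx \<alpha>"
    "- ((1/2) *\<^sub>R br (K \<beta>) (xx \<alpha>)) = - ((rt \<alpha> (K \<beta>) / 2) *\<^sub>R yy \<alpha>)"
    unfolding root_value[OF assms] unfolding Hr_eq[OF assms(2)] X_eq(1)[OF assms(1)]
    by (auto simp: complex_bracket_def complex_scale_def br_simps)
  from this[THEN arg_cong[where f = "\<lambda>v. (-2) *\<^sub>R v"]]
  show "br (K \<beta>) (xx \<alpha>) = rt \<alpha> (K \<beta>) *\<^sub>R yy \<alpha>" "br (K \<beta>) (yy \<alpha>) = - rt \<alpha> (K \<beta>) *\<^sub>R xx \<alpha>"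
    by simp_all
qed

lemma br_xx_yy: assumes "\<alpha> \<in> \<Delta>" shows "br (xx \<alpha>) (yy \<alpha>) = 2 *\<^sub>R K \<alpha>"
proof -
  have "complex_bracket br (X \<alpha>) (X (- \<alpha>)) = (0, - K \<alpha>)"
    using X_opposite[OF assms] Hr_eq[OF assms] by simp
  then have "(1/4) *\<^sub>R br (yy \<alpha>) (xx \<alpha>) - (1/4) *\<^sub>R br (xx \<alpha>) (yy \<alpha>) = - K \<alpha>"
    unfolding X_eq[OF assms] by (auto simp: complex_bracket_def br_simps)
  from this[THEN arg_cong[where f = uminus]]
  have "K \<alpha> = (1/4) *\<^sub>R br (xx \<alpha>) (yy \<alpha>) - (1/4) *\<^sub>R br (yy \<alpha>) (xx \<alpha>)"
    unfolding minus_diff_eq minus_minus by (rule sym)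
  also have "\<dots> = (1/2) *\<^sub>R br (xx \<alpha>) (yy \<alpha>)"
    unfolding br_skew[of "yy \<alpha>" "xx \<alpha>"] by (simp add: scaleR_left_distrib[symmetric])
  finally have "(1/2) *\<^sub>R br (xx \<alpha>) (yy \<alpha>) = K \<alpha>" by simp
  then have "2 *\<^sub>R ((1/2) *\<^sub>R br (xx \<alpha>) (yy \<alpha>)) = 2 *\<^sub>R K \<alpha>" by simp
  then show ?thesis by simp
qed

lemma linear_rot: "linear (\<lambda>p. fst (complex_scale \<i> (p :: 'g \<times> 'g)))"
  by (rule linearI) (auto simp: complex_scale_def)

lemma T_span: "T = span (K ` \<Delta>)"
proof -
  have "T = (\<lambda>p. fst (complex_scale \<i> p)) ` span (Hr ` \<Delta>)" by (simp add: T_def image_image)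
  also have "\<dots> = span ((\<lambda>p. fst (complex_scale \<i> p)) ` Hr ` \<Delta>)"
    by (rule linear_span_image[OF linear_rot, symmetric])
  finally show ?thesis by (simp add: image_image K_def)
qed

lemma T_u: "H \<in> T \<Longrightarrow> H \<in> u"
  unfolding T_span using K_u span_minimal[OF _ subspace_u, of "K ` \<Delta>"] by auto

lemma rt_add:
  assumes "\<alpha> \<in> \<Delta>" "H \<in> u" "H' \<in> u"
  shows "rt \<alpha> (H + H') = rt \<alpha> H + rt \<alpha> H'" 
  using assms K_u by (simp_all add: rt_def \<kappa>_add)

lemma rt_scale: "\<alpha> \<in> \<Delta> \<Longrightarrow> H \<in> u \<Longrightarrow> rt \<alpha> (c *\<^sub>R H) = c * rt \<alpha> H"
  using K_u by (simp add: rt_def \<kappa>_scale)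

lemma br_T:
  assumes "H \<in> T" "\<alpha> \<in> \<Delta>"
  shows "br H (xx \<alpha>) = rt \<alpha> H *\<^sub>R yy \<alpha> \<and> br H (yy \<alpha>) = - rt \<alpha> H *\<^sub>R xx \<alpha>"
proof -
  have "H \<in> u \<and> br H (xx \<alpha>) = rt \<alpha> H *\<^sub>R yy \<alpha> \<and> br H (yy \<alpha>) = - rt \<alpha> H *\<^sub>R xx \<alpha>"
    using assms(1) unfolding T_span
  proof (induction rule: span_induct_alt)
    case base
    show ?case using assms(2) subspace_u by (simp add: subspace_0 br_simps rt_def K_u \<kappa>_zero)
  next
    case (step c k H)
    then obtain \<beta> where "k = K \<beta>" "\<beta> \<in> \<Delta>" by auto
    then show ?case
      using step assms(2) K_u subspace_u
      by (simp add: br_K br_simps rt_add rt_scale subspace_add subspace_scale algebra_simps)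
  qed
  then show ?thesis by simp
qed

lemma u_span: "u = span (K ` \<Delta> \<union> xx ` \<Delta> \<union> yy ` \<Delta>)"
proof -
  have "u = fst ` (u \<times> {0 :: 'g})" by force
  also have "\<dots> = span (fst ` ((\<lambda>\<alpha>. complex_scale \<i> (Hr \<alpha>)) ` \<Delta> \<union> X_up X ` \<Delta> \<union> Y_up X ` \<Delta>))"
    unfolding real_form by (rule linear_span_image[symmetric]) (rule linear_fst)
  also have "fst ` ((\<lambda>\<alpha>. complex_scale \<i> (Hr \<alpha>)) ` \<Delta> \<union> X_up X ` \<Delta> \<union> Y_up X ` \<Delta>)
      = K ` \<Delta> \<union> xx ` \<Delta> \<union> yy ` \<Delta>"
    by (auto simp: image_Un image_image K_def xx_def yy_def)
  finally show ?thesis .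
qed

text \<open>Such an \<open>H\<close> also commutes with \<open>[xx \<alpha>, yy \<alpha>] = 2 K \<alpha>\<close>, hence with all of \<open>u\<close>, which has no centre.\<close>

lemma root_vectors_centralizer:
  assumes "H \<in> u" "\<And>\<alpha>. \<alpha> \<in> \<Delta> \<Longrightarrow> br H (xx \<alpha>) = 0" "\<And>\<alpha>. \<alpha> \<in> \<Delta> \<Longrightarrow> br H (yy \<alpha>) = 0"
  shows "H = 0"
proof (rule central_zero[OF assms(1)])
  fix v assume "v \<in> u"
  have K0: "br H (K \<alpha>) = 0" if "\<alpha> \<in> \<Delta>" for \<alpha>
  proof -
    have "2 *\<^sub>R br H (K \<alpha>) = br H (br (xx \<alpha>) (yy \<alpha>))" by (simp add: br_xx_yy that br_simps)
    also have "\<dots> = 0" unfolding jacobi[of H] using that by (simp add: assms br_simps)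
    finally show ?thesis by simp
  qed
  have "span (K ` \<Delta> \<union> xx ` \<Delta> \<union> yy ` \<Delta>) \<subseteq> {v. br H v = 0}"
    using K0 assms(2,3) by (intro span_minimal) (auto simp: subspace_def br_simps)
  then show "br H v = 0" using \<open>v \<in> u\<close> u_span by auto
qed

lemma T_abelian: assumes "H \<in> T" "H' \<in> T" shows "br H H' = 0"
proof (rule root_vectors_centralizer)
  show "br H H' \<in> u" using assms by (simp add: T_u u_closed)
  fix \<alpha> assume \<alpha>: "\<alpha> \<in> \<Delta>"
  have 1: "br (br H H') v = br H (br H' v) - br H' (br H v)" for v
    by (simp add: jacobi[of H H'])
  show "br (br H H') (xx \<alpha>) = 0" "br (br H H') (yy \<alpha>) = 0"
    unfolding 1 using br_T[OF assms(1) \<alpha>] br_T[OF assms(2) \<alpha>] by (simp_all add: br_simps)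
qed

text \<open>Negating a root changes \<open>xx\<close> and \<open>yy\<close> by a sign at most, so the positive roots suffice to span \<open>u\<close>.\<close>

lemma negative_root_vectors:
  assumes "\<alpha> \<in> \<Delta>" "\<alpha> \<notin> P" shows "- \<alpha> \<in> P" "xx \<alpha> = - xx (- \<alpha>)" "yy \<alpha> = yy (- \<alpha>)"
proof -
  show "- \<alpha> \<in> P" using assms positive by (auto simp: positive_system_def)
  have "- (- \<alpha>) = \<alpha>" by simp
  then show "xx \<alpha> = - xx (- \<alpha>)" "yy \<alpha> = yy (- \<alpha>)"
    by (simp_all add: xx_def yy_def X_up_def Y_up_def add.commute)
qed

lemma rt_faithful:
  assumes "H \<in> T" "\<And>\<alpha>. \<alpha> \<in> P \<Longrightarrow> rt \<alpha> H = 0" shows "H = 0"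
proof (rule root_vectors_centralizer)
  show "H \<in> u" using assms by (simp add: T_u)
  have P0: "br H (xx \<alpha>) = 0" "br H (yy \<alpha>) = 0" if "\<alpha> \<in> P" for \<alpha>
    using br_T[OF assms(1) P_sub[OF that]] assms(2)[OF that] by auto
  show "br H (xx \<alpha>) = 0" "br H (yy \<alpha>) = 0" if "\<alpha> \<in> \<Delta>" for \<alpha>
    using P0[of \<alpha>] P0[of "- \<alpha>"] negative_root_vectors[OF that] by (cases "\<alpha> \<in> P"; simp add: br_simps)+
qed

text \<open>A root is the Killing dual of \<open>H\<^sub>\<alpha>\<close>, i.e. of a multiple of \<open>K \<alpha>\<close>.\<close>

lemma root_determined:
  assumes "\<alpha> \<in> \<Delta>" "\<beta> \<in> \<Delta>" "K \<alpha> = c *\<^sub>R K \<beta>" shows "\<alpha> = (\<lambda>H. of_real c * \<beta> H)"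
proof
  fix H
  have dual: "\<alpha> \<in> dual_on complex_scale h" "\<beta> \<in> dual_on complex_scale h"
    using assms roots by (auto simp: root_system_def)
  show "\<alpha> H = of_real c * \<beta> H"
  proof (cases "H \<in> h")
    case False then show ?thesis using dual by (cases H) (simp add: dual_on_def)
  next
    case True
    then have "H \<in> u \<times> u" using cartan by (auto simp: cartan_subalgebra_def)
    then obtain p q where H: "H = (p, q)" "p \<in> u" "q \<in> u" by auto
    have "\<alpha> H = Complex (\<kappa> q (K \<alpha>)) (- \<kappa> p (K \<alpha>))" "\<beta> H = Complex (\<kappa> q (K \<beta>)) (- \<kappa> p (K \<beta>))"
      using Hr_dual[OF _ True] killing_Hr[OF _ H(2,3)] assms(1,2) H(1) by auto
    then show ?thesis
      using assms(3) H K_u[OF assms(2)] by (simp add: \<kappa>_scale_right complex_eq_iff)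
  qed
qed

lemma K_nonzero: assumes "\<alpha> \<in> \<Delta>" shows "K \<alpha> \<noteq> 0"
proof
  assume "K \<alpha> = 0"
  then have "\<alpha> = (\<lambda>H. of_real 0 * \<alpha> H)" using root_determined[OF assms assms, of 0] by simp
  then have "\<alpha> = 0" by (simp add: fun_eq_iff)
  then show False using assms roots by (simp add: root_system_def)
qed

lemma xx_yy_nonzero: assumes "\<alpha> \<in> \<Delta>" shows "xx \<alpha> \<noteq> 0" "yy \<alpha> \<noteq> 0"
  using br_xx_yy[OF assms] K_nonzero[OF assms] by (auto simp: br_simps)

text \<open>If \<open>rt \<alpha> = c rt \<beta>\<close> on \<open>T\<close> then \<open>K \<alpha> - c K \<beta>\<close> is Killing-orthogonal to \<open>T\<close>, in particular to itself, and
  vanishes by definiteness; then \<open>\<alpha> = c \<beta>\<close>, and a positive system contains no root together with its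
  negative.\<close>

lemma rt_separates:
  assumes "\<alpha> \<in> P" "\<beta> \<in> P" "\<alpha> \<noteq> \<beta>" "c = 1 \<or> c = -1"
  shows "\<exists>H\<in>T. rt \<alpha> H \<noteq> c * rt \<beta> H"
proof (rule ccontr)
  assume "\<not> (\<exists>H\<in>T. rt \<alpha> H \<noteq> c * rt \<beta> H)"
  then have eq: "rt \<alpha> H = c * rt \<beta> H" if "H \<in> T" for H using that by blast
  have \<Delta>: "\<alpha> \<in> \<Delta>" "\<beta> \<in> \<Delta>" using assms P_sub by auto
  define H where "H = K \<alpha> + (- c) *\<^sub>R K \<beta>"
  have HT: "H \<in> T"
    unfolding H_def T_span using \<Delta> by (intro span_add span_scale span_base) auto
  have "\<kappa> H H = \<kappa> H (K \<alpha>) + \<kappa> H ((- c) *\<^sub>R K \<beta>)"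
    unfolding H_def[THEN arg_cong, of "\<kappa> H"]
    using T_u[OF HT] \<Delta> K_u by (intro \<kappa>_add_right subspace_scale[OF subspace_u]) auto
  also have "\<dots> = 0"
    using eq[OF HT] T_u[OF HT] \<Delta> K_u by (simp only: \<kappa>_scale_right) (simp add: rt_def)
  finally have "H = 0" using \<kappa>_neg[OF T_u[OF HT]] by force
  then have "K \<alpha> = c *\<^sub>R K \<beta>" by (simp add: H_def)
  from root_determined[OF \<Delta> this] assms(4) have "\<alpha> = \<beta> \<or> \<alpha> = - \<beta>"
    by (auto simp: fun_eq_iff)
  then have "- \<beta> \<in> P" using assms(1,3) by auto
  moreover have "\<beta> \<in> P \<longleftrightarrow> - \<beta> \<notin> P"
    using positive \<Delta>(2) unfolding positive_system_def by blast
  ultimately show False using assms(2) by blast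
qed

lemma orthogonal_T:
  assumes "H \<in> T" "\<alpha> \<in> \<Delta>" shows "\<kappa> H (xx \<alpha>) = 0" "\<kappa> H (yy \<alpha>) = 0"
proof -
  have KT: "K \<alpha> \<in> T" using assms by (auto simp: T_span span_base)
  have r: "rt \<alpha> (K \<alpha>) \<noteq> 0"
    using \<kappa>_neg[OF K_u[OF assms(2)] K_nonzero[OF assms(2)]] by (simp add: rt_def)
  have 0: "\<kappa> H (br (K \<alpha>) v) = 0" if "v \<in> u" for v
    using \<kappa>_invariant[of H "K \<alpha>" v] T_abelian[OF assms(1) KT] T_u[OF assms(1)] T_u[OF KT] that
    by (simp add: \<kappa>_zero)
  show "\<kappa> H (yy \<alpha>) = 0"
    using 0[OF xx_u[OF assms(2)]] br_T[OF KT assms(2)] r T_u[OF assms(1)] yy_u[OF assms(2)]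
    by (simp add: \<kappa>_scale_right)
  show "\<kappa> H (xx \<alpha>) = 0"
    using 0[OF yy_u[OF assms(2)]] br_T[OF KT assms(2)] r T_u[OF assms(1)] xx_u[OF assms(2)]
    by (simp add: \<kappa>_scale_right \<kappa>_minus subspace_scale[OF subspace_u])
qed

lemma orthogonal_xx_yy:
  assumes "\<alpha> \<in> \<Delta>" shows "\<kappa> (xx \<alpha>) (yy \<alpha>) = 0"
proof -
  have KT: "K \<alpha> \<in> T" using assms by (auto simp: T_span span_base)
  have r: "rt \<alpha> (K \<alpha>) \<noteq> 0"
    using \<kappa>_neg[OF K_u[OF assms] K_nonzero[OF assms]] by (simp add: rt_def)
  have "\<kappa> (xx \<alpha>) (br (K \<alpha>) (xx \<alpha>)) = \<kappa> (br (xx \<alpha>) (K \<alpha>)) (xx \<alpha>)"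
    using \<kappa>_invariant[of "xx \<alpha>" "K \<alpha>" "xx \<alpha>"] xx_u[OF assms] K_u[OF assms] by simp
  also have "\<dots> = - \<kappa> (xx \<alpha>) (br (K \<alpha>) (xx \<alpha>))"
    using xx_u[OF assms] K_u[OF assms] u_closed
    by (subst br_skew) (simp add: \<kappa>_minus \<kappa>_commute[of _ "xx \<alpha>"])
  finally have "\<kappa> (xx \<alpha>) (br (K \<alpha>) (xx \<alpha>)) = 0" by simp
  then show ?thesis
    using br_T[OF KT assms] r xx_u[OF assms] yy_u[OF assms] by (simp add: \<kappa>_scale_right)
qed

text \<open>Invariance of the Killing form under the rotations by \<open>T\<close> gives linear relations between the four
  pairings of the two root planes; they have only the zero solution when some element of \<open>T\<close> has
  \<open>rt \<alpha> \<noteq> rt \<beta>\<close> and some element has \<open>rt \<alpha> \<noteq> - rt \<beta>\<close>.\<close>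

lemma orthogonal_roots:
  assumes "\<alpha> \<in> P" "\<beta> \<in> P" "\<alpha> \<noteq> \<beta>"
  shows "\<kappa> (xx \<alpha>) (xx \<beta>) = 0" "\<kappa> (yy \<alpha>) (yy \<beta>) = 0" "\<kappa> (xx \<alpha>) (yy \<beta>) = 0"
proof -
  have \<Delta>: "\<alpha> \<in> \<Delta>" "\<beta> \<in> \<Delta>" using assms P_sub by auto
  note in_u = xx_u[OF \<Delta>(1)] xx_u[OF \<Delta>(2)] yy_u[OF \<Delta>(1)] yy_u[OF \<Delta>(2)]
  have skew: "\<kappa> (br H v) w = - \<kappa> v (br H w)" if "H \<in> T" "v \<in> u" "w \<in> u" for H v w
  proof -
    have "\<kappa> (br H v) w = \<kappa> (- br v H) w" by (subst br_skew) simp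
    also have "\<dots> = - \<kappa> v (br H w)"
      using that T_u u_closed by (simp add: \<kappa>_minus \<kappa>_invariant)
    finally show ?thesis .
  qed
  have rel: "rt \<alpha> H * \<kappa> (yy \<alpha>) (yy \<beta>) = rt \<beta> H * \<kappa> (xx \<alpha>) (xx \<beta>)"
    "rt \<alpha> H * \<kappa> (xx \<alpha>) (xx \<beta>) = rt \<beta> H * \<kappa> (yy \<alpha>) (yy \<beta>)"
    "rt \<alpha> H * \<kappa> (yy \<alpha>) (xx \<beta>) = - rt \<beta> H * \<kappa> (xx \<alpha>) (yy \<beta>)"
    "rt \<alpha> H * \<kappa> (xx \<alpha>) (yy \<beta>) = - rt \<beta> H * \<kappa> (yy \<alpha>) (xx \<beta>)" if "H \<in> T" for H
    using skew[OF that in_u(1) in_u(4)] skew[OF that in_u(3) in_u(2)]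
      skew[OF that in_u(1) in_u(2)] skew[OF that in_u(3) in_u(4)]
      br_T[OF that \<Delta>(1)] br_T[OF that \<Delta>(2)] in_u
    by (simp_all add: \<kappa>_scale \<kappa>_scale_right \<kappa>_minus subspace_scale[OF subspace_u])
  obtain H1 H2 where H: "H1 \<in> T" "rt \<alpha> H1 \<noteq> rt \<beta> H1" "H2 \<in> T" "rt \<alpha> H2 \<noteq> - rt \<beta> H2"
    using rt_separates[OF assms, of 1] rt_separates[OF assms, of "-1"] by auto
  have "(rt \<alpha> H1 - rt \<beta> H1) * (\<kappa> (xx \<alpha>) (xx \<beta>) + \<kappa> (yy \<alpha>) (yy \<beta>)) = 0"
    using rel[OF H(1)] by (simp add: algebra_simps)
  moreover have "(rt \<alpha> H2 + rt \<beta> H2) * (\<kappa> (xx \<alpha>) (xx \<beta>) - \<kappa> (yy \<alpha>) (yy \<beta>)) = 0"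
    using rel[OF H(3)] by (simp add: algebra_simps)
  moreover have "(rt \<alpha> H1 - rt \<beta> H1) * (\<kappa> (yy \<alpha>) (xx \<beta>) - \<kappa> (xx \<alpha>) (yy \<beta>)) = 0"
    using rel[OF H(1)] by (simp add: algebra_simps)
  moreover have "(rt \<alpha> H2 + rt \<beta> H2) * (\<kappa> (yy \<alpha>) (xx \<beta>) + \<kappa> (xx \<alpha>) (yy \<beta>)) = 0"
    using rel[OF H(3)] by (simp add: algebra_simps)
  moreover have "rt \<alpha> H1 - rt \<beta> H1 \<noteq> 0" "rt \<alpha> H2 + rt \<beta> H2 \<noteq> 0" using H by (auto simp: add_eq_0_iff)
  ultimately have "\<kappa> (xx \<alpha>) (xx \<beta>) + \<kappa> (yy \<alpha>) (yy \<beta>) = 0" "\<kappa> (xx \<alpha>) (xx \<beta>) - \<kappa> (yy \<alpha>) (yy \<beta>) = 0"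
    "\<kappa> (yy \<alpha>) (xx \<beta>) - \<kappa> (xx \<alpha>) (yy \<beta>) = 0" "\<kappa> (yy \<alpha>) (xx \<beta>) + \<kappa> (xx \<alpha>) (yy \<beta>) = 0"
    by simp_all
  then show "\<kappa> (xx \<alpha>) (xx \<beta>) = 0" "\<kappa> (yy \<alpha>) (yy \<beta>) = 0" "\<kappa> (xx \<alpha>) (yy \<beta>) = 0"
    by linarith+
qed

definition M where "M = xx ` P \<union> yy ` P"

lemma M_u: "M \<subseteq> u" and M_nonzero: "0 \<notin> M"
proof -
  have "e \<in> u \<and> e \<noteq> 0" if "e \<in> M" for e
  proof -
    obtain \<alpha> where "\<alpha> \<in> P" "e = xx \<alpha> \<or> e = yy \<alpha>" using \<open>e \<in> M\<close> unfolding M_def by blast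
    then show ?thesis using xx_u yy_u xx_yy_nonzero P_sub by metis
  qed
  then show "M \<subseteq> u" "0 \<notin> M" by auto
qed

lemma orthogonal_xx_yy_roots: "\<alpha> \<in> P \<Longrightarrow> \<beta> \<in> P \<Longrightarrow> \<kappa> (xx \<alpha>) (yy \<beta>) = 0"
  using orthogonal_roots(3)[of \<alpha> \<beta>] orthogonal_xx_yy[of \<alpha>] P_sub by (cases "\<alpha> = \<beta>") auto

lemma xx_neq_yy: assumes "\<alpha> \<in> P" "\<beta> \<in> P" shows "xx \<alpha> \<noteq> yy \<beta>"
  using orthogonal_xx_yy_roots[OF assms] \<kappa>_neg[OF xx_u xx_yy_nonzero(1)] P_sub[OF assms(1)] by force

lemma M_orthogonal: assumes "e \<in> M" "f \<in> M" "e \<noteq> f" shows "\<kappa> e f = 0"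
proof -
  have "\<kappa> (yy \<alpha>) (xx \<beta>) = 0" if "\<alpha> \<in> P" "\<beta> \<in> P" for \<alpha> \<beta>
    using orthogonal_xx_yy_roots[OF that(2,1)]
      \<kappa>_commute[OF yy_u xx_u, OF P_sub[OF that(1)] P_sub[OF that(2)]] by simp
  moreover have "\<kappa> (xx \<alpha>) (xx \<beta>) = 0" if "\<alpha> \<in> P" "\<beta> \<in> P" "xx \<alpha> \<noteq> xx \<beta>" for \<alpha> \<beta>
    by (rule orthogonal_roots(1)[OF that(1,2)]) (use that(3) in auto)
  moreover have "\<kappa> (yy \<alpha>) (yy \<beta>) = 0" if "\<alpha> \<in> P" "\<beta> \<in> P" "yy \<alpha> \<noteq> yy \<beta>" for \<alpha> \<beta>
    by (rule orthogonal_roots(2)[OF that(1,2)]) (use that(3) in auto)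
  ultimately show ?thesis using assms orthogonal_xx_yy_roots unfolding M_def by blast
qed

lemma M_independent: "independent M"
  using M_u M_nonzero M_orthogonal by (rule orthogonal_independent)

lemma M_finite: "finite M"
  using M_independent by (rule independent_finite)

lemma T_Int_span_M: "T \<inter> span M = {0}"
proof -
  have "v = 0" if v: "v \<in> T" "v \<in> span M" for v
  proof -
    have "\<kappa> v w = 0" if "w \<in> span M" for w
    proof -
      have "w \<in> u \<and> \<kappa> v w = 0"
        using that
      proof (induction rule: span_induct_alt)
        case base show ?case using T_u[OF v(1)] subspace_u by (simp add: \<kappa>_zero subspace_0)
      next
        case (step c e w)
        then have "e \<in> u" "\<kappa> v e = 0" using M_u orthogonal_T[OF v(1)] P_sub by (auto simp: M_def)
        then show ?case using step T_u[OF v(1)] subspace_u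
          by (simp add: \<kappa>_add_right \<kappa>_scale_right subspace_scale subspace_add)
      qed
      then show ?thesis by simp
    qed
    then have "\<kappa> v v = 0" using v by simp
    then show ?thesis using \<kappa>_neg[OF T_u[OF v(1)]] by force
  qed
  then show ?thesis by (auto simp: T_span span_zero)
qed

lemma u_span_T_M: "u = span (T \<union> M)"
proof
  show "span (T \<union> M) \<subseteq> u" using T_u M_u by (intro span_minimal subspace_u) auto
  have "xx \<alpha> \<in> span (T \<union> M)" "yy \<alpha> \<in> span (T \<union> M)" if "\<alpha> \<in> \<Delta>" for \<alpha>
  proof -
    have P: "xx \<alpha> \<in> span (T \<union> M)" "yy \<alpha> \<in> span (T \<union> M)" if "\<alpha> \<in> P" for \<alpha>
      using that by (auto simp: M_def intro!: span_base)
    show "xx \<alpha> \<in> span (T \<union> M)" "yy \<alpha> \<in> span (T \<union> M)"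
      using negative_root_vectors[OF that] P[of \<alpha>] P[of "- \<alpha>"]
      by (cases "\<alpha> \<in> P"; simp add: span_neg)+
  qed
  moreover have "K \<alpha> \<in> span (T \<union> M)" if "\<alpha> \<in> \<Delta>" for \<alpha>
    using that by (auto simp: T_span intro!: span_base)
  ultimately show "u \<subseteq> span (T \<union> M)"
    by (subst u_span) (intro span_minimal, auto)
qed

end

section \<open>Degeneration by weights\<close>

lemma ricci_form_reindex:
  assumes "inj_on g I"
  shows "ricci_form (g ` I) C x = ricci_form I (\<lambda>i j k. C (g i) (g j) (g k)) (\<lambda>i. x (g i))"
  unfolding ricci_form_def using assms by (simp add: sum.reindex)

lemma power_quotient_limit:
  assumes "k \<le> m"
  shows "((\<lambda>t::real. t ^ k / t ^ m) \<longlongrightarrow> (if k = m then 1 else 0)) at_top"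
proof (cases "k = m")
  case True
  have "\<forall>\<^sub>F t::real in at_top. t ^ k / t ^ m = 1"
    using eventually_gt_at_top[of 0] by eventually_elim (simp add: True)
  then show ?thesis using True by (simp add: tendsto_eventually)
next
  case False
  then have m: "m = k + Suc (m - k - 1)" using assms by simp
  have "((\<lambda>t::real. inverse t ^ Suc (m - k - 1)) \<longlongrightarrow> 0 ^ Suc (m - k - 1)) at_top"
    by (intro tendsto_power tendsto_inverse_0_at_top filterlim_ident)
  moreover have "\<forall>\<^sub>F t::real in at_top. inverse t ^ Suc (m - k - 1) = t ^ k / t ^ m"
    using eventually_gt_at_top[of 0]
  proof eventually_elim
    case (elim t)
    have "t ^ m = t ^ k * t ^ Suc (m - k - 1)" by (subst m) (rule power_add)
    then show ?case using elim by (simp add: field_simps)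
  qed
  ultimately show ?thesis using False by (simp add: tendsto_cong)
qed

context lie_algebra
begin

lemma scaled_basis_frame:
  assumes B: "finite B" "independent B" "span B = UNIV" and pos: "\<And>b. b \<in> B \<Longrightarrow> 0 < l b"
  defines "ip \<equiv> \<lambda>x y. \<Sum>b\<in>B. representation B x b * representation B y b / (l b)\<^sup>2"
  shows "metric_algebra ip ((\<lambda>b. l b *\<^sub>R b) ` B) br"
    and "inj_on (\<lambda>b. l b *\<^sub>R b) B"
    and "b \<in> B \<Longrightarrow> ip x (l b *\<^sub>R b) = representation B x b / l b"
proof -
  note rep = real_vector.representation_add[OF B(2)] real_vector.representation_scale[OF B(2)]
  have rep_base: "representation B (r *\<^sub>R a) b = (if b = a then r else 0)" if "a \<in> B" for a b r
    using that by (simp add: rep B(3) real_vector.representation_basis[OF B(2)])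
  show ip_base: "ip x (l b *\<^sub>R b) = representation B x b / l b" if "b \<in> B" for x b
  proof -
    have "ip x (l b *\<^sub>R b) = (\<Sum>a\<in>B. if a = b then representation B x b / l b else 0)"
      unfolding ip_def using that pos[OF that]
      by (intro sum.cong refl) (auto simp: rep_base power2_eq_square)
    then show ?thesis using B that by simp
  qed
  have ip_pos: "0 < ip x x" if nonzero: "x \<noteq> 0" for x
  proof -
    have x: "(\<Sum>b\<in>B. representation B x b *\<^sub>R b) = x"
      using real_vector.sum_representation_eq[OF B(2) _ B(1) subset_refl, of x] B(3) by simp
    have "\<exists>b\<in>B. representation B x b \<noteq> 0"
    proof (rule ccontr)
      assume "\<not> (\<exists>b\<in>B. representation B x b \<noteq> 0)"
      then have "(\<Sum>b\<in>B. representation B x b *\<^sub>R b) = 0" by (intro sum.neutral) auto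
      then show False using x nonzero by simp
    qed
    then obtain b where b: "b \<in> B" "representation B x b \<noteq> 0" by blast
    show ?thesis
      unfolding ip_def
    proof (rule sum_pos2[OF B(1) b(1)])
      show "0 < representation B x b * representation B x b / (l b)\<^sup>2"
        using b pos[OF b(1)] by (auto simp: zero_less_mult_iff intro!: divide_pos_pos)
    qed simp
  qed
  have inner: "inner_product_on UNIV ip"
    unfolding inner_product_on_def
  proof (intro conjI ballI allI impI)
    show "ip (x + y) z = ip x z + ip y z" for x y z
      by (simp add: ip_def rep B(3) distrib_right add_divide_distrib sum.distrib)
    show "ip (a *\<^sub>R x) y = a * ip x y" for a x y
      by (simp add: ip_def rep B(3) sum_distrib_left mult.assoc)
    show "ip x y = ip y x" for x y by (simp add: ip_def mult.commute)
  qed (rule ip_pos)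
  have eq_iff: "l a *\<^sub>R a = l b *\<^sub>R b \<longleftrightarrow> a = b" if "a \<in> B" "b \<in> B" for a b
  proof
    assume "l a *\<^sub>R a = l b *\<^sub>R b"
    then have "representation B (l a *\<^sub>R a) a = representation B (l b *\<^sub>R b) a" by simp
    then show "a = b" using that pos[of a] by (auto simp: rep_base split: if_splits)
  qed simp
  then show inj: "inj_on (\<lambda>b. l b *\<^sub>R b) B" by (auto intro: inj_onI)
  have "B \<subseteq> span ((\<lambda>b. l b *\<^sub>R b) ` B)"
  proof
    fix b assume b: "b \<in> B"
    then have "(1 / l b) *\<^sub>R (l b *\<^sub>R b) \<in> span ((\<lambda>b. l b *\<^sub>R b) ` B)"
      by (intro span_scale span_base) auto
    then show "b \<in> span ((\<lambda>b. l b *\<^sub>R b) ` B)" using pos[OF b] by simp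
  qed
  then have spn: "span ((\<lambda>b. l b *\<^sub>R b) ` B) = UNIV"
    using B(3) by (metis span_minimal subspace_span top.extremum_uniqueI)
  show "metric_algebra ip ((\<lambda>b. l b *\<^sub>R b) ` B) br"
  proof
    show "ip a b = (if a = b then 1 else 0)"
      if ab: "a \<in> (\<lambda>b. l b *\<^sub>R b) ` B" "b \<in> (\<lambda>b. l b *\<^sub>R b) ` B" for a b
    proof -
      obtain a' b' where "a = l a' *\<^sub>R a'" "b = l b' *\<^sub>R b'" "a' \<in> B" "b' \<in> B" using ab by blast
      then show ?thesis using pos[of b'] by (auto simp: ip_base rep_base eq_iff)
    qed
  qed (use inner B spn in auto)
qed

text \<open>Declare the vectors \<open>s b t\<^bsup>- w b\<^esup> b\<close> to be orthonormal.  This multiplies the structure constant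
  \<open>c a b k\<close> by \<open>s a s b / s k\<close> and by \<open>t\<close> to the power \<open>w k - w a - w b\<close>, which is never positive.  As
  \<open>t\<close> grows, only the structure constants that respect the weights remain, and negative definiteness
  of the limit form passes to large \<open>t\<close>.\<close>

lemma negative_ricci_by_degeneration:
  fixes w :: "'g \<Rightarrow> nat" and s :: "'g \<Rightarrow> real" and D :: "'g \<Rightarrow> 'g \<Rightarrow> 'g \<Rightarrow> real"
  assumes B: "finite B" "independent B" "span B = UNIV" and s: "\<And>b. b \<in> B \<Longrightarrow> 0 < s b"
    and weights: "\<And>a b k. a \<in> B \<Longrightarrow> b \<in> B \<Longrightarrow> k \<in> B \<Longrightarrow> representation B (br a b) k \<noteq> 0 \<Longrightarrow> w k \<le> w a + w b"
    and D: "\<And>a b k. a \<in> B \<Longrightarrow> b \<in> B \<Longrightarrow> k \<in> B \<Longrightarrow>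
      D a b k = (if w k = w a + w b then s a * s b / s k * representation B (br a b) k else 0)"
    and neg: "\<And>x. \<exists>i\<in>B. x i \<noteq> 0 \<Longrightarrow> ricci_form B D x < 0"
  shows "\<exists>ip. inner_product_on UNIV ip \<and> negative_ricci br ip"
proof -
  define l where "l t b = s b / t ^ w b" for t b
  define C where "C t a b k = l t a * l t b / l t k * representation B (br a b) k" for t a b k
  have "((\<lambda>t. C t a b k) \<longlongrightarrow> D a b k) at_top" if abk: "a \<in> B" "b \<in> B" "k \<in> B" for a b k
  proof (cases "representation B (br a b) k = 0")
    case True then show ?thesis using D[OF abk] by (simp add: C_def)
  next
    case False
    note le = weights[OF abk False]
    have "\<forall>\<^sub>F t in at_top. s a * s b / s k * representation B (br a b) k * (t ^ w k / t ^ (w a + w b)) = C t a b k"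
      using eventually_gt_at_top[of 0]
      by eventually_elim (simp add: C_def l_def power_add field_simps)
    moreover have "((\<lambda>t. s a * s b / s k * representation B (br a b) k * (t ^ w k / t ^ (w a + w b)))
        \<longlongrightarrow> s a * s b / s k * representation B (br a b) k * (if w k = w a + w b then 1 else 0)) at_top"
      by (intro tendsto_mult tendsto_const power_quotient_limit le)
    ultimately show ?thesis
      using D[OF abk] by (auto elim: Lim_transform_eventually[rotated])
  qed
  from ricci_form_negative_open[OF B(1) this neg]
  have "\<forall>\<^sub>F t in at_top. \<forall>x. (\<exists>i\<in>B. x i \<noteq> 0) \<longrightarrow> ricci_form B (C t) x < 0" by blast
  then have "\<forall>\<^sub>F t in at_top. 0 < t \<and> (\<forall>x. (\<exists>i\<in>B. x i \<noteq> 0) \<longrightarrow> ricci_form B (C t) x < 0)"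
    using eventually_gt_at_top[of 0] by eventually_elim auto
  then obtain t where t: "0 < t" "\<And>x. \<exists>i\<in>B. x i \<noteq> 0 \<Longrightarrow> ricci_form B (C t) x < 0"
    using eventually_happens'[OF trivial_limit_at_top_linorder] by blast
  have l_pos: "0 < l t b" if "b \<in> B" for b using t s that by (simp add: l_def)
  define ip where "ip x y = (\<Sum>b\<in>B. representation B x b * representation B y b / (l t b)\<^sup>2)" for x y
  define g where "g b = l t b *\<^sub>R b" for b
  note frame = scaled_basis_frame[OF B l_pos, folded ip_def g_def]
  have ip_g: "ip x (g b) = representation B x b / l t b" if "b \<in> B" for x b
    using scaled_basis_frame(3)[OF B l_pos that] by (simp add: ip_def[abs_def] g_def)
  interpret metric_algebra ip "g ` B" br
    using frame(1) by (simp add: ip_def[abs_def] g_def[abs_def])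
  have inj: "inj_on g B" using frame(2) by (simp add: g_def[abs_def])
  have "ricci_tensor br ip x x < 0" if x: "x \<noteq> 0" for x
  proof -
    have "ricci_tensor br ip x x = ricci_form B (\<lambda>a b k. ip (br (g a) (g b)) (g k)) (\<lambda>b. ip x (g b))"
      unfolding ricci_tensor_form by (rule ricci_form_reindex[OF inj])
    also have "\<dots> = ricci_form B (C t) (\<lambda>b. ip x (g b))"
    proof (rule ricci_form_cong)
      fix a b k assume "a \<in> B" "b \<in> B" "k \<in> B"
      then show "ip (br (g a) (g b)) (g k) = C t a b k"
        by (simp add: ip_g C_def) (simp add: g_def br_simps
          real_vector.representation_scale[OF B(2)] B(3))
    qed simp
    also have "\<dots> < 0"
    proof (rule t(2), rule ccontr)
      assume "\<not> (\<exists>i\<in>B. ip x (g i) \<noteq> 0)"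
      then have "(\<Sum>a\<in>g ` B. ip x a *\<^sub>R a) = 0" by (intro sum.neutral) auto
      then have "x = 0" unfolding frame_expansion .
      then show False using x by simp
    qed
    finally show ?thesis .
  qed
  then have "negative_ricci br ip" by (simp add: negative_ricci_iff)
  then show ?thesis using inner by blast
qed

end

section \<open>Independent and orthonormal sets\<close>

lemma independent_Un_disjoint_span:
  fixes A B :: "'v::real_vector set"
  assumes "finite A" "finite B" "independent A" "independent B" "span A \<inter> span B \<subseteq> {0}"
  shows "independent (A \<union> B)" "A \<inter> B = {}"
proof -
  show disj: "A \<inter> B = {}"
  proof (rule ccontr)
    assume "A \<inter> B \<noteq> {}"
    then obtain x where "x \<in> A" "x \<in> B" by blast
    then have "x = 0" using assms(5) span_base by blast
    then show False using \<open>x \<in> A\<close> assms(3) dependent_zero by blast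
  qed
  show "independent (A \<union> B)"
  proof (rule independent_if_scalars_zero)
    fix f x assume "(\<Sum>x\<in>A \<union> B. f x *\<^sub>R x) = 0" and x: "x \<in> A \<union> B"
    then have eq: "(\<Sum>x\<in>A. f x *\<^sub>R x) = - (\<Sum>x\<in>B. f x *\<^sub>R x)"
      using assms(1,2) disj by (simp add: sum.union_disjoint add_eq_0_iff2)
    have A: "(\<Sum>x\<in>A. f x *\<^sub>R x) \<in> span A" by (intro span_sum span_scale span_base)
    have B: "(\<Sum>x\<in>B. f x *\<^sub>R x) \<in> span B" by (intro span_sum span_scale span_base)
    have "(\<Sum>x\<in>A. f x *\<^sub>R x) \<in> span B" unfolding eq using B by (rule span_neg)
    with A have "(\<Sum>x\<in>A. f x *\<^sub>R x) = 0" using assms(5) by blast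
    moreover from this have "(\<Sum>x\<in>B. f x *\<^sub>R x) = 0" using eq by simp
    ultimately show "f x = 0"
      using x real_vector.representation_sum_scale[OF assms(1,3), of x f]
        real_vector.representation_sum_scale[OF assms(2,4), of x f]
      by (auto simp: real_vector.representation_zero)
  qed (use assms in auto)
qed

lemma span_Un_cong:
  fixes A :: "'v::real_vector set"
  assumes "span A = span A'" "span B = span B'" shows "span (A \<union> B) = span (A' \<union> B')"
  unfolding span_Un assms ..

lemma small_square:
  fixes g :: "'a \<Rightarrow> real"
  assumes "finite S" "\<forall>x\<in>S. 0 < g x" "0 \<le> K" "0 < b"
  shows "\<exists>\<delta>>0. \<delta> \<le> b \<and> (\<forall>x\<in>S. K * \<delta>\<^sup>2 < g x)"
proof -
  define m where "m = Min (insert 1 (g ` S))"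
  have m: "0 < m" "\<And>x. x \<in> S \<Longrightarrow> m \<le> g x" using assms by (auto simp: m_def)
  define \<delta> where "\<delta> = min (min b 1) (m / (K + 1))"
  have \<delta>: "0 < \<delta>" "\<delta> \<le> b" "\<delta> \<le> 1" "\<delta> \<le> m / (K + 1)" using assms m by (auto simp: \<delta>_def)
  have "\<delta>\<^sup>2 \<le> \<delta>" using \<delta> by (simp add: power2_eq_square mult_left_le)
  then have "K * \<delta>\<^sup>2 \<le> K * (m / (K + 1))" using \<delta> assms(3) by (intro mult_left_mono) auto
  also have "\<dots> < m" using m assms(3) by (simp add: field_simps)
  finally have "K * \<delta>\<^sup>2 < m" .
  then show ?thesis using \<delta> m(2) by (intro exI[of _ \<delta>]) (auto intro: less_le_trans)
qed

lemma inner_product_onD: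
  assumes "inner_product_on V ip" "x \<in> V" "y \<in> V"
  shows "z \<in> V \<Longrightarrow> ip (x + y) z = ip x z + ip y z" "ip (a *\<^sub>R x) y = a * ip x y"
    "ip x y = ip y x" "x \<noteq> 0 \<Longrightarrow> 0 < ip x x"
  using assms by (simp_all add: inner_product_on_def)

lemma inner_product_on_sum:
  assumes ip: "inner_product_on V ip" and V: "subspace V" and G: "finite G" "\<And>b. b \<in> G \<Longrightarrow> f b \<in> V" "y \<in> V"
  shows "ip (\<Sum>b\<in>G. f b) y = (\<Sum>b\<in>G. ip (f b) y)"
  using G
proof (induction G)
  case empty
  show ?case using inner_product_onD(2)[OF ip subspace_0[OF V] G(3), of 0] by simp
next
  case (insert x G)
  then have "(\<Sum>b\<in>G. f b) \<in> V" by (intro subspace_sum[OF V]) auto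
  then show ?case using insert inner_product_onD(1)[OF ip, of "f x" "\<Sum>b\<in>G. f b" y] by simp
qed

lemma orthonormal_expansion:
  assumes ip: "inner_product_on V ip" and V: "subspace V" and B: "finite B" "B \<subseteq> V"
    and on: "\<And>a b. a \<in> B \<Longrightarrow> b \<in> B \<Longrightarrow> ip a b = (if a = b then 1 else 0)" and a: "a \<in> B"
  shows "ip (\<Sum>b\<in>B. r b *\<^sub>R b) a = r a"
proof -
  have "ip (\<Sum>b\<in>B. r b *\<^sub>R b) a = (\<Sum>b\<in>B. ip (r b *\<^sub>R b) a)"
    using B a by (intro inner_product_on_sum[OF ip V]) (auto intro: subspace_scale[OF V])
  also have "\<dots> = (\<Sum>b\<in>B. if b = a then r a else 0)"
  proof (intro sum.cong refl)
    fix b assume b: "b \<in> B"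
    then have "b \<in> V" "a \<in> V" using B a by auto
    then show "ip (r b *\<^sub>R b) a = (if b = a then r a else 0)"
      using inner_product_onD(2)[OF ip, of b a "r b"] on[OF b a] by simp
  qed
  finally show ?thesis using B a by simp
qed

lemma orthonormal_independent:
  assumes ip: "inner_product_on V ip" and V: "subspace V" and B: "finite B" "B \<subseteq> V"
    and on: "\<And>a b. a \<in> B \<Longrightarrow> b \<in> B \<Longrightarrow> ip a b = (if a = b then 1 else 0)"
  shows "independent B"
proof (rule independent_if_scalars_zero[OF B(1)])
  fix f x assume "(\<Sum>x\<in>B. f x *\<^sub>R x) = 0" "x \<in> B"
  then show "f x = 0"
    using orthonormal_expansion[OF assms \<open>x \<in> B\<close>, of f] orthonormal_expansion[OF assms \<open>x \<in> B\<close>, of "\<lambda>_. 0"]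
    by simp
qed

lemma orthonormal_representation:
  assumes ip: "inner_product_on V ip" and V: "subspace V" and B: "finite B" "B \<subseteq> V"
    and on: "\<And>a b. a \<in> B \<Longrightarrow> b \<in> B \<Longrightarrow> ip a b = (if a = b then 1 else 0)"
    and x: "x \<in> span B" "b \<in> B"
  shows "representation B x b = ip x b"
proof -
  have ind: "independent B" by (rule orthonormal_independent[OF ip V B on])
  have "(\<Sum>b\<in>B. representation B x b *\<^sub>R b) = x"
    using real_vector.sum_representation_eq[OF ind x(1) B(1) subset_refl] .
  then show ?thesis using orthonormal_expansion[OF ip V B on x(2), of "representation B x"] by simp
qed

text \<open>Gram-Schmidt, for inner products that are only defined on a subspace.\<close>

lemma orthonormal_basis_exists:
  fixes V :: "'v::real_vector set"
  assumes ip: "inner_product_on V ip" and V: "subspace V" and F: "finite F" "F \<subseteq> V"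
  shows "\<exists>B. finite B \<and> B \<subseteq> V \<and> span B = span F \<and>
    (\<forall>a\<in>B. \<forall>b\<in>B. ip a b = (if a = b then 1 else 0))"
  using F
proof (induction F)
  case empty then show ?case by (intro exI[of _ "{}"]) simp
next
  case (insert x F)
  then obtain B where B: "finite B" "B \<subseteq> V" "span B = span F"
    and on: "\<And>a b. a \<in> B \<Longrightarrow> b \<in> B \<Longrightarrow> ip a b = (if a = b then 1 else 0)" by auto
  define p where "p = (\<Sum>b\<in>B. ip x b *\<^sub>R b)"
  define v where "v = x - p"
  have pB: "p \<in> span B" unfolding p_def by (intro span_sum span_scale span_base)
  have spanBV: "span B \<subseteq> V" using B(2) V by (rule span_minimal)
  have vV: "v \<in> V" using insert.prems pB spanBV V by (auto simp: v_def intro: subspace_diff)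
  have spn: "span (insert x B) = span (insert v B)"
    using eq_span_insert_eq[of x v B] pB by (simp add: v_def)
  show ?case
  proof (cases "v = 0")
    case True
    then have "x \<in> span F" using pB B by (simp add: v_def)
    then show ?thesis using B on by (intro exI[of _ B]) (auto simp: span_redundant)
  next
    case False
    define e where "e = (1 / sqrt (ip v v)) *\<^sub>R v"
    have v_pos: "0 < ip v v" using inner_product_onD(4)[OF ip vV vV False] .
    have eV: "e \<in> V" using vV V by (simp add: e_def subspace_scale)
    have add: "ip (a + b) c = ip a c + ip b c" if "a \<in> V" "b \<in> V" "c \<in> V" for a b c
      by (rule inner_product_onD(1)[OF ip that])
    have scale: "ip (r *\<^sub>R a) c = r * ip a c" if "a \<in> V" "c \<in> V" for r a c
      by (rule inner_product_onD(2)[OF ip that])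
    have comm: "ip a c = ip c a" if "a \<in> V" "c \<in> V" for a c
      by (rule inner_product_onD(3)[OF ip that])
    have vb: "ip v b = 0" if b: "b \<in> B" for b
    proof -
      have bV: "b \<in> V" and pV: "p \<in> V" and xV: "x \<in> V" using b B pB spanBV insert.prems by auto
      have "ip x b = ip (v + p) b" by (simp add: v_def)
      also have "\<dots> = ip v b + ip p b" by (rule add[OF vV pV bV])
      also have "ip p b = ip x b" unfolding p_def by (rule orthonormal_expansion[OF ip V B(1,2) on b])
      finally show ?thesis by simp
    qed
    have ee: "ip e e = 1"
    proof -
      have "ip ((1 / sqrt (ip v v)) *\<^sub>R v) e = (1 / sqrt (ip v v)) * ip v e" by (rule scale[OF vV eV])
      then have "ip e e = (1 / sqrt (ip v v)) * ip v e" by (simp only: e_def[symmetric])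
      also have "ip v e = ip e v" by (rule comm[OF vV eV])
      also have "\<dots> = (1 / sqrt (ip v v)) * ip v v" unfolding e_def by (rule scale[OF vV vV])
      finally show ?thesis using v_pos by simp
    qed
    have eb: "ip e b = 0" "ip b e = 0" if "b \<in> B" for b
    proof -
      have bV: "b \<in> V" using that B by auto
      show "ip e b = 0" unfolding e_def using scale[OF vV bV] vb[OF that] by simp
      then show "ip b e = 0" using comm[OF bV eV] by simp
    qed
    have "span (insert e B) = span (insert v B)"
    proof
      show "span (insert e B) \<subseteq> span (insert v B)"
        unfolding e_def by (intro span_minimal) (auto intro: span_base span_scale)
      have "sqrt (ip v v) *\<^sub>R e \<in> span (insert e B)" by (intro span_scale span_base) simp
      then have "v \<in> span (insert e B)" using v_pos by (simp add: e_def)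
      then show "span (insert v B) \<subseteq> span (insert e B)"
        by (intro span_minimal) (auto intro: span_base)
    qed
    also have "\<dots> = span (insert x F)"
      unfolding spn[symmetric] using span_Un_cong[of "{x}" "{x}" B F] B(3) by simp
    finally have "span (insert e B) = span (insert x F)" .
    moreover have "e \<notin> B" using eb(1)[of e] ee by auto
    ultimately show ?thesis
      using B eV on ee eb by (intro exI[of _ "insert e B"]) auto
  qed
qed

section \<open>The metrics adapted to a decomposition\<close>

context lie_algebra
begin

lemma trace_on_commutator:
  assumes V: "subspace V" and \<phi>: "linear \<phi>" "\<phi> ` V \<subseteq> V"
    and xy: "br x ` V \<subseteq> V" "br y ` V \<subseteq> V" and comm: "\<And>v. \<phi> (br x v) = br x (\<phi> v)"
  shows "trace_on scaleR V (\<lambda>v. \<phi> (br (br x y) v)) = 0"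
proof -
  interpret finite_subspace V by (rule finite_subspaceI[OF V])
  have lin: "linear (\<lambda>v. \<phi> (br y v))" "linear (\<lambda>v. \<phi> (br x (br y v)))" "linear (\<lambda>v. \<phi> (br y (br x v)))" for x y
    using linear_compose[OF br_linear(1) \<phi>(1)] linear_compose[OF linear_br_br \<phi>(1)]
    by (auto simp: o_def)
  have into: "\<phi> v \<in> V" "br x v \<in> V" "br y v \<in> V" if "v \<in> V" for v using that \<phi>(2) xy by auto
  have "\<phi> (br (br x y) v) = \<phi> (br x (br y v)) - \<phi> (br y (br x v))" for v
    by (simp add: jacobi[of x y] linear_add[OF \<phi>(1)])
  then have "trace_on scaleR V (\<lambda>v. \<phi> (br (br x y) v))
      = trace_on scaleR V (\<lambda>v. \<phi> (br x (br y v))) - trace_on scaleR V (\<lambda>v. \<phi> (br y (br x v)))"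
    using into by (simp only:) (intro trace_on_diff lin, auto)
  also have "trace_on scaleR V (\<lambda>v. \<phi> (br x (br y v))) = trace_on scaleR V (\<lambda>v. br x (\<phi> (br y v)))"
    by (simp add: comm)
  also have "\<dots> = trace_on scaleR V (\<lambda>v. \<phi> (br y (br x v)))"
    using into by (intro trace_on_commute[where f = "br x" and g = "\<lambda>v. \<phi> (br y v)"] br_linear lin) auto
  finally show ?thesis by simp
qed

end

context compact_roots
begin

text \<open>The torus is spanned by the \<open>K \<alpha> = [xx \<alpha>, yy \<alpha>] / 2\<close>, so it acts by sums of commutators.  Composition
  with \<open>\<phi>\<close> will be used for \<open>ad Z\<close>, to make the actions of \<open>Z\<close> and of the torus orthogonal.\<close>

lemma trace_on_T:
  assumes V: "subspace V" and \<phi>: "linear \<phi>" "\<phi> ` V \<subseteq> V"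
    and u: "\<And>x. x \<in> u \<Longrightarrow> br x ` V \<subseteq> V" and comm: "\<And>x v. x \<in> u \<Longrightarrow> \<phi> (br x v) = br x (\<phi> v)"
    and H: "H \<in> T"
  shows "trace_on scaleR V (\<lambda>v. \<phi> (br H v)) = 0"
proof -
  interpret finite_subspace V by (rule finite_subspaceI[OF V])
  have lin: "linear (\<lambda>v. \<phi> (br y v))" for y
    using linear_compose[OF br_linear(1) \<phi>(1)] by (auto simp: o_def)
  have into: "(\<lambda>v. \<phi> (br x v)) ` V \<subseteq> V" if "x \<in> u" for x using u[OF that] \<phi>(2) by auto
  have "H \<in> u \<and> trace_on scaleR V (\<lambda>v. \<phi> (br H v)) = 0"
    using H unfolding T_span
  proof (induction rule: span_induct_alt)
    case base
    have "trace_on scaleR V (\<lambda>v. 0 *\<^sub>R \<phi> v) = 0 * trace_on scaleR V \<phi>"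
      by (rule trace_on_scale[OF \<phi>])
    then show ?case using subspace_0[OF subspace_u] by (simp add: br_simps linear_0[OF \<phi>(1)])
  next
    case (step c k H)
    then obtain \<beta> where \<beta>: "\<beta> \<in> \<Delta>" "k = K \<beta>" by auto
    have ku: "k \<in> u" using \<beta> K_u by simp
    have "2 * trace_on scaleR V (\<lambda>v. \<phi> (br k v)) = trace_on scaleR V (\<lambda>v. 2 *\<^sub>R \<phi> (br k v))"
      by (rule trace_on_scale[symmetric, OF lin into[OF ku]])
    also have "\<dots> = trace_on scaleR V (\<lambda>v. \<phi> (br (br (xx \<beta>) (yy \<beta>)) v))"
      by (simp add: \<beta> br_xx_yy br_simps linear_scale[OF \<phi>(1)])
    also have "\<dots> = 0"
      using xx_u[OF \<beta>(1)] yy_u[OF \<beta>(1)] by (intro trace_on_commutator V \<phi> u comm)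
    finally have k0: "trace_on scaleR V (\<lambda>v. \<phi> (br k v)) = 0" by simp
    have lin_c: "linear (\<lambda>v. c *\<^sub>R \<phi> (br k v))" by (rule linear_compose_scale_right[OF lin])
    have into_c: "(\<lambda>v. c *\<^sub>R \<phi> (br k v)) ` V \<subseteq> V"
      using into[OF ku] by (auto intro!: subspace_scale[OF V])
    have "trace_on scaleR V (\<lambda>v. \<phi> (br (c *\<^sub>R k + H) v))
        = trace_on scaleR V (\<lambda>v. c *\<^sub>R \<phi> (br k v) + \<phi> (br H v))"
      by (simp add: br_simps linear_add[OF \<phi>(1)] linear_scale[OF \<phi>(1)])
    also have "\<dots> = trace_on scaleR V (\<lambda>v. c *\<^sub>R \<phi> (br k v)) + trace_on scaleR V (\<lambda>v. \<phi> (br H v))"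
      using step by (intro trace_on_add lin_c into_c lin into) auto
    also have "\<dots> = 0"
      using step by (simp add: k0 trace_on_scale[OF lin into[OF ku]])
    finally show ?case
      using step ku by (simp add: subspace_add[OF subspace_u] subspace_scale[OF subspace_u])
  qed
  then show ?thesis by simp
qed

end

text \<open>\<open>BT\<close> is a basis of the torus, \<open>B1\<close> and \<open>B2\<close> are bases of \<open>V\<^sub>1\<close> and \<open>V\<^sub>2\<close>, and \<open>BW\<close> is a basis of an
  invariant complement of \<open>V\<^sub>1 + V\<^sub>2\<close> in the nilpotent ideal.  The condition
  \<open>orth\<close> is the orthogonality of the maps from \<open>V\<^sub>1\<close> to \<open>V\<^sub>2\<close> given by different root vectors, written with
  matrix entries in orthonormal bases.\<close>

locale adapted_basis = compact_roots br u h \<Delta> P Hr X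
  for br :: "'g::real_vector \<Rightarrow> 'g \<Rightarrow> 'g" and u h \<Delta> P Hr X +
  fixes Z :: 'g and BT B1 B2 BW :: "'g set" and d :: "'g \<Rightarrow> real"
  assumes independent_U: "independent (insert Z (BT \<union> M \<union> (B1 \<union> B2 \<union> BW)))"
    and span_U: "span (insert Z (BT \<union> M \<union> (B1 \<union> B2 \<union> BW))) = UNIV"
    and disj: "Z \<notin> BT \<union> M \<union> (B1 \<union> B2 \<union> BW)" "BT \<inter> M = {}" "(BT \<union> M) \<inter> (B1 \<union> B2 \<union> BW) = {}"
      "B1 \<inter> B2 = {}" "(B1 \<union> B2) \<inter> BW = {}"
    and span_BT: "span BT = T"
    and ideal: "y \<in> span (B1 \<union> B2 \<union> BW) \<Longrightarrow> br x y \<in> span (B1 \<union> B2 \<union> BW)"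
    and Zu: "x \<in> u \<Longrightarrow> br Z x = 0"
    and eig: "b \<in> B1 \<union> B2 \<union> BW \<Longrightarrow> br Z b = d b *\<^sub>R b" "b \<in> B1 \<union> B2 \<union> BW \<Longrightarrow> 0 < d b"
    and N_nonempty: "B1 \<union> B2 \<union> BW \<noteq> {}"
    and T1: "H \<in> T \<Longrightarrow> v \<in> B1 \<Longrightarrow> br H v \<in> span B1"
    and T2: "H \<in> T \<Longrightarrow> v \<in> B2 \<Longrightarrow> br H v \<in> span B2"
    and uW: "x \<in> u \<Longrightarrow> v \<in> BW \<Longrightarrow> br x v \<in> span BW"
    and M1: "e \<in> M \<Longrightarrow> v \<in> B1 \<Longrightarrow> br e v \<in> span B2"
    and orth: "e \<in> M \<Longrightarrow> f \<in> M \<Longrightarrow> e \<noteq> f \<Longrightarrow>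
      (\<Sum>b\<in>B1. \<Sum>b'\<in>B2. representation B2 (br e b) b' * representation B2 (br f b) b') = 0"
    and nz: "e \<in> M \<Longrightarrow> \<exists>v\<in>B1. br e v \<noteq> 0"
begin

abbreviation "N \<equiv> B1 \<union> B2 \<union> BW"
abbreviation "U \<equiv> insert Z (BT \<union> M \<union> N)"

lemma finite_U: "finite U" by (rule independent_finite[OF independent_U])

lemma finite_parts: "finite BT" "finite B1" "finite B2" "finite BW" "finite N"
  using finite_U by auto

lemma BT_u: "k \<in> BT \<Longrightarrow> k \<in> T" "k \<in> BT \<Longrightarrow> k \<in> u"
  using span_BT span_base T_u by blast+

text \<open>Structure constants, cut off outside the basis so that identities need no membership conditions.\<close>

definition c where
  "c a b k = (if a \<in> U \<and> b \<in> U \<and> k \<in> U then representation U (br a b) k else 0)"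

lemma c_span:
  assumes "a \<in> U" "b \<in> U" "A \<subseteq> U" "br a b \<in> span A" shows "c a b k = representation A (br a b) k"
proof -
  have "representation U (br a b) = representation A (br a b)"
    by (rule real_vector.representation_extend[OF independent_U assms(4,3)])
  moreover have "representation A (br a b) k = 0" if "k \<notin> U"
    using real_vector.representation_ne_zero[of A "br a b" k] that assms(3) by blast
  ultimately show ?thesis using assms by (simp add: c_def)
qed

lemma c_zero:
  assumes "a \<in> U" "b \<in> U" "A \<subseteq> U" "br a b \<in> span A" "k \<notin> A" shows "c a b k = 0"
  using c_span[OF assms(1-4), of k] real_vector.representation_ne_zero[of A "br a b" k] assms(5) by auto

lemma c_skew: "c a b k = - c b a k"
proof (cases "a \<in> U \<and> b \<in> U \<and> k \<in> U")
  case True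
  have "representation U (br a b) = representation U (- br b a)"
    by (subst br_skew) (rule refl)
  then show ?thesis
    using True span_U by (simp only: c_def simp_thms if_True)
      (simp add: real_vector.representation_neg[OF independent_U])
qed (auto simp: c_def)

lemma c_multiple:
  assumes "a \<in> U" "b \<in> U" "v \<in> U" "br a b = r *\<^sub>R v"
  shows "c a b k = (if k = v then r else 0)"
  using assms span_U independent_U
  by (auto simp: c_def real_vector.representation_scale real_vector.representation_basis)

lemma c_vanish: "a \<in> U \<Longrightarrow> b \<in> U \<Longrightarrow> br a b = 0 \<Longrightarrow> c a b k = 0"
  by (rule c_zero[of a b "{}"]) auto

lemma c_Z: "c Z j k = (if j \<in> N \<and> k = j then d j else 0)"
proof (cases "j \<in> N")
  case True then show ?thesis using c_multiple[of Z j j "d j"] eig by auto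
next
  case False
  have "c Z j k = 0"
  proof (cases "j \<in> U")
    case True
    then have "br Z j = 0" using False Zu BT_u M_u by (auto simp: br_self)
    then show ?thesis using True by (intro c_vanish) auto
  qed (auto simp: c_def)
  then show ?thesis using False by simp
qed

lemma c_TT: "k \<in> BT \<Longrightarrow> l \<in> BT \<Longrightarrow> c k l j = 0"
  by (rule c_vanish) (auto simp: BT_u T_abelian)

lemma c_Txx: assumes "k \<in> BT" "\<alpha> \<in> P" shows "c k (xx \<alpha>) f = (if f = yy \<alpha> then rt \<alpha> k else 0)"
  using br_T[OF BT_u(1)[OF assms(1)] P_sub[OF assms(2)]] assms
  by (intro c_multiple) (auto simp: M_def)

lemma c_Tyy: assumes "k \<in> BT" "\<alpha> \<in> P" shows "c k (yy \<alpha>) f = (if f = xx \<alpha> then - rt \<alpha> k else 0)"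
  using br_T[OF BT_u(1)[OF assms(1)] P_sub[OF assms(2)]] assms
  by (intro c_multiple) (auto simp: M_def)

lemma c_TM: assumes "k \<in> BT" "e \<in> M" "j \<notin> M" shows "c k e j = 0"
proof -
  obtain \<alpha> where \<alpha>: "\<alpha> \<in> P" "e = xx \<alpha> \<or> e = yy \<alpha>" using assms(2) by (auto simp: M_def)
  then have "xx \<alpha> \<in> M" "yy \<alpha> \<in> M" by (auto simp: M_def)
  then show ?thesis using \<alpha> assms c_Txx c_Tyy by auto
qed

lemma c_TM_diagonal: assumes "k \<in> BT" "e \<in> M" shows "c k e e = 0"
proof -
  obtain \<alpha> where \<alpha>: "\<alpha> \<in> P" "e = xx \<alpha> \<or> e = yy \<alpha>" using assms(2) by (auto simp: M_def)
  then show ?thesis using assms c_Txx c_Tyy xx_neq_yy[OF \<alpha>(1) \<alpha>(1)] by auto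
qed

lemma c_N: "a \<in> U \<Longrightarrow> n \<in> N \<Longrightarrow> j \<notin> N \<Longrightarrow> c a n j = 0"
  by (rule c_zero[of a n N]) (auto intro: ideal span_base)

lemma c_uu: "a \<in> BT \<union> M \<Longrightarrow> b \<in> BT \<union> M \<Longrightarrow> j \<notin> BT \<union> M \<Longrightarrow> c a b j = 0"
proof (rule c_zero[of a b "BT \<union> M"])
  assume ab: "a \<in> BT \<union> M" "b \<in> BT \<union> M"
  have "br a b \<in> u" using ab BT_u M_u by (intro u_closed) auto
  also have "u = span (BT \<union> M)"
    unfolding u_span_T_M using span_Un_cong[of T BT M M] span_BT by (simp add: T_span)
  finally show "br a b \<in> span (BT \<union> M)" .
qed auto

lemma c_T1: "k \<in> BT \<Longrightarrow> n \<in> B1 \<Longrightarrow> j \<notin> B1 \<Longrightarrow> c k n j = 0"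
  and c_T2: "k \<in> BT \<Longrightarrow> n \<in> B2 \<Longrightarrow> j \<notin> B2 \<Longrightarrow> c k n j = 0"
  and c_M1: "e \<in> M \<Longrightarrow> n \<in> B1 \<Longrightarrow> j \<notin> B2 \<Longrightarrow> c e n j = 0"
  by (rule c_zero[of _ _ B1] c_zero[of _ _ B2]; auto intro: T1 T2 M1 BT_u)+

lemma c_uW: "a \<in> BT \<union> M \<Longrightarrow> n \<in> BW \<Longrightarrow> j \<notin> BW \<Longrightarrow> c a n j = 0"
proof -
  assume *: "a \<in> BT \<union> M" "n \<in> BW" "j \<notin> BW"
  then have "a \<in> u" using M_u BT_u by blast
  then show "c a n j = 0" using * by (intro c_zero[of a n BW] uW) auto
qed

text \<open>The weights of the degeneration.  The weight 1 of the root vectors kills the brackets among them.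
  The step from \<open>B1\<close> to \<open>B2\<close> compensates this weight, so that exactly the maps from \<open>V\<^sub>1\<close> to \<open>V\<^sub>2\<close> of
  the root vectors survive.  The common shift by 2 on the ideal makes it abelian in the limit.\<close>

definition w :: "'g \<Rightarrow> nat" where
  "w b = (if b \<in> M then 1 else if b \<in> B1 \<union> BW then 2 else if b \<in> B2 then 3 else 0)"

lemma w_simps: "w Z = 0" "b \<in> BT \<Longrightarrow> w b = 0" "b \<in> M \<Longrightarrow> w b = 1" "b \<in> B1 \<Longrightarrow> w b = 2"
  "b \<in> BW \<Longrightarrow> w b = 2" "b \<in> B2 \<Longrightarrow> w b = 3"
  using disj by (auto simp: w_def)

lemma w_N: "b \<in> N \<Longrightarrow> 2 \<le> w b \<and> w b \<le> 3" by (auto simp: w_simps)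

lemma w_bound: "b \<in> U \<Longrightarrow> w b \<le> 3" by (auto simp: w_def)

text \<open>No exponent of the degeneration is positive.  The critical case is the torus acting on the
  ideal, where a component from \<open>V\<^sub>1\<close> or from the complement into \<open>V\<^sub>2\<close> would blow up; invariance of these
  subspaces rules it out.\<close>

lemma c_weights:
  assumes "a \<in> U" "b \<in> U" "c a b k \<noteq> 0" shows "w k \<le> w a + w b"
proof -
  have kU: "k \<in> U" using assms(3) by (auto simp: c_def split: if_splits)
  have half: "w k \<le> w a + w b"
    if h: "c a b k \<noteq> 0" "a = Z \<or> a \<in> BT \<and> b \<noteq> Z \<or> a \<in> M \<and> b \<in> M \<union> N \<or> a \<in> N \<and> b \<in> N" "b \<in> U" for a b
  proof -
    consider "a = Z" | "a \<in> BT" "b \<in> BT" | "a \<in> BT" "b \<in> M" | "a \<in> BT" "b \<in> N"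
      | "a \<in> M" "b \<in> M" | "a \<in> M" "b \<in> N" | "a \<in> N" "b \<in> N"
      using h by blast
    then show ?thesis
    proof cases
      case 1 then show ?thesis using h(1) by (auto simp: c_Z split: if_splits)
    next
      case 2 then show ?thesis using h(1) c_TT by simp
    next
      case 3 then have "k \<in> M" using h(1) c_TM by blast
      then show ?thesis using 3 by (simp add: w_simps)
    next
      case 4
      then consider "b \<in> B1" "k \<in> B1" | "b \<in> B2" "k \<in> B2" | "b \<in> BW" "k \<in> BW"
        using h(1) c_T1 c_T2 c_uW by blast
      then show ?thesis by cases (simp_all add: w_simps)
    next
      case 5 then have "k \<in> BT \<union> M" using h(1) c_uu by blast
      then show ?thesis using 5 by (auto simp: w_simps)
    next
      case 6
      then consider "b \<in> B1" | "b \<in> B2" | "b \<in> BW" "k \<in> BW" using h(1) c_uW by blast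
      then show ?thesis using w_bound[OF kU] 6 by cases (simp_all add: w_simps)
    next
      case 7 then show ?thesis using w_N[of a] w_N[of b] w_bound[OF kU] by linarith
    qed
  qed
  show ?thesis
  proof (cases "a = Z \<or> a \<in> BT \<and> b \<noteq> Z \<or> a \<in> M \<and> b \<in> M \<union> N \<or> a \<in> N \<and> b \<in> N")
    case True then show ?thesis using half[OF assms(3) _ assms(2)] by blast
  next
    case False
    then have "b = Z \<or> b \<in> BT \<and> a \<noteq> Z \<or> b \<in> M \<and> a \<in> M \<union> N \<or> b \<in> N \<and> a \<in> N"
      using assms(1,2) by blast
    moreover have "c b a k \<noteq> 0" using assms(3) c_skew[of a b k] by simp
    ultimately show ?thesis using half[of b a] assms(1) by simp
  qed
qed

lemma N_rep: "k \<in> BT \<Longrightarrow> n \<in> N \<Longrightarrow> c k n n' = representation N (br k n) n'"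
  by (rule c_span) (auto intro: ideal span_base)

lemma independent_N: "independent N"
  using independent_U by (rule real_vector.independent_mono) auto

lemma trace_TN:
  assumes k: "k \<in> BT" shows "(\<Sum>n\<in>N. c k n n) = 0" "(\<Sum>n\<in>N. d n * c k n n) = 0"
proof -
  interpret fs: finite_subspace "span N" by (rule finite_subspaceI) simp
  note base = finite_parts(5) independent_N refl
  have inv: "br x ` span N \<subseteq> span N" for x using ideal by auto
  have "0 = trace_on scaleR (span N) (br k)"
    using trace_on_T[of "span N" "\<lambda>v. v" k] inv BT_u(1)[OF k] by (simp add: linear_id[unfolded id_def])
  also have "\<dots> = (\<Sum>n\<in>N. representation N (br k n) n)"
    by (rule fs.trace_on_linear_basis[OF base br_linear(1) inv])
  finally show "(\<Sum>n\<in>N. c k n n) = 0" using k by (simp add: N_rep)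
  have comm: "br Z (br x v) = br x (br Z v)" if "x \<in> u" for x v
    by (subst jacobi) (simp add: Zu that br_simps)
  have "0 = trace_on scaleR (span N) (\<lambda>v. br Z (br k v))"
    using trace_on_T[of "span N" "br Z" k] inv BT_u(1)[OF k] by (simp add: br_linear comm)
  also have "\<dots> = (\<Sum>n\<in>N. representation N (br Z (br k n)) n)"
    using inv by (intro fs.trace_on_linear_basis[OF base linear_br_br]) (auto intro: ideal)
  also have "\<dots> = (\<Sum>n\<in>N. d n * c k n n)"
  proof (rule sum.cong[OF refl])
    fix n assume n: "n \<in> N"
    then have in_N: "br k n \<in> span N" by (intro ideal span_base)
    have "br Z (br k n) = br Z (\<Sum>m\<in>N. representation N (br k n) m *\<^sub>R m)"
      using real_vector.sum_representation_eq[OF independent_N in_N finite_parts(5) subset_refl] by simp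
    also have "\<dots> = (\<Sum>m\<in>N. (representation N (br k n) m * d m) *\<^sub>R m)"
      unfolding linear_sum[OF br_linear(1)] by (intro sum.cong refl) (simp add: br_simps eig)
    finally show "representation N (br Z (br k n)) n = d n * c k n n"
      using real_vector.representation_sum_scale[OF finite_parts(5) independent_N n] N_rep[OF k n]
      by (simp add: mult.commute)
  qed
  finally show "(\<Sum>n\<in>N. d n * c k n n) = 0" by simp
qed

lemma c_M1_rep: "e \<in> M \<Longrightarrow> n \<in> B1 \<Longrightarrow> c e n n' = representation B2 (br e n) n'"
  by (rule c_span) (auto intro: M1)

definition q where "q e = (\<Sum>n\<in>B1. \<Sum>n'\<in>B2. (c e n n')\<^sup>2)"

lemma q_pos: assumes "e \<in> M" shows "0 < q e"
proof -
  obtain v where v: "v \<in> B1" "br e v \<noteq> 0" using nz[OF assms] by blast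
  have B2: "independent B2" using independent_U by (rule real_vector.independent_mono) auto
  have "\<exists>n'\<in>B2. representation B2 (br e v) n' \<noteq> 0"
  proof (rule ccontr)
    assume "\<not> (\<exists>n'\<in>B2. representation B2 (br e v) n' \<noteq> 0)"
    then have "(\<Sum>b\<in>B2. representation B2 (br e v) b *\<^sub>R b) = 0" by (intro sum.neutral) auto
    then show False
      using real_vector.sum_representation_eq[OF B2 M1[OF assms v(1)] finite_parts(3) subset_refl] v by simp
  qed
  then obtain n' where "n' \<in> B2" "c e v n' \<noteq> 0" using c_M1_rep[OF assms v(1)] by auto
  then have "0 < (\<Sum>n'\<in>B2. (c e v n')\<^sup>2)"
    by (intro sum_pos2[OF finite_parts(3), of n']) auto
  then show ?thesis
    unfolding q_def by (rule sum_pos2[OF finite_parts(2) v(1)]) (simp add: sum_nonneg)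
qed

context
  fixes \<delta> \<epsilon> :: real
  assumes \<delta>: "0 < \<delta>" and \<epsilon>: "0 < \<epsilon>" "\<epsilon> \<le> \<delta>"
    and small_\<delta>: "\<And>n. n \<in> N \<Longrightarrow>
      2 * (\<Sum>k\<in>BT \<union> M. \<Sum>v\<in>N. \<Sum>w\<in>N. (c k v w)\<^sup>2) * \<delta>\<^sup>2 < (\<Sum>v\<in>N. d v) * d n"
    and small_\<epsilon>: "\<And>e. e \<in> M \<Longrightarrow>
      2 * (\<Sum>k\<in>BT. \<Sum>f\<in>M. \<Sum>f'\<in>M. (c k f f')\<^sup>2) * \<epsilon>\<^sup>2 < \<delta>\<^sup>2 * q e / 2"
begin

text \<open>The lengths of the basis vectors before degeneration.  Giving \<open>xx \<alpha>\<close> and \<open>yy \<alpha>\<close> different factors is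
  essential: with equal factors the torus would act on the root planes by skew maps, and the curvature
  would not be negative on the torus.\<close>

definition s where
  "s b = (if b \<in> BT then \<epsilon> else if b \<in> xx ` P then \<delta> else if b \<in> yy ` P then 2 * \<delta> else 1)"

text \<open>The limit of the structure constants.\<close>

definition D where
  "D a b k = (if w k = w a + w b then s a * s b / s k * c a b k else 0)"

lemma s_pos: "0 < s b" using \<delta> \<epsilon> by (simp add: s_def)

lemma s_T: "b \<in> BT \<Longrightarrow> s b = \<epsilon>" by (simp add: s_def)

lemma s_M: "\<alpha> \<in> P \<Longrightarrow> s (xx \<alpha>) = \<delta>" "\<alpha> \<in> P \<Longrightarrow> s (yy \<alpha>) = 2 * \<delta>"
proof -
  assume \<alpha>: "\<alpha> \<in> P"
  then have "xx \<alpha> \<notin> BT" "yy \<alpha> \<notin> BT" using disj(2) by (auto simp: M_def)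
  moreover have "yy \<alpha> \<notin> xx ` P"
  proof
    assume "yy \<alpha> \<in> xx ` P"
    then obtain \<beta> where "\<beta> \<in> P" "xx \<beta> = yy \<alpha>" by auto
    then show False using xx_neq_yy \<alpha> by blast
  qed
  ultimately show "s (xx \<alpha>) = \<delta>" "s (yy \<alpha>) = 2 * \<delta>" using \<alpha> by (auto simp: s_def)
qed

lemma s_M_bounds: "e \<in> M \<Longrightarrow> \<delta> \<le> s e \<and> s e \<le> 2 * \<delta>"
  using s_M \<delta> by (auto simp: M_def)

lemma s_Z: "s Z = 1" and s_N: "n \<in> N \<Longrightarrow> s n = 1"
  using disj by (auto simp: s_def M_def)

lemma D_skew: "D a b k = - D b a k"
  using c_skew[of a b k] by (simp add: D_def add.commute mult.commute)

lemma D_zero: "c a b k = 0 \<Longrightarrow> D a b k = 0" by (simp add: D_def)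

lemma D_Z: "D Z j k = (if j \<in> N \<and> k = j then d j else 0)"
  by (auto simp: D_def c_Z w_simps s_Z s_N)

lemma D_TM: "k \<in> BT \<Longrightarrow> e \<in> M \<Longrightarrow> f \<in> M \<Longrightarrow> D k e f = \<epsilon> * s e / s f * c k e f"
  by (simp add: D_def w_simps s_T)

lemma D_TN: "k \<in> BT \<Longrightarrow> n \<in> N \<Longrightarrow> n' \<in> N \<Longrightarrow> D k n n' = \<epsilon> * c k n n'"
proof -
  assume k: "k \<in> BT" "n \<in> N" "n' \<in> N"
  have "w n' = w n" if h: "c k n n' \<noteq> 0"
  proof -
    consider "n \<in> B1" "n' \<in> B1" | "n \<in> B2" "n' \<in> B2" | "n \<in> BW" "n' \<in> BW"
      using h k c_T1 c_T2 c_uW by blast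
    then show ?thesis by cases (simp_all add: w_simps)
  qed
  then show "D k n n' = \<epsilon> * c k n n'" using k by (auto simp: D_def w_simps s_T s_N)
qed

lemma D_MN:
  assumes "e \<in> M" "n \<in> N" "n' \<in> N"
  shows "D e n n' = (if n \<in> B1 \<and> n' \<in> B2 then s e * c e n n' else 0)"
proof -
  consider "n \<in> B1" "n' \<in> B2" | "n \<in> B1" "n' \<notin> B2" | "n \<in> B2" | "n \<in> BW" using assms by blast
  then show ?thesis
  proof cases
    case 1 then show ?thesis using assms by (simp add: D_def w_simps s_N)
  next
    case 2 then show ?thesis using assms c_M1 by (auto simp: D_def)
  next
    case 3
    then have "n \<notin> B1" using disj by auto
    then show ?thesis using w_N[OF assms(3)] 3 assms(1) by (simp add: D_def w_simps)
  next
    case 4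
    then have "n \<notin> B1" using disj by auto
    moreover have "D e n n' = 0"
    proof (cases "n' \<in> BW")
      case True then show ?thesis using 4 assms by (simp add: D_def w_simps)
    next
      case False then show ?thesis using 4 assms c_uW[of e n n'] by (simp add: D_zero)
    qed
    ultimately show ?thesis by simp
  qed
qed

text \<open>A root vector maps \<open>V\<^sub>1\<close> to \<open>V\<^sub>2\<close> and kills the rest, so each entry of its matrix occurs twice in the
  symmetrization, and no two entries are added there.\<close>

lemma D_MN_sum:
  assumes "e \<in> M" "f \<in> M"
  shows "(\<Sum>n\<in>N. \<Sum>n'\<in>N. (D e n n' + D e n' n) * (D f n n' + D f n' n))
      = 2 * (s e * s f * (\<Sum>n\<in>B1. \<Sum>n'\<in>B2. c e n n' * c f n n'))"
proof -
  define G where "G n n' = D e n n' * D f n n'" for n n'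
  have "(\<Sum>n\<in>N. \<Sum>n'\<in>N. (D e n n' + D e n' n) * (D f n n' + D f n' n))
      = (\<Sum>n\<in>N. \<Sum>n'\<in>N. G n n' + G n' n)"
  proof (intro sum.cong refl)
    fix n n' assume n: "n \<in> N" "n' \<in> N"
    have cross: "D e n n' * D f n' n = 0" "D e n' n * D f n n' = 0"
      using disj(4) n assms by (auto simp: D_MN)
    show "(D e n n' + D e n' n) * (D f n n' + D f n' n) = G n n' + G n' n"
      unfolding G_def distrib_left distrib_right cross by simp
  qed
  also have "\<dots> = 2 * (\<Sum>n\<in>N. \<Sum>n'\<in>N. G n n')"
    unfolding sum.distrib by (subst (2) sum.swap) simp
  also have "(\<Sum>n\<in>N. \<Sum>n'\<in>N. G n n') = (\<Sum>n\<in>B1. \<Sum>n'\<in>N. G n n')"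
    using finite_parts assms by (intro sum.mono_neutral_right) (auto simp: G_def D_MN intro!: sum.neutral)
  also have "\<dots> = (\<Sum>n\<in>B1. \<Sum>n'\<in>B2. G n n')"
    using finite_parts assms by (intro sum.cong refl sum.mono_neutral_right) (auto simp: G_def D_MN)
  also have "\<dots> = (\<Sum>n\<in>B1. \<Sum>n'\<in>B2. s e * s f * (c e n n' * c f n n'))"
    using assms by (intro sum.cong refl) (simp add: G_def D_MN mult_ac)
  finally show ?thesis by (simp add: sum_distrib_left)
qed

lemma D_N_bound: assumes "k \<in> BT \<union> M" "v \<in> N" "v' \<in> N" shows "(D k v v')\<^sup>2 \<le> 4 * \<delta>\<^sup>2 * (c k v v')\<^sup>2"
proof -
  have "\<bar>D k v v'\<bar> \<le> 2 * \<delta> * \<bar>c k v v'\<bar>"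
  proof (cases "k \<in> BT")
    case True
    then show ?thesis using assms \<delta> \<epsilon> by (simp add: D_TN abs_mult mult_right_mono)
  next
    case False
    then have k: "k \<in> M" using assms by auto
    show ?thesis using s_M_bounds[OF k] \<delta> s_pos[of k] assms k
      by (auto simp: D_MN abs_mult intro!: mult_right_mono)
  qed
  then have "\<bar>D k v v'\<bar>\<^sup>2 \<le> (2 * \<delta> * \<bar>c k v v'\<bar>)\<^sup>2" by (intro power_mono) auto
  then show ?thesis by (simp add: power_mult_distrib)
qed

lemma D_M_bound: assumes "k \<in> BT" "f \<in> M" "f' \<in> M" shows "(D k f f')\<^sup>2 \<le> 4 * \<epsilon>\<^sup>2 * (c k f f')\<^sup>2"
proof -
  have "s f \<le> 2 * s f'" using s_M_bounds[OF assms(2)] s_M_bounds[OF assms(3)] by linarith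
  then have "s f / s f' \<le> 2" using s_pos[of f'] by (simp add: field_simps)
  then have "\<epsilon> * (s f / s f') * \<bar>c k f f'\<bar> \<le> \<epsilon> * 2 * \<bar>c k f f'\<bar>"
    using \<epsilon> by (intro mult_right_mono mult_left_mono) auto
  moreover have "\<bar>D k f f'\<bar> = \<epsilon> * (s f / s f') * \<bar>c k f f'\<bar>"
    using assms \<epsilon> s_pos[of f] s_pos[of f'] by (simp add: D_TM abs_mult)
  ultimately have "\<bar>D k f f'\<bar>\<^sup>2 \<le> (\<epsilon> * 2 * \<bar>c k f f'\<bar>)\<^sup>2" by (intro power_mono) auto
  then show ?thesis by (simp add: power_mult_distrib mult.commute)
qed

text \<open>On the plane of \<open>xx \<alpha>\<close> and \<open>yy \<alpha>\<close> the two off-diagonal entries of the action of \<open>k\<close> are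
  \<open>\<epsilon> rt \<alpha> k / 2\<close> and \<open>- 2 \<epsilon> rt \<alpha> k\<close>, because the lengths have ratio 2; their sum is a nonzero multiple of
  \<open>rt \<alpha> k\<close>.\<close>

lemma D_faithful:
  assumes x: "\<And>e f. e \<in> M \<Longrightarrow> f \<in> M \<Longrightarrow> (\<Sum>k\<in>BT. x k * (D k e f + D k f e)) = 0" and k: "k \<in> BT"
  shows "x k = 0"
proof -
  define H where "H = (\<Sum>k\<in>BT. x k *\<^sub>R k)"
  have BT: "independent BT" using independent_U by (rule real_vector.independent_mono) auto
  have rt_sum: "rt \<alpha> (\<Sum>k\<in>F. x k *\<^sub>R k) = (\<Sum>k\<in>F. x k * rt \<alpha> k)"
    if "finite F" "F \<subseteq> BT" "\<alpha> \<in> \<Delta>" for F \<alpha>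
    using that
  proof (induction F)
    case empty
    have "rt \<alpha> (0 *\<^sub>R 0) = 0 * rt \<alpha> 0"
      using empty by (intro rt_scale subspace_0[OF subspace_u])
    then show ?case by simp
  next
    case (insert a F)
    then have "a \<in> u" "x a *\<^sub>R a \<in> u" "(\<Sum>k\<in>F. x k *\<^sub>R k) \<in> u"
      using BT_u by (auto intro!: subspace_scale[OF subspace_u] subspace_sum[OF subspace_u])
    then show ?case using insert by (simp add: rt_add rt_scale)
  qed
  have "H \<in> T" unfolding H_def span_BT[symmetric] by (intro span_sum span_scale span_base)
  moreover have "rt \<alpha> H = 0" if \<alpha>: "\<alpha> \<in> P" for \<alpha>
  proof -
    have in_M: "xx \<alpha> \<in> M" "yy \<alpha> \<in> M" using \<alpha> by (auto simp: M_def)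
    have "D k (xx \<alpha>) (yy \<alpha>) + D k (yy \<alpha>) (xx \<alpha>) = - (3 / 2 * \<epsilon>) * rt \<alpha> k" if "k \<in> BT" for k
      using that \<alpha> in_M \<delta> by (simp add: D_TM s_M c_Txx c_Tyy field_simps)
    then have "0 = (\<Sum>k\<in>BT. x k * (- (3 / 2 * \<epsilon>) * rt \<alpha> k))"
      using x[OF in_M] by simp
    also have "\<dots> = - (3 / 2 * \<epsilon>) * (\<Sum>k\<in>BT. x k * rt \<alpha> k)"
      unfolding sum_distrib_left by (intro sum.cong refl) simp
    also have "(\<Sum>k\<in>BT. x k * rt \<alpha> k) = rt \<alpha> H"
      unfolding H_def using finite_parts P_sub[OF \<alpha>] by (simp add: rt_sum)
    finally show ?thesis using \<epsilon> by simp
  qed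
  ultimately have "H = 0" by (rule rt_faithful)
  then show ?thesis
    using real_vector.representation_sum_scale[OF finite_parts(1) BT k, of x]
    by (simp add: H_def real_vector.representation_zero)
qed

lemma graded_limit: "graded_limit Z BT M N D d"
proof
  show "finite BT" "finite M" "finite N" by (simp_all add: finite_parts M_finite del: finite_Un)
  show "Z \<notin> BT" "Z \<notin> M" "Z \<notin> N" "BT \<inter> M = {}" "BT \<inter> N = {}" "M \<inter> N = {}" "N \<noteq> {}"
    using disj N_nonempty by auto
  show "0 < d n" if "n \<in> N" for n using eig(2)[OF that] .
  show "D i j k = - D j i k" for i j k by (rule D_skew)
  show "D Z j k = (if j \<in> N \<and> k = j then d j else 0)" for j k by (rule D_Z)
  show "D k l j = 0" if "k \<in> BT" "l \<in> BT" for k l j using that by (simp add: D_zero c_TT)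
  show "D k e j = 0" if "k \<in> BT" "e \<in> M" "j \<notin> M" for k e j using that by (simp add: D_zero c_TM)
  show "D k n j = 0" if "k \<in> BT" "n \<in> N" "j \<notin> N" for k n j
    using that by (intro D_zero c_N) auto
  show "D k n j = 0" if "k \<in> M" "n \<in> N" "j \<notin> N" for k n j
    using that by (intro D_zero c_N) auto
  show "D e f j = 0" if "e \<in> M" "f \<in> M" for e f j
  proof (cases "j \<in> BT \<union> M")
    case True then show ?thesis using that by (auto simp: D_def w_simps)
  next
    case False then show ?thesis using that by (intro D_zero c_uu) auto
  qed
  show "D n n' j = 0" if "n \<in> N" "n' \<in> N" for n n' j
  proof (cases "j \<in> U")
    case True then show ?thesis using w_bound[OF True] w_N[OF that(1)] w_N[OF that(2)] by (simp add: D_def)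
  next
    case False then show ?thesis by (intro D_zero) (simp add: c_def)
  qed
  show "(\<Sum>e\<in>M. D k e e) = 0" if "k \<in> BT" for k
    using that by (intro sum.neutral ballI) (simp add: D_zero c_TM_diagonal)
  show "(\<Sum>n\<in>N. D k n n) = 0" if "k \<in> BT" for k
  proof -
    have "(\<Sum>n\<in>N. D k n n) = \<epsilon> * (\<Sum>n\<in>N. c k n n)"
      unfolding sum_distrib_left using that by (intro sum.cong refl) (simp add: D_TN)
    then show ?thesis by (simp add: trace_TN[OF that])
  qed
  show "(\<Sum>n\<in>N. d n * D k n n) = 0" if "k \<in> BT" for k
  proof -
    have "(\<Sum>n\<in>N. d n * D k n n) = \<epsilon> * (\<Sum>n\<in>N. d n * c k n n)"
      unfolding sum_distrib_left using that by (intro sum.cong refl) (simp add: D_TN)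
    then show ?thesis by (simp add: trace_TN[OF that])
  qed
  show "D e n n = 0" if "e \<in> M" "n \<in> N" for e n
    using that disj(4) by (auto simp: D_MN)
  show "(\<Sum>n\<in>N. \<Sum>n'\<in>N. (D k n n' + D k n' n) * (D e n n' + D e n' n)) = 0"
    if ke: "k \<in> BT" "e \<in> M" for k e
  proof (intro sum.neutral ballI)
    fix n n' assume n: "n \<in> N" "n' \<in> N"
    have *: "D k m m' = 0" "D k m' m = 0" if "m \<in> B1" "m' \<in> B2" for m m'
    proof -
      have "m' \<notin> B1" "m \<notin> B2" using that disj(4) by auto
      then show "D k m m' = 0" "D k m' m = 0"
        using that ke by (simp_all add: D_zero c_T1 c_T2)
    qed
    consider "n \<in> B1" "n' \<in> B2" | "n' \<in> B1" "n \<in> B2" | "D e n n' = 0" "D e n' n = 0"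
      using D_MN[OF ke(2) n] D_MN[OF ke(2) n(2,1)]
      by (cases "n \<in> B1 \<and> n' \<in> B2"; cases "n' \<in> B1 \<and> n \<in> B2") auto
    then show "(D k n n' + D k n' n) * (D e n n' + D e n' n) = 0"
      using *[of n n'] *[of n' n] by cases auto
  qed
  show "(\<Sum>n\<in>N. \<Sum>n'\<in>N. (D e n n' + D e n' n) * (D f n n' + D f n' n)) = 0"
    if "e \<in> M" "f \<in> M" "e \<noteq> f" for e f
  proof -
    have "(\<Sum>n\<in>B1. \<Sum>n'\<in>B2. c e n n' * c f n n') = 0"
      using orth[OF that] that by (simp add: c_M1_rep)
    then show ?thesis unfolding D_MN_sum[OF that(1,2)] by simp
  qed
  show "(\<Sum>k\<in>BT \<union> M. \<Sum>v\<in>N. \<Sum>w\<in>N. (D k v w)\<^sup>2) / 2 < (\<Sum>v\<in>N. d v) * d n" if "n \<in> N" for n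
  proof -
    have "(\<Sum>k\<in>BT \<union> M. \<Sum>v\<in>N. \<Sum>w\<in>N. (D k v w)\<^sup>2)
        \<le> (\<Sum>k\<in>BT \<union> M. \<Sum>v\<in>N. \<Sum>w\<in>N. 4 * \<delta>\<^sup>2 * (c k v w)\<^sup>2)"
      by (intro sum_mono D_N_bound)
    also have "\<dots> = 4 * \<delta>\<^sup>2 * (\<Sum>k\<in>BT \<union> M. \<Sum>v\<in>N. \<Sum>w\<in>N. (c k v w)\<^sup>2)"
      by (simp only: sum_distrib_left)
    finally show ?thesis using small_\<delta>[OF that] by (simp add: mult_ac)
  qed
  show "(\<Sum>k\<in>BT. \<Sum>f\<in>M. \<Sum>f'\<in>M. (D k f f')\<^sup>2) / 2 < (\<Sum>n\<in>N. \<Sum>n'\<in>N. (D e n n' + D e n' n)\<^sup>2) / 4"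
    if "e \<in> M" for e
  proof -
    have "(\<Sum>k\<in>BT. \<Sum>f\<in>M. \<Sum>f'\<in>M. (D k f f')\<^sup>2)
        \<le> (\<Sum>k\<in>BT. \<Sum>f\<in>M. \<Sum>f'\<in>M. 4 * \<epsilon>\<^sup>2 * (c k f f')\<^sup>2)"
      by (intro sum_mono D_M_bound)
    also have "\<dots> = 4 * \<epsilon>\<^sup>2 * (\<Sum>k\<in>BT. \<Sum>f\<in>M. \<Sum>f'\<in>M. (c k f f')\<^sup>2)"
      by (simp only: sum_distrib_left)
    finally have "(\<Sum>k\<in>BT. \<Sum>f\<in>M. \<Sum>f'\<in>M. (D k f f')\<^sup>2) / 2 < \<delta>\<^sup>2 * q e / 2"
      using small_\<epsilon>[OF that] by (simp add: mult_ac)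
    also have "\<dots> \<le> (s e)\<^sup>2 * q e / 2"
      using s_M_bounds[OF that] \<delta> q_pos[OF that] by (intro divide_right_mono mult_right_mono power_mono) auto
    also have "\<dots> = (\<Sum>n\<in>N. \<Sum>n'\<in>N. (D e n n' + D e n' n)\<^sup>2) / 4"
      using D_MN_sum[OF that that] by (simp add: power2_eq_square q_def)
    finally show ?thesis .
  qed
  show "x k = 0"
    if "\<And>e f. e \<in> M \<Longrightarrow> f \<in> M \<Longrightarrow> (\<Sum>k\<in>BT. x k * (D k e f + D k f e)) = 0" "k \<in> BT" for x k
    using that by (rule D_faithful)
qed

lemma negative_ricci_if_small: "\<exists>ip. inner_product_on UNIV ip \<and> negative_ricci br ip"
proof (rule negative_ricci_by_degeneration[OF finite_U independent_U span_U])
  interpret gl: graded_limit Z BT M N D d by (rule graded_limit)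
  show "ricci_form U D x < 0" if "\<exists>i\<in>U. x i \<noteq> 0" for x
    using gl.ricci_form_negative[of x] that by simp
  show "w k \<le> w a + w b"
    if "a \<in> U" "b \<in> U" "k \<in> U" "representation U (br a b) k \<noteq> 0" for a b k
    using c_weights[OF that(1,2), of k] that by (simp add: c_def)
  show "D a b k = (if w k = w a + w b then s a * s b / s k * representation U (br a b) k else 0)"
    if "a \<in> U" "b \<in> U" "k \<in> U" for a b k
    using that by (simp add: D_def c_def)
qed (rule s_pos)

end

text \<open>The bound on the ideal is quadratic in \<open>\<delta>\<close> and is met first; then \<open>\<epsilon>\<close> is chosen, since the bound on
  the root vectors is quadratic in \<open>\<epsilon>\<close> against a multiple of \<open>\<delta>\<^sup>2\<close>.\<close>

theorem negative_ricci_exists: "\<exists>ip. inner_product_on UNIV ip \<and> negative_ricci br ip"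
proof -
  have d_sum: "0 < (\<Sum>v\<in>N. d v)"
    using finite_parts(5) N_nonempty eig(2) by (intro sum_pos) auto
  have pos: "\<forall>n\<in>N. 0 < (\<Sum>v\<in>N. d v) * d n" using d_sum eig(2) by (intro ballI mult_pos_pos) blast+
  have nonneg: "0 \<le> 2 * (\<Sum>k\<in>BT \<union> M. \<Sum>v\<in>N. \<Sum>w\<in>N. (c k v w)\<^sup>2)" by (simp add: sum_nonneg)
  obtain \<delta> where \<delta>: "0 < \<delta>"
    "\<forall>n\<in>N. 2 * (\<Sum>k\<in>BT \<union> M. \<Sum>v\<in>N. \<Sum>w\<in>N. (c k v w)\<^sup>2) * \<delta>\<^sup>2 < (\<Sum>v\<in>N. d v) * d n"
    using small_square[where g = "\<lambda>n. (\<Sum>v\<in>N. d v) * d n", OF finite_parts(5) pos nonneg zero_less_one]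
    by blast
  have pos': "\<forall>e\<in>M. 0 < \<delta>\<^sup>2 * q e / 2" using \<delta>(1) q_pos by simp
  have nonneg': "0 \<le> 2 * (\<Sum>k\<in>BT. \<Sum>f\<in>M. \<Sum>f'\<in>M. (c k f f')\<^sup>2)" by (simp add: sum_nonneg)
  obtain \<epsilon> where \<epsilon>: "0 < \<epsilon>" "\<epsilon> \<le> \<delta>"
    "\<forall>e\<in>M. 2 * (\<Sum>k\<in>BT. \<Sum>f\<in>M. \<Sum>f'\<in>M. (c k f f')\<^sup>2) * \<epsilon>\<^sup>2 < \<delta>\<^sup>2 * q e / 2"
    using small_square[where g = "\<lambda>e. \<delta>\<^sup>2 * q e / 2", OF M_finite pos' nonneg' \<delta>(1)]
    by blast
  show ?thesis by (rule negative_ricci_if_small[OF \<delta>(1) \<epsilon>(1,2) bspec[OF \<delta>(2)] bspec[OF \<epsilon>(3)]])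
qed

end

section \<open>Transposes, complements and eigenspaces\<close>

text \<open>This turns the orthogonality condition on the root vectors into a statement about matrix entries.
  Only the values of the maps on \<open>W\<close> are controlled, and they may leave \<open>W\<close>.\<close>

lemma trace_on_transpose:
  assumes ip: "inner_product_on V ip" and V: "subspace V"
    and B: "finite B" "B \<subseteq> V" "span B = W"
    and on: "\<And>a b. a \<in> B \<Longrightarrow> b \<in> B \<Longrightarrow> ip a b = (if a = b then 1 else 0)"
    and A: "linear A" "A ` W \<subseteq> V" and C: "linear C" "C ` W \<subseteq> V"
  shows "trace_on scaleR W (\<lambda>v. transpose_on ip W C (A v)) = (\<Sum>b\<in>B. ip (C b) (A b))"
proof -
  have ind: "independent B" by (rule orthonormal_independent[OF ip V B(1,2) on])
  have WV: "W \<subseteq> V" using B V by (auto intro: span_minimal[THEN subsetD])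
  have BW: "B \<subseteq> W" using B(3) span_superset by blast
  have W: "subspace W" using B(3) by auto
  have tr: "transpose_on ip W C y = (\<Sum>b\<in>B. ip (C b) y *\<^sub>R b)" if y: "y \<in> V" for y
    unfolding transpose_on_def
  proof (rule the_equality)
    let ?z = "\<Sum>b\<in>B. ip (C b) y *\<^sub>R b"
    have zW: "?z \<in> W" using BW W by (auto intro!: subspace_sum subspace_scale)
    have adj: "ip (C w) y = ip w ?z" if w: "w \<in> W" for w
    proof -
      have wV: "w \<in> V" and zV: "?z \<in> V" using w zW WV by auto
      have "w = (\<Sum>b\<in>B. ip w b *\<^sub>R b)"
        using real_vector.sum_representation_eq[OF ind _ B(1) subset_refl, of w]
          orthonormal_representation[OF ip V B(1,2) on, of w] w B(3) by simp
      then have "C w = C (\<Sum>b\<in>B. ip w b *\<^sub>R b)" by (rule arg_cong)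
      also have "\<dots> = (\<Sum>b\<in>B. ip w b *\<^sub>R C b)"
        by (simp add: linear_sum[OF C(1)] linear_scale[OF C(1)])
      finally have "ip (C w) y = (\<Sum>b\<in>B. ip (ip w b *\<^sub>R C b) y)"
        using B y C(2) BW V by (simp only:) (intro inner_product_on_sum[OF ip V], auto intro!: subspace_scale)
      also have "\<dots> = (\<Sum>b\<in>B. ip w b * ip (C b) y)"
        using C(2) BW y by (intro sum.cong refl inner_product_onD(2)[OF ip]) auto
      also have "\<dots> = (\<Sum>b\<in>B. ip (ip (C b) y *\<^sub>R b) w)"
        using B(2) wV inner_product_onD(2,3)[OF ip]
        by (intro sum.cong refl) (simp add: subset_iff)
      also have "\<dots> = ip ?z w"
        using B wV V by (intro inner_product_on_sum[OF ip V, symmetric]) (auto intro!: subspace_scale)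
      also have "\<dots> = ip w ?z" by (rule inner_product_onD(3)[OF ip zV wV])
      finally show ?thesis .
    qed
    show "?z \<in> W \<and> (\<forall>w\<in>W. ip (C w) y = ip w ?z)" using zW adj by blast
    fix z assume z: "z \<in> W \<and> (\<forall>w\<in>W. ip (C w) y = ip w z)"
    define v where "v = z - ?z"
    have vW: "v \<in> W" unfolding v_def using z zW W by (intro subspace_diff) auto
    have in_V: "v \<in> V" "z \<in> V" "?z \<in> V" using vW z zW WV by auto
    have "ip z v = ip ?z v"
      using z adj[OF vW] vW inner_product_onD(3)[OF ip in_V(2,1)] inner_product_onD(3)[OF ip in_V(3,1)] by simp
    moreover have "ip (v + ?z) v = ip v v + ip ?z v"
      by (rule inner_product_onD(1)[OF ip in_V(1,3,1)])
    ultimately have "ip v v = 0" by (simp add: v_def)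
    then have "v = 0" using inner_product_onD(4)[OF ip in_V(1,1)] by force
    then show "z = ?z" by (simp add: v_def)
  qed
  let ?f = "\<lambda>v. \<Sum>b\<in>B. ip (C b) (A v) *\<^sub>R b"
  have f: "transpose_on ip W C (A v) = ?f v" if "v \<in> W" for v using that A(2) by (intro tr) auto
  have CA: "C b \<in> V" "A v \<in> V" if "b \<in> B" "v \<in> W" for b v using that A(2) C(2) BW by auto
  have "trace_on scaleR W (\<lambda>v. transpose_on ip W C (A v))
      = (\<Sum>b\<in>B. representation B (transpose_on ip W C (A b)) b)"
  proof (rule real_vector.trace_on_basis[OF B(1) ind B(3)])
    fix x y assume xy: "x \<in> W" "y \<in> W"
    have "ip (C b) (A (x + y)) = ip (C b) (A x) + ip (C b) (A y)" if "b \<in> B" for b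
    proof -
      have "ip (A x + A y) (C b) = ip (A x) (C b) + ip (A y) (C b)"
        using CA that xy by (intro inner_product_onD(1)[OF ip]) auto
      then show ?thesis
        using inner_product_onD(3)[OF ip] CA that xy V by (simp add: linear_add[OF A(1)] subspace_add)
    qed
    then show "transpose_on ip W C (A (x + y)) = transpose_on ip W C (A x) + transpose_on ip W C (A y)"
      using xy W by (simp add: f subspace_add scaleR_left_distrib sum.distrib)
  next
    fix r x assume x: "x \<in> W"
    have "ip (C b) (A (r *\<^sub>R x)) = r * ip (C b) (A x)" if "b \<in> B" for b
    proof -
      have "ip (r *\<^sub>R A x) (C b) = r * ip (A x) (C b)"
        using CA that x by (intro inner_product_onD(2)[OF ip]) auto
      then show ?thesis
        using inner_product_onD(3)[OF ip] CA that x V by (simp add: linear_scale[OF A(1)] subspace_scale)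
    qed
    then show "transpose_on ip W C (A (r *\<^sub>R x)) = r *\<^sub>R transpose_on ip W C (A x)"
      using x W by (simp add: f subspace_scale scaleR_sum_right)
  next
    fix x assume "x \<in> W"
    then show "transpose_on ip W C (A x) \<in> W"
      using BW W by (auto simp: f intro!: subspace_sum subspace_scale)
  qed
  also have "\<dots> = (\<Sum>b\<in>B. ip (C b) (A b))"
  proof (rule sum.cong[OF refl])
    fix b assume b: "b \<in> B"
    have "transpose_on ip W C (A b) = ?f b" by (rule f) (use b BW in auto)
    then show "representation B (transpose_on ip W C (A b)) b = ip (C b) (A b)"
      using real_vector.representation_sum_scale[OF B(1) ind b, of "\<lambda>a. ip (C a) (A b)"] by simp
  qed
  finally show ?thesis .
qed

lemma span_Union_subspaces:
  assumes "finite \<S>" "\<And>W. W \<in> \<S> \<Longrightarrow> subspace W" "x \<in> span (\<Union>\<S>)"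
  shows "\<exists>g. (\<forall>W\<in>\<S>. g W \<in> W) \<and> x = (\<Sum>W\<in>\<S>. g W)"
proof -
  let ?S = "{x. \<exists>g. (\<forall>W\<in>\<S>. g W \<in> W) \<and> x = (\<Sum>W\<in>\<S>. g W)}"
  have "subspace ?S"
  proof (rule subspaceI)
    show "0 \<in> ?S" using assms(2) by (auto intro!: exI[of _ "\<lambda>_. 0"] subspace_0)
    fix x y assume "x \<in> ?S" "y \<in> ?S"
    then obtain g g' where g: "\<forall>W\<in>\<S>. g W \<in> W" "x = (\<Sum>W\<in>\<S>. g W)"
      and g': "\<forall>W\<in>\<S>. g' W \<in> W" "y = (\<Sum>W\<in>\<S>. g' W)" by auto
    have "\<forall>W\<in>\<S>. g W + g' W \<in> W" using g g' assms(2) by (auto intro: subspace_add)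
    moreover have "x + y = (\<Sum>W\<in>\<S>. g W + g' W)" using g g' by (simp add: sum.distrib)
    ultimately show "x + y \<in> ?S" by (intro CollectI exI[of _ "\<lambda>W. g W + g' W"] conjI)
  next
    fix r x assume "x \<in> ?S"
    then obtain g where g: "\<forall>W\<in>\<S>. g W \<in> W" "x = (\<Sum>W\<in>\<S>. g W)" by auto
    have "\<forall>W\<in>\<S>. r *\<^sub>R g W \<in> W" using g assms(2) by (auto intro: subspace_scale)
    moreover have "r *\<^sub>R x = (\<Sum>W\<in>\<S>. r *\<^sub>R g W)" using g by (simp add: scaleR_sum_right)
    ultimately show "r *\<^sub>R x \<in> ?S" by (intro CollectI exI[of _ "\<lambda>W. r *\<^sub>R g W"] conjI)
  qed
  moreover have "\<Union>\<S> \<subseteq> ?S"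
  proof
    fix x assume "x \<in> \<Union>\<S>"
    then obtain W where W: "W \<in> \<S>" "x \<in> W" by auto
    let ?g = "\<lambda>W'. if W' = W then x else 0"
    have "\<forall>W'\<in>\<S>. ?g W' \<in> W'" using W assms(2) by (auto intro: subspace_0)
    moreover have "x = (\<Sum>W'\<in>\<S>. ?g W')" using W assms(1) by simp
    ultimately show "x \<in> ?S" by (intro CollectI exI[of _ ?g] conjI)
  qed
  ultimately have "span (\<Union>\<S>) \<subseteq> ?S" by (intro span_minimal)
  then show ?thesis using assms(3) by auto
qed

text \<open>The sum of the other summands is a complement by directness of the decomposition.\<close>

lemma component_complement:
  assumes comp: "irreducible_component \<pi> u M V" and lin: "\<And>x. x \<in> u \<Longrightarrow> linear (\<pi> x)"
  shows "\<exists>W. subspace W \<and> (\<forall>x\<in>u. \<forall>w\<in>W. \<pi> x w \<in> W) \<and> V \<inter> W \<subseteq> {0} \<and> M = span (V \<union> W)"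
proof -
  obtain \<W> where "finite \<W> \<and> V \<in> \<W> \<and> (\<forall>W\<in>\<W>. irreducible_module \<pi> u W) \<and> M = span (\<Union>\<W>) \<and>
      (\<forall>f. (\<forall>W\<in>\<W>. f W \<in> W) \<and> (\<Sum>W\<in>\<W>. f W) = 0 \<longrightarrow> (\<forall>W\<in>\<W>. f W = 0))"
    using comp unfolding irreducible_component_def by (elim exE)
  then have \<W>: "finite \<W>" "V \<in> \<W>" "\<forall>W\<in>\<W>. irreducible_module \<pi> u W" "M = span (\<Union>\<W>)"
    and direct: "\<And>f. (\<forall>W\<in>\<W>. f W \<in> W) \<and> (\<Sum>W\<in>\<W>. f W) = 0 \<Longrightarrow> \<forall>W\<in>\<W>. f W = 0"
    by simp_all
  have sub: "subspace W" "x \<in> u \<Longrightarrow> w \<in> W \<Longrightarrow> \<pi> x w \<in> W" if "W \<in> \<W>" for W x w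
    using bspec[OF \<W>(3) that] by (auto simp: irreducible_module_def submodule_def)
  define W where "W = span (\<Union>(\<W> - {V}))"
  show ?thesis
  proof (intro exI[of _ W] conjI)
    show "subspace W" by (simp add: W_def)
    have "\<pi> x w \<in> W" if "x \<in> u" "w \<in> W" for x w
    proof -
      have "\<pi> x ` \<Union>(\<W> - {V}) \<subseteq> W"
        using sub(2)[OF _ that(1)] by (auto simp: W_def intro!: span_base)
      then have "span (\<pi> x ` \<Union>(\<W> - {V})) \<subseteq> W" by (intro span_minimal) (auto simp: W_def)
      then show ?thesis
        using that(2) linear_span_image[OF lin[OF that(1)], of "\<Union>(\<W> - {V})"] by (auto simp: W_def)
    qed
    then show "\<forall>x\<in>u. \<forall>w\<in>W. \<pi> x w \<in> W" by blast
    show "V \<inter> W \<subseteq> {0}"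
    proof
      fix v assume v: "v \<in> V \<inter> W"
      then obtain g where g: "\<And>W. W \<in> \<W> - {V} \<Longrightarrow> g W \<in> W" "v = (\<Sum>W\<in>\<W> - {V}. g W)"
        using span_Union_subspaces[of "\<W> - {V}" v] \<W>(1) sub(1) by (auto simp: W_def)
      define f where "f W = (if W = V then - v else g W)" for W
      have "f W \<in> W" if "W \<in> \<W>" for W
        using that v g sub(1) by (auto simp: f_def intro: subspace_neg)
      moreover have "(\<Sum>W\<in>\<W>. f W) = f V + (\<Sum>W\<in>\<W> - {V}. f W)"
        using \<W>(1,2) by (rule sum.remove)
      moreover have "(\<Sum>W\<in>\<W> - {V}. f W) = v"
        unfolding g(2) by (intro sum.cong refl) (auto simp: f_def)
      ultimately have "\<forall>W\<in>\<W>. f W = 0" by (intro direct) (simp add: f_def)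
      then have "f V = 0" using \<W>(2) by blast
      then show "v \<in> {0}" by (simp add: f_def)
    qed
    have "\<Union>\<W> = V \<union> \<Union>(\<W> - {V})" using \<W>(2) by auto
    then show "M = span (V \<union> W)"
      unfolding \<W>(4) W_def using span_Un_cong[OF refl span_span[symmetric]] by simp
  qed
qed

lemma eigenspace_span:
  assumes D: "finite D" "independent D" "span D = V" and f: "linear f"
    and ev: "\<And>b. b \<in> D \<Longrightarrow> f b = ev b *\<^sub>R b"
  shows "eigenspace_on V f c = span {b \<in> D. ev b = c}"
proof
  have "subspace (eigenspace_on V f c)"
    using D(3) unfolding eigenspace_on_def subspace_def
    by (auto simp: linear_0[OF f] linear_add[OF f] linear_scale[OF f] scaleR_add_right
        span_zero span_add span_scale)
  then show "span {b \<in> D. ev b = c} \<subseteq> eigenspace_on V f c"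
    using D(3) ev by (intro span_minimal) (auto simp: eigenspace_on_def span_base)
  show "eigenspace_on V f c \<subseteq> span {b \<in> D. ev b = c}"
  proof
    fix v assume "v \<in> eigenspace_on V f c"
    then have v: "v \<in> span D" "f v = c *\<^sub>R v" using D(3) by (auto simp: eigenspace_on_def)
    define r where "r = representation D v"
    have v_eq: "(\<Sum>b\<in>D. r b *\<^sub>R b) = v"
      unfolding r_def using real_vector.sum_representation_eq[OF D(2) v(1) D(1) subset_refl] .
    have "0 = f v - c *\<^sub>R v" using v by simp
    also have "\<dots> = (\<Sum>b\<in>D. f (r b *\<^sub>R b)) - (\<Sum>b\<in>D. c *\<^sub>R r b *\<^sub>R b)"
      unfolding v_eq[symmetric] linear_sum[OF f] scaleR_sum_right ..
    also have "\<dots> = (\<Sum>b\<in>D. (r b * (ev b - c)) *\<^sub>R b)"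
      unfolding sum_subtractf[symmetric]
      by (intro sum.cong refl) (simp add: linear_scale[OF f] ev algebra_simps)
    finally have sum0: "(\<Sum>b\<in>D. (r b * (ev b - c)) *\<^sub>R b) = 0" by simp
    have "r b = 0" if "b \<in> D" "ev b \<noteq> c" for b
      using real_vector.representation_sum_scale[OF D(1,2) that(1), of "\<lambda>b. r b * (ev b - c)"] that(2)
      unfolding sum0 by (simp add: real_vector.representation_zero)
    then have "v = (\<Sum>b\<in>{b \<in> D. ev b = c}. r b *\<^sub>R b)"
      unfolding v_eq[symmetric] using D(1) by (intro sum.mono_neutral_right) auto
    then show "v \<in> span {b \<in> D. ev b = c}"
      by (auto intro!: span_sum span_scale intro: span_base)
  qed
qed

section \<open>Existence of a metric of negative Ricci curvature\<close>

theorem theorem5p3: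
  fixes br :: "'g::real_vector \<Rightarrow> 'g \<Rightarrow> 'g"
    and Z :: 'g and u n :: "'g set"
    and h :: "('g \<times> 'g) set" and \<Delta> P :: "('g \<times> 'g \<Rightarrow> complex) set"
    and Hr X :: "('g \<times> 'g \<Rightarrow> complex) \<Rightarrow> 'g \<times> 'g"
    and c :: real and V V1 V2 :: "'g set" and ip :: "'g \<Rightarrow> 'g \<Rightarrow> real"
  assumes "real_lie_algebra br"
    and "compact_semisimple br u"
    and "lie_ideal br n" and "lie_nilpotent scaleR br n"
    and "Z \<noteq> 0" and "\<And>x. x \<in> u \<Longrightarrow> br Z x = 0"
    and "internal_direct_sum (span (insert Z u)) (span {Z}) u"
    and "internal_direct_sum UNIV (span (insert Z u)) n"
    and "diagonalizable_on n (br Z)"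
    and "\<And>d. eigenspace_on n (br Z) d \<noteq> {0} \<Longrightarrow> 0 < d"
    and "compact_root_data br u h \<Delta> P Hr X"
    and "irreducible_component br u (eigenspace_on n (br Z) c) V"
    and "adapted_decomposition br (fst ` complex_scale \<i> ` span (Hr ` \<Delta>)) P
           (\<lambda>\<alpha>. fst (X_up X \<alpha>)) (\<lambda>\<alpha>. fst (Y_up X \<alpha>)) V V1 V2 ip"
  shows "\<exists>ip'. inner_product_on UNIV ip' \<and> negative_ricci br ip'"
proof -
  interpret cr: compact_roots br u h \<Delta> P Hr X
    using assms by (intro compact_roots.intro compact_lie.intro lie_algebra.intro compact_lie_axioms.intro)
  note central = assms(6) and positive = assms(10)
  have XU: "(\<lambda>\<alpha>. fst (X_up X \<alpha>)) = cr.xx" "(\<lambda>\<alpha>. fst (Y_up X \<alpha>)) = cr.yy"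
    by (auto simp: cr.xx_def cr.yy_def)
  note dec = assms(13)[unfolded XU cr.T_def[symmetric] adapted_decomposition_def, folded cr.M_def]
  have dec1: "internal_direct_sum V V1 V2" by (rule dec[THEN conjunct1])
  have ip: "inner_product_on V ip" by (rule dec[THEN conjunct2, THEN conjunct1])
  have T_inv: "\<forall>H\<in>cr.T. br H ` V1 \<subseteq> V1 \<and> br H ` V2 \<subseteq> V2"
    by (rule dec[THEN conjunct2, THEN conjunct2, THEN conjunct1])
  have M_inv: "\<forall>\<alpha>\<in>P. br (cr.xx \<alpha>) ` V1 \<subseteq> V2 \<and> br (cr.yy \<alpha>) ` V1 \<subseteq> V2"
    by (rule dec[THEN conjunct2, THEN conjunct2, THEN conjunct2, THEN conjunct1])
  have M_nz: "\<forall>\<alpha>\<in>P. (\<exists>v\<in>V1. br (cr.xx \<alpha>) v \<noteq> 0) \<and> (\<exists>v\<in>V1. br (cr.yy \<alpha>) v \<noteq> 0)"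
    by (rule dec[THEN conjunct2, THEN conjunct2, THEN conjunct2, THEN conjunct2, THEN conjunct2, THEN conjunct2, THEN conjunct1])
  have M_orth: "\<forall>e\<in>cr.M. \<forall>f\<in>cr.M. e \<noteq> f \<longrightarrow>
      trace_on scaleR V1 (\<lambda>v. transpose_on ip V1 (br f) (br e v)) = 0"
    by (rule dec[THEN conjunct2, THEN conjunct2, THEN conjunct2, THEN conjunct2, THEN conjunct2, THEN conjunct2, THEN conjunct2])
  have M_V2: "br e v \<in> V2" if "e \<in> cr.M" "v \<in> V1" for e v
  proof -
    obtain \<alpha> where "\<alpha> \<in> P" "e = cr.xx \<alpha> \<or> e = cr.yy \<alpha>" using \<open>e \<in> cr.M\<close> by (auto simp: cr.M_def)
    then show ?thesis using bspec[OF M_inv] that(2) by blast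
  qed
  have M_nonzero: "\<exists>v\<in>V1. br e v \<noteq> 0" if "e \<in> cr.M" for e
  proof -
    obtain \<alpha> where "\<alpha> \<in> P" "e = cr.xx \<alpha> \<or> e = cr.yy \<alpha>" using \<open>e \<in> cr.M\<close> by (auto simp: cr.M_def)
    then show ?thesis using bspec[OF M_nz] by blast
  qed
  have V12: "subspace V1" "subspace V2" "V1 \<inter> V2 = {0}" "V = {a + b | a b. a \<in> V1 \<and> b \<in> V2}"
    using dec1 by (auto simp: internal_direct_sum_def)
  have V_span: "V = span (V1 \<union> V2)"
    unfolding span_Un span_eq_iff[THEN iffD2, OF V12(1)] span_eq_iff[THEN iffD2, OF V12(2)]
    using V12(4) by auto
  have V: "subspace V" unfolding V_span by simp
  have V12V: "V1 \<subseteq> V" "V2 \<subseteq> V" 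
    using span_superset[of "V1 \<union> V2"] unfolding V_span by auto
  note comp = assms(12)
  have n: "subspace n" "\<And>x y. y \<in> n \<Longrightarrow> br x y \<in> n" using assms(3) by (auto simp: lie_ideal_def)
  have on_basis: "\<exists>B. finite B \<and> B \<subseteq> V \<and> span B = W \<and> (\<forall>a\<in>B. \<forall>b\<in>B. ip a b = (if a = b then 1 else 0))"
    if W: "subspace W" "W \<subseteq> V" for W
  proof -
    obtain F where F: "finite F" "independent F" "span F = W" by (rule cr.finite_basis[OF W(1)])
    then have "F \<subseteq> V" using span_superset[of F] W(2) by auto
    then show ?thesis using orthonormal_basis_exists[OF ip V F(1)] F(3) by simp
  qed
  obtain B1 where "finite B1 \<and> B1 \<subseteq> V \<and> span B1 = V1 \<and>
      (\<forall>a\<in>B1. \<forall>b\<in>B1. ip a b = (if a = b then 1 else 0))"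
    using on_basis[OF V12(1) V12V(1)] by (elim exE)
  then have B1: "finite B1" "B1 \<subseteq> V" "span B1 = V1"
      "\<And>a b. a \<in> B1 \<Longrightarrow> b \<in> B1 \<Longrightarrow> ip a b = (if a = b then 1 else 0)"
    by simp_all
  obtain B2 where "finite B2 \<and> B2 \<subseteq> V \<and> span B2 = V2 \<and>
      (\<forall>a\<in>B2. \<forall>b\<in>B2. ip a b = (if a = b then 1 else 0))"
    using on_basis[OF V12(2) V12V(2)] by (elim exE)
  then have B2: "finite B2" "B2 \<subseteq> V" "span B2 = V2"
      "\<And>a b. a \<in> B2 \<Longrightarrow> b \<in> B2 \<Longrightarrow> ip a b = (if a = b then 1 else 0)"
    by simp_all
  have ind12: "independent B1" "independent B2"
    by (rule orthonormal_independent[OF ip V B1(1,2) B1(4)]; assumption)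
      (rule orthonormal_independent[OF ip V B2(1,2) B2(4)]; assumption)
  \<comment> \<open>the complement of \<open>V\<close> is its complement in the eigenspace together with all other eigenspaces\<close>
  obtain D where D: "independent D" "span D = n" "\<forall>b\<in>D. \<exists>c. br Z b = c *\<^sub>R b"
    using assms(9) by (auto simp: diagonalizable_on_def)
  then obtain ev where ev: "\<And>b. b \<in> D \<Longrightarrow> br Z b = ev b *\<^sub>R b"
    using bchoice[of D "\<lambda>b c. br Z b = c *\<^sub>R b"] by auto
  have D_fin: "finite D" by (rule cr.independent_finite[OF D(1)])
  have eigen: "eigenspace_on n (br Z) r = span {b \<in> D. ev b = r}" for r
    by (rule eigenspace_span[OF D_fin D(1,2) cr.br_linear(1)]) (rule ev)
  obtain W where "subspace W \<and> (\<forall>x\<in>u. \<forall>w\<in>W. br x w \<in> W) \<and> V \<inter> W \<subseteq> {0} \<and>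
      eigenspace_on n (br Z) c = span (V \<union> W)"
    using component_complement[OF comp cr.br_linear(1)] by (elim exE)
  then have W: "subspace W" "\<And>x w. x \<in> u \<Longrightarrow> w \<in> W \<Longrightarrow> br x w \<in> W" "V \<inter> W \<subseteq> {0}"
      "eigenspace_on n (br Z) c = span (V \<union> W)"
    by simp_all
  obtain BC where BC: "finite BC" "independent BC" "span BC = W" by (rule cr.finite_basis[OF W(1)])
  define Dc where "Dc = {b \<in> D. ev b = c}"
  define DO where "DO = {b \<in> D. ev b \<noteq> c}"
  have D_split: "D = Dc \<union> DO" "Dc \<inter> DO = {}" by (auto simp: Dc_def DO_def)
  have ind_D: "independent Dc" "independent DO"
    by (rule real_vector.independent_mono[OF D(1)]; simp add: D_split(1))+
  have fin_D: "finite Dc" "finite DO" using D_fin D_split by auto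
  have span_Dc: "span Dc = span (V \<union> W)" using eigen[of c] W(4) by (simp add: Dc_def)
  have Dc_DO: "span Dc \<inter> span DO \<subseteq> {0}"
  proof
    fix v assume v: "v \<in> span Dc \<inter> span DO"
    have "representation D v b = 0" for b
    proof -
      have "representation D v = representation Dc v"
        by (rule real_vector.representation_extend[OF D(1)]) (use v D_split in auto)
      moreover have "representation D v = representation DO v"
        by (rule real_vector.representation_extend[OF D(1)]) (use v D_split in auto)
      ultimately show ?thesis
        using real_vector.representation_ne_zero[of Dc v b] real_vector.representation_ne_zero[of DO v b]
          D_split(2) by auto
    qed
    moreover have "(\<Sum>b\<in>D. representation D v b *\<^sub>R b) = v"
      by (rule real_vector.sum_representation_eq[OF D(1) _ D_fin subset_refl])
        (use v D_split(1) span_mono[of Dc D] in auto)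
    ultimately show "v \<in> {0}" by simp
  qed
  have V_W: "span (B1 \<union> B2) = V"
    unfolding V_span
    by (rule span_Un_cong) (simp_all only: B1(3)[symmetric] B2(3)[symmetric] span_span)
  define BW where "BW = BC \<union> DO"
  have BC_sub: "span BC \<subseteq> span Dc" unfolding span_Dc BC(3) using span_superset by blast
  have "span BC \<inter> span DO \<subseteq> {0}" using Dc_DO BC_sub by blast
  note BCO = independent_Un_disjoint_span[OF BC(1) fin_D(2) BC(2) ind_D(2) this, folded BW_def]
  have B12: "independent (B1 \<union> B2)" "B1 \<inter> B2 = {}"
    using independent_Un_disjoint_span[OF B1(1) B2(1) ind12] B1(3) B2(3) V12(3) by auto
  have V_BW: "span (B1 \<union> B2) \<inter> span BW \<subseteq> {0}"
  proof
    fix v assume v: "v \<in> span (B1 \<union> B2) \<inter> span BW"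
    then obtain a b where ab: "a \<in> W" "b \<in> span DO" "v = a + b" and vV: "v \<in> V"
      unfolding BW_def V_W by (auto simp: span_Un BC(3))
    have "v - a \<in> span Dc"
      unfolding span_Dc using ab vV by (intro span_diff span_base) auto
    then have "b = 0" using ab Dc_DO by auto
    then show "v \<in> {0}" using ab vV W(3) by auto
  qed
  have BN: "independent (B1 \<union> B2 \<union> BW)" "(B1 \<union> B2) \<inter> BW = {}"
    using independent_Un_disjoint_span[of "B1 \<union> B2" BW] B1(1) B2(1) BC(1) fin_D B12 BCO V_BW
    by (simp_all add: BW_def)
  have span_N: "span (B1 \<union> B2 \<union> BW) = n"
  proof -
    have "span (B1 \<union> B2 \<union> BW) = span ((B1 \<union> B2) \<union> BC \<union> DO)" by (simp add: BW_def Un_assoc)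
    also have "\<dots> = span (Dc \<union> DO)"
    proof (rule span_Un_cong)
      have "span ((B1 \<union> B2) \<union> BC) = span (V \<union> W)"
        by (rule span_Un_cong) (simp_all only: V_W[symmetric] BC(3)[symmetric] span_span)
      then show "span ((B1 \<union> B2) \<union> BC) = span Dc" by (simp add: span_Dc)
    qed simp
    finally show ?thesis using D(2) D_split by simp
  qed
  have eig_c: "br Z b = c *\<^sub>R b \<and> 0 < c" if "b \<in> B1 \<union> B2 \<union> BC" "b \<noteq> 0" for b
  proof -
    have "b \<in> span (V \<union> W)"
      using that B1(2) B2(2) BC(3) span_superset[of BC] by (auto intro!: span_base)
    then have b: "b \<in> eigenspace_on n (br Z) c" using W(4) by simp
    then have "0 < c" using positive[of c] that(2) by blast
    then show ?thesis using b by (simp add: eigenspace_on_def)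
  qed
  have eig_O: "0 < ev b" if "b \<in> DO" for b
  proof -
    have "b \<in> D" using that by (simp add: DO_def)
    then have "b \<in> eigenspace_on n (br Z) (ev b)" unfolding eigen by (intro span_base) simp
    moreover have "b \<noteq> 0" using \<open>b \<in> D\<close> D(1) dependent_zero by blast
    ultimately show ?thesis using positive[of "ev b"] by blast
  qed
  have uW: "br x w \<in> span BW" if "x \<in> u" "w \<in> BW" for x w
  proof (cases "w \<in> BC")
    case True
    then have "br x w \<in> W" using W(2)[OF that(1)] BC(3) span_base by blast
    then show ?thesis unfolding BC(3)[symmetric] BW_def using span_mono[of BC "BC \<union> DO"] by auto
  next
    case False
    then have w: "w \<in> D" "ev w \<noteq> c" "br Z w = ev w *\<^sub>R w" using that(2) ev by (auto simp: BW_def DO_def)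
    have wn: "w \<in> n" using w(1) D(2) span_base by blast
    \<comment> \<open>eigenspaces of \<open>ad Z\<close> are submodules because \<open>Z\<close> commutes with \<open>u\<close>\<close>
    have "br Z (br x w) = ev w *\<^sub>R br x w"
      using cr.jacobi[of Z x w] central[OF that(1)] w by (simp add: cr.br_simps)
    then have "br x w \<in> eigenspace_on n (br Z) (ev w)" using n(2)[OF wn] by (simp add: eigenspace_on_def)
    then have "br x w \<in> span {b \<in> D. ev b = ev w}" unfolding eigen .
    moreover have "{b \<in> D. ev b = ev w} \<subseteq> BW" using w(2) by (auto simp: BW_def DO_def)
    ultimately show ?thesis using span_mono by blast
  qed
  obtain BT where BT: "finite BT" "independent BT" "span BT = cr.T"
    using cr.finite_basis[of cr.T] by (metis cr.T_span subspace_span)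
  have TM: "independent (BT \<union> cr.M)" "BT \<inter> cr.M = {}"
    using independent_Un_disjoint_span[OF BT(1) cr.M_finite BT(2) cr.M_independent]
      BT(3) cr.T_Int_span_M by auto
  have span_TM: "span (BT \<union> cr.M) = u"
    unfolding cr.u_span_T_M by (rule span_Un_cong) (simp_all only: BT(3)[symmetric] span_span)
  have Zu: "span {Z} \<inter> span (BT \<union> cr.M) \<subseteq> {0}"
    using assms(7) by (simp add: internal_direct_sum_def span_TM)
  have indZ: "independent {Z}" using assms(5) by simp
  have fin_TM: "finite (BT \<union> cr.M)" using BT(1) cr.M_finite by simp
  have ZTM: "independent ({Z} \<union> (BT \<union> cr.M))" "{Z} \<inter> (BT \<union> cr.M) = {}"
    using independent_Un_disjoint_span[OF _ fin_TM indZ TM(1) Zu] by auto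
  have span_ZTM: "span ({Z} \<union> (BT \<union> cr.M)) = span (insert Z u)"
    unfolding insert_is_Un[of Z u] by (rule span_Un_cong) (simp_all only: span_TM[symmetric] span_span)
  have direct: "span (insert Z u) \<inter> n = {0}" "UNIV = {a + b | a b. a \<in> span (insert Z u) \<and> b \<in> n}"
    using assms(8) by (auto simp: internal_direct_sum_def)
  have fin_N: "finite (B1 \<union> B2 \<union> BW)" using B1 B2 BC fin_D by (simp add: BW_def)
  have all: "independent (({Z} \<union> (BT \<union> cr.M)) \<union> (B1 \<union> B2 \<union> BW))"
      "({Z} \<union> (BT \<union> cr.M)) \<inter> (B1 \<union> B2 \<union> BW) = {}"
    using independent_Un_disjoint_span[OF _ fin_N ZTM(1) BN(1)] fin_TM direct(1)
    unfolding span_ZTM span_N by auto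
  have span_all: "span (({Z} \<union> (BT \<union> cr.M)) \<union> (B1 \<union> B2 \<union> BW)) = UNIV"
    unfolding span_Un[of "{Z} \<union> (BT \<union> cr.M)"] span_ZTM span_N by (rule direct(2)[symmetric])
  have U_eq: "({Z} \<union> (BT \<union> cr.M)) \<union> (B1 \<union> B2 \<union> BW) = insert Z (BT \<union> cr.M \<union> (B1 \<union> B2 \<union> BW))"
    by auto
  define d where "d b = (if b \<in> DO then ev b else c)" for b
  have nonzero: "b \<noteq> 0" if "b \<in> B1 \<union> B2 \<union> BW" for b
    using BN(1) that dependent_zero[of "B1 \<union> B2 \<union> BW"] by auto
  have V1_ne: "B1 \<union> B2 \<union> BW \<noteq> {}"
  proof -
    have "V \<noteq> {0}" using comp by (auto simp: irreducible_component_def irreducible_module_def)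
    then have "span (B1 \<union> B2) \<noteq> span {}" using V_W by simp
    then show ?thesis by auto
  qed
  have e_lin: "br e ` V1 \<subseteq> V" if "e \<in> cr.M" for e using M_V2[OF that] V12V by auto
  interpret ab: adapted_basis br u h \<Delta> P Hr X Z BT B1 B2 BW d
  proof
    show "independent (insert Z (BT \<union> cr.M \<union> (B1 \<union> B2 \<union> BW)))" using all(1) unfolding U_eq .
    show "span (insert Z (BT \<union> cr.M \<union> (B1 \<union> B2 \<union> BW))) = UNIV" using span_all unfolding U_eq .
    show "Z \<notin> BT \<union> cr.M \<union> (B1 \<union> B2 \<union> BW)" "BT \<inter> cr.M = {}"
      "(BT \<union> cr.M) \<inter> (B1 \<union> B2 \<union> BW) = {}" "B1 \<inter> B2 = {}" "(B1 \<union> B2) \<inter> BW = {}"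
      using ZTM(2) TM(2) all(2) B12(2) BN(2) by auto
    show "span BT = cr.T" by (rule BT(3))
    show "br x y \<in> span (B1 \<union> B2 \<union> BW)" if "y \<in> span (B1 \<union> B2 \<union> BW)" for x y
      using that unfolding span_N by (rule n(2))
    show "br Z x = 0" if "x \<in> u" for x by (rule central[OF that])
    show "br Z b = d b *\<^sub>R b" "0 < d b" if b: "b \<in> B1 \<union> B2 \<union> BW" for b
    proof -
      have "br Z b = d b *\<^sub>R b \<and> 0 < d b"
      proof (cases "b \<in> DO")
        case True then show ?thesis using ev eig_O by (simp add: d_def DO_def)
      next
        case False
        then show ?thesis using eig_c[OF _ nonzero[OF b]] b by (auto simp: d_def BW_def)
      qed
      then show "br Z b = d b *\<^sub>R b" "0 < d b" by auto
    qed
    show "B1 \<union> B2 \<union> BW \<noteq> {}" by (rule V1_ne)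
    show "br H v \<in> span B1" if "H \<in> cr.T" "v \<in> B1" for H v
      using bspec[OF T_inv that(1)] span_base[OF that(2)] B1(3) by blast
    show "br H v \<in> span B2" if "H \<in> cr.T" "v \<in> B2" for H v
      using bspec[OF T_inv that(1)] span_base[OF that(2)] B2(3) by blast
    show "br x v \<in> span BW" if "x \<in> u" "v \<in> BW" for x v by (rule uW[OF that])
    show M1: "br e v \<in> span B2" if "e \<in> cr.M" "v \<in> B1" for e v
      using M_V2[OF that(1)] span_base[OF that(2)] B1(3) B2(3) by simp
    show "(\<Sum>b\<in>B1. \<Sum>b'\<in>B2. representation B2 (br e b) b' * representation B2 (br f b) b') = 0"
      if ef: "e \<in> cr.M" "f \<in> cr.M" "e \<noteq> f" for e f
    proof -
      have rep: "representation B2 (br e b) b' = ip (br e b) b'" if "e \<in> cr.M" "b \<in> B1" "b' \<in> B2" for e b b'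
        by (rule orthonormal_representation[OF ip V B2(1,2,4) M1[OF that(1,2)] that(3)])
      have pars: "ip (br f b) (br e b) = (\<Sum>b'\<in>B2. representation B2 (br e b) b' * representation B2 (br f b) b')"
        if b: "b \<in> B1" for b
      proof -
        have in_V: "br e b \<in> V" "br f b \<in> V"
          using e_lin ef b B1(3) span_base by blast+
        have "ip (br e b) (br f b) = ip (\<Sum>b'\<in>B2. representation B2 (br e b) b' *\<^sub>R b') (br f b)"
          using real_vector.sum_representation_eq[OF ind12(2) M1[OF ef(1) b] B2(1) subset_refl] by simp
        also have "\<dots> = (\<Sum>b'\<in>B2. ip (representation B2 (br e b) b' *\<^sub>R b') (br f b))"
          using B2(1,2) in_V V by (intro inner_product_on_sum[OF ip V]) (auto intro!: subspace_scale)
        also have "\<dots> = (\<Sum>b'\<in>B2. representation B2 (br e b) b' * representation B2 (br f b) b')"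
        proof (rule sum.cong[OF refl])
          fix b' assume b': "b' \<in> B2"
          then have "b' \<in> V" using B2(2) by auto
          then show "ip (representation B2 (br e b) b' *\<^sub>R b') (br f b)
              = representation B2 (br e b) b' * representation B2 (br f b) b'"
            using inner_product_onD(2)[OF ip _ in_V(2)] inner_product_onD(3)[OF ip _ in_V(2)]
              rep[OF ef(2) b b'] by simp
        qed
        finally show ?thesis using inner_product_onD(3)[OF ip in_V] by simp
      qed
      have "(\<Sum>b\<in>B1. ip (br f b) (br e b)) = 0"
        using M_orth ef trace_on_transpose[OF ip V B1 cr.br_linear(1) e_lin[OF ef(1)]
            cr.br_linear(1) e_lin[OF ef(2)]] by simp
      then show ?thesis using pars by simp
    qed
    show "\<exists>v\<in>B1. br e v \<noteq> 0" if "e \<in> cr.M" for e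
    proof (rule ccontr)
      assume "\<not> (\<exists>v\<in>B1. br e v \<noteq> 0)"
      then have "br e v = 0" if "v \<in> span B1" for v
        using linear_eq_0_on_span[OF cr.br_linear(1), of B1 e v] that by blast
      then show False using M_nonzero[OF that] B1(3) by blast
    qed
  qed
  show ?thesis by (rule ab.negative_ricci_exists)
qed

end
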